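(* Let $T$ be a complete first-order theory with monster model $\mathfrak{C}$, let $A\subset\mathfrak{C}$ be small, and let $\bar p\in S(\mathfrak{C})$ be a global type generically stable over $A$. Let $f_c$ be a partial definable function, defined by an $L$-formula with parameter $c\in\mathfrak{C}$, such that $f_c(a)$ is defined for every $a$ realizing $\bar p$. Then the germ of $f_c$ on $\bar p$ is strong over $A$; that is, for $a$ realizing $\bar p$, $f_c(a)\in\operatorname{dcl}(c/E,a,A)$, where $c/E$ is the germ of $f_c$ on $\bar p$.
   Context: A global type $\bar p$ is $A$-invariant if for each formula $\varphi(x,y)$, whether $\varphi(x,b)\in\bar p$ depends only on $\operatorname{tp}(b/A)$. For $A$-invariant $\bar p$, a Morley sequence over $A$ is $(a_i:i<\alpha)$ with $a_i\models\bar p\restriction Aa_{<i}$. $\bar p$ is generically stable over $A$ if it is $A$-invariant and for every ordinal $\alpha\ge\omega$ and every Morley sequence $(a_i:i<\alpha)$ of $\bar p$ over $A$, the set of formulas over $\mathfrak{C}$ satisfied by all but finitely many $a_i$ is a complete type; such $\bar p$ is definable over $A$. Germs: for $\bar p$ definable over $A$ and $f_c$ defined on $\bar p$, define the equivalence relation $E$ on realizations of $\operatorname{tp}(c/A)$ in $\mathfrak{C}$ by $E(c_1,c_2)$ iff $f_{c_1}(a)=f_{c_2}(a)$ for some (equivalently any) $a$ realizing $\bar p$ (in an elementary extension of $\mathfrak{C}$). $E$ is $A$-definable, and the imaginary $c/E$ (in $\mathfrak{C}^{eq}$) is called the germ of $f_c$ on $\bar p$. The germ is strong over $A$ if for $a$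 realizing $\bar p$, $f_c(a)\in\operatorname{dcl}(c/E,a,A)$. *)

theory Defs
  imports Main
begin

section \<open>First-order logic\<close>

record ('f, 'r) lang =
  fsyms :: "('f \<times> nat) set"
  rsyms :: "('r \<times> nat) set"

datatype 'f tm = Var nat | Fn 'f "'f tm list"

datatype ('f, 'r) fm =
    Eq "'f tm" "'f tm"
  | Rel 'r "'f tm list"
  | Neg "('f, 'r) fm"
  | And "('f, 'r) fm" "('f, 'r) fm"
  | Ex nat "('f, 'r) fm"

fun wf_tm :: "('f, 'r) lang \<Rightarrow> 'f tm \<Rightarrow> bool" where
  "wf_tm L (Var i) \<longleftrightarrow> True"
| "wf_tm L (Fn f ts) \<longleftrightarrow> (f, length ts) \<in> fsyms L \<and> (\<forall>t\<in>set ts. wf_tm L t)"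

fun wf_fm :: "('f, 'r) lang \<Rightarrow> ('f, 'r) fm \<Rightarrow> bool" where
  "wf_fm L (Eq s t) \<longleftrightarrow> wf_tm L s \<and> wf_tm L t"
| "wf_fm L (Rel R ts) \<longleftrightarrow> (R, length ts) \<in> rsyms L \<and> (\<forall>t\<in>set ts. wf_tm L t)"
| "wf_fm L (Neg \<phi>) \<longleftrightarrow> wf_fm L \<phi>"
| "wf_fm L (And \<phi> \<psi>) \<longleftrightarrow> wf_fm L \<phi> \<and> wf_fm L \<psi>"
| "wf_fm L (Ex i \<phi>) \<longleftrightarrow> wf_fm L \<phi>"

fun fv_tm :: "'f tm \<Rightarrow> nat set" where
  "fv_tm (Var i) = {i}"
| "fv_tm (Fn f ts) = (\<Union>t\<in>set ts. fv_tm t)"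

fun fv :: "('f, 'r) fm \<Rightarrow> nat set" where
  "fv (Eq s t) = fv_tm s \<union> fv_tm t"
| "fv (Rel R ts) = (\<Union>t\<in>set ts. fv_tm t)"
| "fv (Neg \<phi>) = fv \<phi>"
| "fv (And \<phi> \<psi>) = fv \<phi> \<union> fv \<psi>"
| "fv (Ex i \<phi>) = fv \<phi> - {i}"

text \<open>L-formulas in the free variables \<open>x\<^sub>0, \<dots>, x\<^sub>m\<^sub>-\<^sub>1\<close>.\<close>

definition fml :: "('f, 'r) lang \<Rightarrow> nat \<Rightarrow> ('f, 'r) fm set" where
  "fml L m = {\<phi>. wf_fm L \<phi> \<and> fv \<phi> \<subseteq> {..<m}}"

record ('f, 'r, 'a) struc =
  univ :: "'a set"
  fint :: "'f \<Rightarrow> 'a list \<Rightarrow> 'a"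
  rint :: "'r \<Rightarrow> 'a list \<Rightarrow> bool"

definition tup :: "'a set \<Rightarrow> nat \<Rightarrow> 'a list set" where
  "tup B m = {xs. length xs = m \<and> set xs \<subseteq> B}"

definition is_struc :: "('f, 'r) lang \<Rightarrow> ('f, 'r, 'a) struc \<Rightarrow> bool" where
  "is_struc L M \<longleftrightarrow> univ M \<noteq> {} \<and>
     (\<forall>(f, m)\<in>fsyms L. \<forall>xs\<in>tup (univ M) m. fint M f xs \<in> univ M)"

fun tval :: "('f, 'r, 'a) struc \<Rightarrow> (nat \<Rightarrow> 'a) \<Rightarrow> 'f tm \<Rightarrow> 'a" where
  "tval M \<rho> (Var i) = \<rho> i"
| "tval M \<rho> (Fn f ts) = fint M f (map (tval M \<rho>) ts)"

fun sat :: "('f, 'r, 'a) struc \<Rightarrow> (nat \<Rightarrow> 'a) \<Rightarrow> ('f, 'r) fm \<Rightarrow> bool" where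
  "sat M \<rho> (Eq s t) \<longleftrightarrow> tval M \<rho> s = tval M \<rho> t"
| "sat M \<rho> (Rel R ts) \<longleftrightarrow> rint M R (map (tval M \<rho>) ts)"
| "sat M \<rho> (Neg \<phi>) \<longleftrightarrow> \<not> sat M \<rho> \<phi>"
| "sat M \<rho> (And \<phi> \<psi>) \<longleftrightarrow> sat M \<rho> \<phi> \<and> sat M \<rho> \<psi>"
| "sat M \<rho> (Ex i \<phi>) \<longleftrightarrow> (\<exists>x\<in>univ M. sat M (\<rho>(i := x)) \<phi>)"

text \<open>\<open>holds M \<phi> xs\<close> is only meant for \<open>\<phi> \<in> fml L (length xs)\<close>, where the
  values of \<open>(!) xs\<close> beyond the length of \<open>xs\<close> do not matter.\<close>

definition holds :: "('f, 'r, 'a) struc \<Rightarrow> ('f, 'r) fm \<Rightarrow> 'a list \<Rightarrow> bool" where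
  "holds M \<phi> xs \<longleftrightarrow> sat M ((!) xs) \<phi>"

text \<open>A theory is complete if it decides every sentence; theories are taken to be
  deductively closed, and consistency comes from the existence of a model.\<close>

definition complete_theory :: "('f, 'r) lang \<Rightarrow> ('f, 'r) fm set \<Rightarrow> bool" where
  "complete_theory L T \<longleftrightarrow> T \<subseteq> fml L 0 \<and> (\<forall>\<phi>\<in>fml L 0. \<phi> \<in> T \<or> Neg \<phi> \<in> T)"

definition models :: "('f, 'r) lang \<Rightarrow> ('f, 'r, 'a) struc \<Rightarrow> ('f, 'r) fm set \<Rightarrow> bool" where
  "models L M T \<longleftrightarrow> is_struc L M \<and> (\<forall>\<phi>\<in>T. holds M \<phi> [])"

text \<open>Elementary extensions of \<open>M\<close>, up to identifying \<open>M\<close> with its image under \<open>h\<close>.\<close>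

definition elementary_ext ::
  "('f, 'r) lang \<Rightarrow> ('f, 'r, 'a) struc \<Rightarrow> ('f, 'r, 'b) struc \<Rightarrow> ('a \<Rightarrow> 'b) \<Rightarrow> bool" where
  "elementary_ext L M N h \<longleftrightarrow> is_struc L N \<and> h ` univ M \<subseteq> univ N \<and>
     (\<forall>xs. set xs \<subseteq> univ M \<longrightarrow>
        (\<forall>\<phi>\<in>fml L (length xs). holds M \<phi> xs \<longleftrightarrow> holds N \<phi> (map h xs)))"

section \<open>Types\<close>

text \<open>The pair \<open>(\<phi>, b)\<close> stands for the formula \<open>\<phi>(x, b)\<close> where \<open>x\<close> is an \<open>n\<close>-tuple of variables:
  the variables of index below \<open>n\<close> are \<open>x\<close>, the following \<open>length b\<close> ones are replaced by \<open>b\<close>.\<close>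

definition insts :: "('f, 'r) lang \<Rightarrow> nat \<Rightarrow> 'a set \<Rightarrow> (('f, 'r) fm \<times> 'a list) set" where
  "insts L n B = {(\<phi>, b). set b \<subseteq> B \<and> \<phi> \<in> fml L (n + length b)}"

definition realizes ::
  "('f, 'r, 'b) struc \<Rightarrow> ('a \<Rightarrow> 'b) \<Rightarrow> nat \<Rightarrow> (('f, 'r) fm \<times> 'a list) set \<Rightarrow> 'b list \<Rightarrow> bool" where
  "realizes N h n p a \<longleftrightarrow> a \<in> tup (univ N) n \<and> (\<forall>(\<phi>, b)\<in>p. holds N \<phi> (a @ map h b))"

text \<open>The space of complete \<open>n\<close>-types over \<open>B\<close>; consistency with the elementary diagram of \<open>M\<close>
  is finite satisfiability in \<open>M\<close>.\<close>

definition types ::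
  "('f, 'r) lang \<Rightarrow> ('f, 'r, 'a) struc \<Rightarrow> nat \<Rightarrow> 'a set \<Rightarrow> (('f, 'r) fm \<times> 'a list) set set" where
  "types L M n B = {p. p \<subseteq> insts L n B \<and>
     (\<forall>q\<subseteq>p. finite q \<longrightarrow> (\<exists>a. realizes M id n q a)) \<and>
     (\<forall>(\<phi>, b)\<in>insts L n B. (\<phi>, b) \<in> p \<or> (Neg \<phi>, b) \<in> p)}"

definition tp ::
  "('f, 'r) lang \<Rightarrow> ('f, 'r, 'a) struc \<Rightarrow> 'a set \<Rightarrow> 'a list \<Rightarrow> (('f, 'r) fm \<times> 'a list) set" where
  "tp L M B a = {(\<phi>, b)\<in>insts L (length a) B. holds M \<phi> (a @ b)}"

definition restr :: "(('f, 'r) fm \<times> 'a list) set \<Rightarrow> 'a set \<Rightarrow> (('f, 'r) fm \<times> 'a list) set" where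
  "restr p B = {(\<phi>, b)\<in>p. set b \<subseteq> B}"

section \<open>Monster models\<close>

definition small :: "'k rel \<Rightarrow> 'a set \<Rightarrow> bool" where
  "small \<kappa> B \<longleftrightarrow> (card_of B, \<kappa>) \<in> ordLess"

definition automorphism :: "('f, 'r) lang \<Rightarrow> ('f, 'r, 'a) struc \<Rightarrow> ('a \<Rightarrow> 'a) \<Rightarrow> bool" where
  "automorphism L M \<sigma> \<longleftrightarrow> bij_betw \<sigma> (univ M) (univ M) \<and>
     (\<forall>(f, m)\<in>fsyms L. \<forall>xs\<in>tup (univ M) m. \<sigma> (fint M f xs) = fint M f (map \<sigma> xs)) \<and>
     (\<forall>(R, m)\<in>rsyms L. \<forall>xs\<in>tup (univ M) m. rint M R xs \<longleftrightarrow> rint M R (map \<sigma> xs))"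

definition saturated :: "('f, 'r) lang \<Rightarrow> 'k rel \<Rightarrow> ('f, 'r, 'a) struc \<Rightarrow> bool" where
  "saturated L \<kappa> M \<longleftrightarrow> (\<forall>B n. B \<subseteq> univ M \<and> small \<kappa> B \<longrightarrow>
     (\<forall>p\<in>types L M n B. \<exists>a. realizes M id n p a))"

definition partial_elementary ::
  "('f, 'r) lang \<Rightarrow> ('f, 'r, 'a) struc \<Rightarrow> 'a set \<Rightarrow> ('a \<Rightarrow> 'a) \<Rightarrow> bool" where
  "partial_elementary L M B g \<longleftrightarrow> B \<subseteq> univ M \<and> g ` B \<subseteq> univ M \<and>
     (\<forall>xs. set xs \<subseteq> B \<longrightarrow>
        (\<forall>\<phi>\<in>fml L (length xs). holds M \<phi> xs \<longleftrightarrow> holds M \<phi> (map g xs)))"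

definition strongly_homogeneous :: "('f, 'r) lang \<Rightarrow> 'k rel \<Rightarrow> ('f, 'r, 'a) struc \<Rightarrow> bool" where
  "strongly_homogeneous L \<kappa> M \<longleftrightarrow>
     (\<forall>B g. small \<kappa> B \<and> partial_elementary L M B g \<longrightarrow>
        (\<exists>\<sigma>. automorphism L M \<sigma> \<and> (\<forall>b\<in>B. \<sigma> b = g b)))"

definition monster_model ::
  "('f, 'r) lang \<Rightarrow> ('f, 'r) fm set \<Rightarrow> 'k rel \<Rightarrow> ('f, 'r, 'a) struc \<Rightarrow> bool" where
  "monster_model L T \<kappa> M \<longleftrightarrow> models L M T \<and> Card_order \<kappa> \<and>
     small \<kappa> (UNIV :: nat set) \<and> small \<kappa> (fsyms L) \<and> small \<kappa> (rsyms L) \<and>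
     saturated L \<kappa> M \<and> strongly_homogeneous L \<kappa> M"

section \<open>Generic stability\<close>

definition invariant_type ::
  "('f, 'r) lang \<Rightarrow> ('f, 'r, 'a) struc \<Rightarrow> nat \<Rightarrow> 'a set \<Rightarrow> (('f, 'r) fm \<times> 'a list) set \<Rightarrow> bool" where
  "invariant_type L M n A p \<longleftrightarrow>
     (\<forall>m. \<forall>\<phi>\<in>fml L (n + m). \<forall>b\<in>tup (univ M) m. \<forall>b'\<in>tup (univ M) m.
        tp L M A b = tp L M A b' \<longrightarrow> ((\<phi>, b) \<in> p \<longleftrightarrow> (\<phi>, b') \<in> p))"

text \<open>The index ordinal is the well-order \<open>r\<close>; \<open>underS r i\<close> is the set of strict predecessors of \<open>i\<close>.\<close>

definition morley_sequence ::
  "('f, 'r, 'a) struc \<Rightarrow> nat \<Rightarrow> 'a set \<Rightarrow> (('f, 'r) fm \<times> 'a list) set \<Rightarrow>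
   'i rel \<Rightarrow> ('i \<Rightarrow> 'a list) \<Rightarrow> bool" where
  "morley_sequence M n A p r s \<longleftrightarrow>
     (\<forall>i\<in>Field r. realizes M id n (restr p (A \<union> (\<Union>j\<in>underS r i. set (s j)))) (s i))"

text \<open>Ordinals \<open>\<alpha> \<ge> \<omega>\<close> are infinite well-orders on subsets of \<open>'a + nat\<close>. This represents every
  infinite ordinal of cardinality at most that of \<open>'a + nat\<close>. Longer sequences give no further
  condition: if \<open>\<phi>\<close> and \<open>\<not> \<phi>\<close> both hold infinitely often along a Morley sequence, they do so
  along a subsequence of countable length, which is again a Morley sequence.\<close>

definition generically_stable ::
  "('f, 'r) lang \<Rightarrow> ('f, 'r, 'a) struc \<Rightarrow> nat \<Rightarrow> 'a set \<Rightarrow> (('f, 'r) fm \<times> 'a list) set \<Rightarrow> bool" where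
  "generically_stable L M n A p \<longleftrightarrow> invariant_type L M n A p \<and>
     (\<forall>(r :: ('a + nat) rel) s.
        Well_order r \<and> infinite (Field r) \<and> morley_sequence M n A p r s \<longrightarrow>
        {(\<phi>, b)\<in>insts L n (univ M). finite {i\<in>Field r. \<not> holds M \<phi> (s i @ b)}}
          \<in> types L M n (univ M))"

section \<open>Imaginaries\<close>

definition eq_formula ::
  "('f, 'r) lang \<Rightarrow> ('f, 'r, 'a) struc \<Rightarrow> nat \<Rightarrow> ('f, 'r) fm \<Rightarrow> bool" where
  "eq_formula L M m F \<longleftrightarrow> F \<in> fml L (m + m) \<and>
     equiv (tup (univ M) m) {(x, y). x \<in> tup (univ M) m \<and> y \<in> tup (univ M) m \<and> holds M F (x @ y)}"

definition eclass :: "('f, 'r, 'a) struc \<Rightarrow> nat \<Rightarrow> ('f, 'r) fm \<Rightarrow> 'a list \<Rightarrow> 'a list set" where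
  "eclass M m F x = {y\<in>tup (univ M) m. holds M F (x @ y)}"

text \<open>\<open>M\<^sup>e\<^sup>q\<close> as a many-sorted structure: the home sort, a sort \<open>Quot m F\<close> for every 0-definable
  equivalence relation \<open>F\<close> on \<open>m\<close>-tuples, the symbols of \<open>L\<close> on the home sort, and the
  projections from \<open>m\<close>-tuples onto \<open>Quot m F\<close>.\<close>

datatype ('f, 'r) esort = Home | Quot nat "('f, 'r) fm"

datatype ('f, 'r, 'a) eqel = Real (the_real: 'a) | Imag nat "('f, 'r) fm" "'a list set"

fun is_sort :: "('f, 'r) lang \<Rightarrow> ('f, 'r, 'a) struc \<Rightarrow> ('f, 'r) esort \<Rightarrow> bool" where
  "is_sort L M Home \<longleftrightarrow> True"
| "is_sort L M (Quot m F) \<longleftrightarrow> eq_formula L M m F"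

fun edom :: "('f, 'r, 'a) struc \<Rightarrow> ('f, 'r) esort \<Rightarrow> ('f, 'r, 'a) eqel set" where
  "edom M Home = Real ` univ M"
| "edom M (Quot m F) = (\<lambda>x. Imag m F (eclass M m F x)) ` tup (univ M) m"

datatype ('f, 'r) etm =
    EVar "('f, 'r) esort" nat
  | EFn 'f "('f, 'r) etm list"
  | EProj nat "('f, 'r) fm" "('f, 'r) etm list"

datatype ('f, 'r) efm =
    EEq "('f, 'r) etm" "('f, 'r) etm"
  | ERel 'r "('f, 'r) etm list"
  | ENeg "('f, 'r) efm"
  | EAnd "('f, 'r) efm" "('f, 'r) efm"
  | EEx "('f, 'r) esort" nat "('f, 'r) efm"

fun sort_of :: "('f, 'r) etm \<Rightarrow> ('f, 'r) esort" where
  "sort_of (EVar S i) = S"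
| "sort_of (EFn f ts) = Home"
| "sort_of (EProj m F ts) = Quot m F"

fun wf_etm :: "('f, 'r) lang \<Rightarrow> ('f, 'r, 'a) struc \<Rightarrow> ('f, 'r) etm \<Rightarrow> bool" where
  "wf_etm L M (EVar S i) \<longleftrightarrow> is_sort L M S"
| "wf_etm L M (EFn f ts) \<longleftrightarrow> (f, length ts) \<in> fsyms L \<and>
     (\<forall>t\<in>set ts. wf_etm L M t \<and> sort_of t = Home)"
| "wf_etm L M (EProj m F ts) \<longleftrightarrow> is_sort L M (Quot m F) \<and> length ts = m \<and>
     (\<forall>t\<in>set ts. wf_etm L M t \<and> sort_of t = Home)"

fun wf_efm :: "('f, 'r) lang \<Rightarrow> ('f, 'r, 'a) struc \<Rightarrow> ('f, 'r) efm \<Rightarrow> bool" where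
  "wf_efm L M (EEq s t) \<longleftrightarrow> wf_etm L M s \<and> wf_etm L M t \<and> sort_of s = sort_of t"
| "wf_efm L M (ERel R ts) \<longleftrightarrow> (R, length ts) \<in> rsyms L \<and>
     (\<forall>t\<in>set ts. wf_etm L M t \<and> sort_of t = Home)"
| "wf_efm L M (ENeg \<phi>) \<longleftrightarrow> wf_efm L M \<phi>"
| "wf_efm L M (EAnd \<phi> \<psi>) \<longleftrightarrow> wf_efm L M \<phi> \<and> wf_efm L M \<psi>"
| "wf_efm L M (EEx S i \<phi>) \<longleftrightarrow> is_sort L M S \<and> wf_efm L M \<phi>"

fun fv_etm :: "('f, 'r) etm \<Rightarrow> (('f, 'r) esort \<times> nat) set" where
  "fv_etm (EVar S i) = {(S, i)}"
| "fv_etm (EFn f ts) = (\<Union>t\<in>set ts. fv_etm t)"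
| "fv_etm (EProj m F ts) = (\<Union>t\<in>set ts. fv_etm t)"

fun fv_efm :: "('f, 'r) efm \<Rightarrow> (('f, 'r) esort \<times> nat) set" where
  "fv_efm (EEq s t) = fv_etm s \<union> fv_etm t"
| "fv_efm (ERel R ts) = (\<Union>t\<in>set ts. fv_etm t)"
| "fv_efm (ENeg \<phi>) = fv_efm \<phi>"
| "fv_efm (EAnd \<phi> \<psi>) = fv_efm \<phi> \<union> fv_efm \<psi>"
| "fv_efm (EEx S i \<phi>) = fv_efm \<phi> - {(S, i)}"

fun etval :: "('f, 'r, 'a) struc \<Rightarrow> (('f, 'r) esort \<times> nat \<Rightarrow> ('f, 'r, 'a) eqel) \<Rightarrow>
    ('f, 'r) etm \<Rightarrow> ('f, 'r, 'a) eqel" where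
  "etval M \<rho> (EVar S i) = \<rho> (S, i)"
| "etval M \<rho> (EFn f ts) = Real (fint M f (map (\<lambda>t. the_real (etval M \<rho> t)) ts))"
| "etval M \<rho> (EProj m F ts) = Imag m F (eclass M m F (map (\<lambda>t. the_real (etval M \<rho> t)) ts))"

fun esat :: "('f, 'r, 'a) struc \<Rightarrow> (('f, 'r) esort \<times> nat \<Rightarrow> ('f, 'r, 'a) eqel) \<Rightarrow>
    ('f, 'r) efm \<Rightarrow> bool" where
  "esat M \<rho> (EEq s t) \<longleftrightarrow> etval M \<rho> s = etval M \<rho> t"
| "esat M \<rho> (ERel R ts) \<longleftrightarrow> rint M R (map (\<lambda>t. the_real (etval M \<rho> t)) ts)"
| "esat M \<rho> (ENeg \<phi>) \<longleftrightarrow> \<not> esat M \<rho> \<phi>"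
| "esat M \<rho> (EAnd \<phi> \<psi>) \<longleftrightarrow> esat M \<rho> \<phi> \<and> esat M \<rho> \<psi>"
| "esat M \<rho> (EEx S i \<phi>) \<longleftrightarrow> (\<exists>x\<in>edom M S. esat M (\<rho>((S, i) := x)) \<phi>)"

text \<open>Definable closure in \<open>M\<^sup>e\<^sup>q\<close>: \<open>x\<close>, of sort \<open>S\<close>, is the only solution of a formula in the
  variable \<open>(S, 0)\<close> whose other free variables are replaced, via \<open>\<rho>\<close>, by elements of \<open>B\<close>.\<close>

definition dcl_eq ::
  "('f, 'r) lang \<Rightarrow> ('f, 'r, 'a) struc \<Rightarrow> ('f, 'r, 'a) eqel set \<Rightarrow> ('f, 'r, 'a) eqel set" where
  "dcl_eq L M B = {x. \<exists>S \<chi> \<rho>. is_sort L M S \<and> x \<in> edom M S \<and> wf_efm L M \<chi> \<and>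
     (\<forall>(S', i)\<in>fv_efm \<chi> - {(S, 0)}. \<rho> (S', i) \<in> B \<inter> edom M S') \<and>
     (\<forall>y\<in>edom M S. esat M (\<rho>((S, 0) := y)) \<chi> \<longleftrightarrow> y = x)}"

text \<open>The map \<open>M\<^sup>e\<^sup>q \<rightarrow> N\<^sup>e\<^sup>q\<close> induced by an elementary embedding \<open>h\<close>; all \<open>x \<in> X\<close> below
  yield the same class.\<close>

fun eq_map :: "('f, 'r, 'b) struc \<Rightarrow> ('a \<Rightarrow> 'b) \<Rightarrow> ('f, 'r, 'a) eqel \<Rightarrow> ('f, 'r, 'b) eqel" where
  "eq_map N h (Real x) = Real (h x)"
| "eq_map N h (Imag m F X) = Imag m F (\<Union>x\<in>X. eclass N m F (map h x))"

section \<open>Germs\<close>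

text \<open>\<open>\<psi>(x, z, y)\<close>, with \<open>x\<close>, \<open>z\<close>, \<open>y\<close> of lengths \<open>n\<close>, \<open>k\<close>, \<open>length c\<close>, defines \<open>f\<^sub>c(x) = z\<close>
  when \<open>c\<close> is substituted for \<open>y\<close>.\<close>

definition fun_val ::
  "('f, 'r, 'a) struc \<Rightarrow> nat \<Rightarrow> ('f, 'r) fm \<Rightarrow> 'a list \<Rightarrow> 'a list \<Rightarrow> 'a list \<Rightarrow> bool" where
  "fun_val M k \<psi> c a v \<longleftrightarrow> v \<in> tup (univ M) k \<and> holds M \<psi> (a @ v @ c)"

definition partial_definable_function ::
  "('f, 'r) lang \<Rightarrow> ('f, 'r, 'a) struc \<Rightarrow> nat \<Rightarrow> nat \<Rightarrow> ('f, 'r) fm \<Rightarrow> 'a list \<Rightarrow> bool" where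
  "partial_definable_function L M n k \<psi> c \<longleftrightarrow>
     set c \<subseteq> univ M \<and> \<psi> \<in> fml L (n + k + length c) \<and>
     (\<forall>a\<in>tup (univ M) n. \<forall>v w. fun_val M k \<psi> c a v \<and> fun_val M k \<psi> c a w \<longrightarrow> v = w)"

text \<open>Realizations of global types live in elementary extensions of \<open>M\<close>. These range over the
  structures with universe in the type \<open>'b\<close>, which is arbitrary.\<close>

definition defined_on ::
  "'b itself \<Rightarrow> ('f, 'r) lang \<Rightarrow> ('f, 'r, 'a) struc \<Rightarrow> nat \<Rightarrow> (('f, 'r) fm \<times> 'a list) set \<Rightarrow>
   nat \<Rightarrow> ('f, 'r) fm \<Rightarrow> 'a list \<Rightarrow> bool" where
  "defined_on _ L M n p k \<psi> c \<longleftrightarrow>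
     (\<forall>(N :: ('f, 'r, 'b) struc) h a. elementary_ext L M N h \<and> realizes N h n p a \<longrightarrow>
        (\<exists>v. fun_val N k \<psi> (map h c) a v))"

definition germ_rel ::
  "'b itself \<Rightarrow> ('f, 'r) lang \<Rightarrow> ('f, 'r, 'a) struc \<Rightarrow> nat \<Rightarrow> (('f, 'r) fm \<times> 'a list) set \<Rightarrow>
   nat \<Rightarrow> ('f, 'r) fm \<Rightarrow> 'a list \<Rightarrow> 'a list \<Rightarrow> bool" where
  "germ_rel _ L M n p k \<psi> c1 c2 \<longleftrightarrow>
     (\<exists>(N :: ('f, 'r, 'b) struc) h a v. elementary_ext L M N h \<and> realizes N h n p a \<and>
        fun_val N k \<psi> (map h c1) a v \<and> fun_val N k \<psi> (map h c2) a v)"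

text \<open>\<open>e\<close> is the imaginary \<open>c/E\<close>. As \<open>E\<close> is an \<open>A\<close>-definable equivalence relation on the
  realizations of \<open>tp(c/A)\<close>, it is induced there by \<open>F(y d, y' d)\<close> for some 0-definable equivalence
  relation \<open>F\<close> and some tuple \<open>d\<close> from \<open>A\<close>, and \<open>c/E\<close> is the class of \<open>c d\<close> modulo \<open>F\<close>. Different
  choices of \<open>F\<close> and \<open>d\<close> give imaginaries that are interdefinable over \<open>A\<close>.\<close>

definition is_germ ::
  "'b itself \<Rightarrow> ('f, 'r) lang \<Rightarrow> ('f, 'r, 'a) struc \<Rightarrow> nat \<Rightarrow> 'a set \<Rightarrow>
   (('f, 'r) fm \<times> 'a list) set \<Rightarrow> nat \<Rightarrow> ('f, 'r) fm \<Rightarrow> 'a list \<Rightarrow> ('f, 'r, 'a) eqel \<Rightarrow> bool" where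
  "is_germ U L M n A p k \<psi> c e \<longleftrightarrow>
     (\<exists>F d. let m = length c + length d in
        set d \<subseteq> A \<and> eq_formula L M m F \<and>
        (\<forall>c1 c2. realizes M id (length c) (tp L M A c) c1 \<and>
                 realizes M id (length c) (tp L M A c) c2 \<longrightarrow>
           (germ_rel U L M n p k \<psi> c1 c2 \<longleftrightarrow> holds M F ((c1 @ d) @ (c2 @ d)))) \<and>
        e = Imag m F (eclass M m F (c @ d)))"

text \<open>The existence of \<open>c/E\<close> in \<open>M\<^sup>e\<^sup>q\<close> is part of the assertion, so that the quantification over its
  representations is not vacuous. It is asserted when \<open>p\<close> is realized in some \<open>N\<close> over \<open>'b\<close>;
  otherwise \<open>'b\<close> is too small for \<open>germ_rel\<close> to be meaningful.\<close>

definition strong_germ ::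
  "'b itself \<Rightarrow> ('f, 'r) lang \<Rightarrow> ('f, 'r, 'a) struc \<Rightarrow> nat \<Rightarrow> 'a set \<Rightarrow>
   (('f, 'r) fm \<times> 'a list) set \<Rightarrow> nat \<Rightarrow> ('f, 'r) fm \<Rightarrow> 'a list \<Rightarrow> bool" where
  "strong_germ U L M n A p k \<psi> c \<longleftrightarrow>
     (\<forall>(N :: ('f, 'r, 'b) struc) h a v.
        elementary_ext L M N h \<and> realizes N h n p a \<and> fun_val N k \<psi> (map h c) a v \<longrightarrow>
        (\<exists>e. is_germ U L M n A p k \<psi> c e) \<and>
        (\<forall>e. is_germ U L M n A p k \<psi> c e \<longrightarrow>
           Real ` set v \<subseteq> dcl_eq L N ({eq_map N h e} \<union> Real ` set a \<union> Real ` h ` A)))"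

end

theory Submission
  imports Defs "HOL-Library.Countable_Set_Type"
begin

text \<open>
  Along a Morley sequence of order type \<open>\<omega> + \<omega>\<close>, generic stability forbids a formula \<open>\<phi>(x, b)\<close>
  to hold on the first half and fail on the second. By compactness the same is forbidden along
  finite Morley sequences whose length exceeds a bound depending only on \<open>\<phi>\<close>. Hence \<open>p\<close> is definable
  over \<open>A\<close> and finite Morley sequences may be permuted.

  Suppose \<open>a\<close> realizes \<open>p\<close> over \<open>A c\<close>, an automorphism over \<open>A a\<close> takes \<open>c\<close> to some \<open>c'\<close> with the same
  germ, but \<open>f\<^sub>c(a) \<noteq> f\<^bsub>c'\<^esub>(a)\<close>. Prolong \<open>a\<close> to a Morley sequence over \<open>A c\<close> that is generic over \<open>c'\<close> as
  well; the automorphism can be chosen to fix the whole sequence, and then it fixes every value of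
  \<open>f\<^sub>c\<close> along it except the one at \<open>a\<close>. Permuting the sequence over \<open>A c\<close> gives such an automorphism
  for every member, and their products move \<open>f\<^sub>c\<close> to functions that agree with \<open>f\<^sub>c\<close> on the second half
  of the sequence and at no point of the first half, which is a contradiction. So \<open>f\<^sub>c(a)\<close> depends
  only on \<open>tp(a c/A)\<close>, \<open>a\<close> and the germ, and compactness replaces the type by a formula, which
  transfers to realizations of \<open>p\<close> outside the monster model.
\<close>

section \<open>Syntax\<close>

text \<open>The type \<open>p\<close> is global, so \<open>a\<close> lives in an extension
  \<open>N\<close> about which only elementarity is known: no saturation, no homogeneity.
  Automorphisms are available in the monster model alone, where \<open>p\<close> is sure to be
  realized only over small sets. Every argument with automorphisms is therefore made for a
  realization \<open>a0\<close> of \<open>p\<close> over \<open>A c\<close>, and its outcome is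
  condensed into formulas over \<open>A c\<close>; these belong to \<open>p\<close> and so hold of
  \<open>a\<close> in \<open>N\<close>.

  One automorphism yields one point of disagreement, while alternation is contradictory only in
  large numbers. Asking all automorphisms to fix the chosen sequence pointwise makes their effects
  independent: composing with one more changes the agreement pattern at exactly one point.

  Agreement on \<open>p\<close> is an equivalence relation only between suitable parameters such as
  the conjugates of \<open>c\<close>, whereas an imaginary needs a 0-definable equivalence relation
  on all tuples; comparing whole rows of the agreement relation repairs this. Values of
  \<open>f_c\<close> are tuples, but definable closure is asked of their entries, so coordinates are
  treated one at a time.\<close>

lemma tval_cong: "(\<And>i. i \<in> fv_tm t \<Longrightarrow> \<rho> i = \<rho>' i) \<Longrightarrow> tval M \<rho> t = tval M \<rho>' t"
proof (induction t)
  case (Fn f ts)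
  then have "map (tval M \<rho>) ts = map (tval M \<rho>') ts" by auto
  then show ?case by (simp only: tval.simps)
qed simp

lemma sat_cong: "(\<And>i. i \<in> fv \<phi> \<Longrightarrow> \<rho> i = \<rho>' i) \<Longrightarrow> sat M \<rho> \<phi> = sat M \<rho>' \<phi>"
proof (induction \<phi> arbitrary: \<rho> \<rho>')
  case (Eq s t)
  then have "tval M \<rho> s = tval M \<rho>' s" "tval M \<rho> t = tval M \<rho>' t" by (auto intro!: tval_cong)
  then show ?case by simp
next
  case (Rel R ts)
  then have "map (tval M \<rho>) ts = map (tval M \<rho>') ts" by (auto intro!: tval_cong)
  then show ?case by (simp only: sat.simps)
next
  case (And \<phi> \<psi>)
  then have "sat M \<rho> \<phi> = sat M \<rho>' \<phi>" "sat M \<rho> \<psi> = sat M \<rho>' \<psi>"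
    by (metis UnCI fv.simps(4))+
  then show ?case by simp
next
  case (Ex j \<phi>)
  have "sat M (\<rho>(j := x)) \<phi> = sat M (\<rho>'(j := x)) \<phi>" for x
    by (rule Ex.IH) (use Ex.prems in auto)
  then show ?case by simp
next
  case (Neg \<phi>)
  have "sat M \<rho> \<phi> = sat M \<rho>' \<phi>" by (rule Neg.IH) (use Neg.prems in auto)
  then show ?case by simp
qed

lemma holds_eq_sat:
  "\<phi> \<in> fml L (length xs) \<Longrightarrow> (\<And>i. i < length xs \<Longrightarrow> \<rho> i = xs ! i) \<Longrightarrow> holds M \<phi> xs = sat M \<rho> \<phi>"
  unfolding holds_def fml_def by (rule sat_cong) auto

lemma finite_fv_tm [simp]: "finite (fv_tm t)"
  by (induction t) auto

lemma finite_fv [simp]: "finite (fv \<phi>)"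
  by (induction \<phi>) auto

section \<open>Renaming of free variables without capture\<close>

fun ren_tm :: "(nat \<Rightarrow> nat) \<Rightarrow> 'f tm \<Rightarrow> 'f tm" where
  "ren_tm r (Var i) = Var (r i)"
| "ren_tm r (Fn f ts) = Fn f (map (ren_tm r) ts)"

definition fresh :: "nat set \<Rightarrow> nat" where
  "fresh X = Suc (Max (insert 0 X))"

lemma fresh_notin: "finite X \<Longrightarrow> fresh X \<notin> X"
  unfolding fresh_def by (metis Max_ge Suc_n_not_le_n finite_insert insertCI)

text \<open>Bound variables are renamed as well: \<open>r\<close> may be non-injective, since one
  block is often plugged in twice, and may send a free variable to a bound index.\<close>

fun ren :: "(nat \<Rightarrow> nat) \<Rightarrow> ('f, 'r) fm \<Rightarrow> ('f, 'r) fm" where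
  "ren r (Eq s t) = Eq (ren_tm r s) (ren_tm r t)"
| "ren r (Rel R ts) = Rel R (map (ren_tm r) ts)"
| "ren r (Neg \<phi>) = Neg (ren r \<phi>)"
| "ren r (And \<phi> \<psi>) = And (ren r \<phi>) (ren r \<psi>)"
| "ren r (Ex i \<phi>) = (let j = fresh (r ` (fv \<phi> - {i})) in Ex j (ren (r(i := j)) \<phi>))"

lemma tval_ren: "tval M \<rho> (ren_tm r t) = tval M (\<lambda>i. \<rho> (r i)) t"
proof (induction t)
  case (Fn f ts)
  then have "map (tval M \<rho>) (map (ren_tm r) ts) = map (tval M (\<lambda>i. \<rho> (r i))) ts"
    by simp
  then show ?case by (simp only: tval.simps ren_tm.simps)
qed simp

lemma sat_ren: "sat M \<rho> (ren r \<phi>) = sat M (\<lambda>i. \<rho> (r i)) \<phi>"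
proof (induction \<phi> arbitrary: \<rho> r)
  case (Rel R ts)
  have "map (tval M \<rho>) (map (ren_tm r) ts) = map (tval M (\<lambda>i. \<rho> (r i))) ts" by (simp add: tval_ren)
  then show ?case by (simp only: sat.simps ren.simps)
next
  case (Ex i \<phi>)
  define j where "j = fresh (r ` (fv \<phi> - {i}))"
  have j: "j \<notin> r ` (fv \<phi> - {i})" unfolding j_def by (rule fresh_notin) simp
  \<comment> \<open>A free variable of \<open>\<phi>\<close> other than \<open>i\<close> is not sent
    to \<open>j\<close>, so the update at \<open>j\<close> is felt at \<open>i\<close>
    alone.\<close>
  have "sat M (\<lambda>a. (\<rho>(j := x)) ((r(i := j)) a)) \<phi> = sat M ((\<lambda>a. \<rho> (r a))(i := x)) \<phi>" for x
    by (rule sat_cong) (use j in auto)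
  then show ?case by (simp add: Let_def j_def [symmetric] Ex.IH del: fun_upd_apply)
qed (simp_all add: tval_ren)

lemma fv_ren_tm: "fv_tm (ren_tm r t) = r ` fv_tm t"
  by (induction t) auto

lemma fv_ren: "fv (ren r \<phi>) \<subseteq> r ` fv \<phi>"
proof (induction \<phi> arbitrary: r)
  case (Ex i \<phi>)
  define j where "j = fresh (r ` (fv \<phi> - {i}))"
  have "fv (ren (r(i := j)) \<phi>) \<subseteq> (r(i := j)) ` fv \<phi>" by (rule Ex.IH)
  then show ?case by (auto simp: Let_def j_def [symmetric] split: if_splits)
next
  case (And \<phi> \<phi>')
  then have "fv (ren r \<phi>) \<subseteq> r ` fv \<phi>" "fv (ren r \<phi>') \<subseteq> r ` fv \<phi>'" by blast+
  then show ?case by (simp add: image_Un) blast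
qed (auto simp: fv_ren_tm)

lemma wf_ren_tm: "wf_tm L (ren_tm r t) = wf_tm L t"
  by (induction t) auto

lemma wf_ren: "wf_fm L (ren r \<phi>) = wf_fm L \<phi>"
  by (induction \<phi> arbitrary: r) (auto simp: wf_ren_tm Let_def)

text \<open>\<open>sub I \<phi>\<close> is \<open>\<phi>(x\<^bsub>I ! 0\<^esub>, x\<^bsub>I ! 1\<^esub>, \<dots>)\<close>.\<close>

definition sub :: "nat list \<Rightarrow> ('f, 'r) fm \<Rightarrow> ('f, 'r) fm" where
  "sub I = ren ((!) I)"

lemma holds_sub:
  "\<phi> \<in> fml L (length I) \<Longrightarrow> holds M (sub I \<phi>) xs = holds M \<phi> (map ((!) xs) I)"
  by (subst holds_eq_sat [where L = L and \<rho> = "\<lambda>i. xs ! (I ! i)"])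
    (auto simp: sub_def holds_def sat_ren)

lemma sub_fml: "\<phi> \<in> fml L (length I) \<Longrightarrow> set I \<subseteq> {..<m} \<Longrightarrow> sub I \<phi> \<in> fml L m"
  unfolding fml_def sub_def using fv_ren [of "(!) I" \<phi>]
  by (auto simp: wf_ren) (metis (no_types, lifting) image_iff lessThan_iff nth_mem subset_iff)

lemma Neg_fml [simp]: "Neg \<phi> \<in> fml L m \<longleftrightarrow> \<phi> \<in> fml L m"
  and And_fml [simp]: "And \<phi> \<phi>' \<in> fml L m \<longleftrightarrow> \<phi> \<in> fml L m \<and> \<phi>' \<in> fml L m"
  and Eq_Var_fml [simp]: "Eq (Var i) (Var j) \<in> fml L m \<longleftrightarrow> i < m \<and> j < m"
  unfolding fml_def by auto

lemma holds_Neg [simp]: "holds M (Neg \<phi>) xs \<longleftrightarrow> \<not> holds M \<phi> xs"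
  and holds_And [simp]: "holds M (And \<phi> \<phi>') xs \<longleftrightarrow> holds M \<phi> xs \<and> holds M \<phi>' xs"
  and holds_Eq_Var [simp]: "holds M (Eq (Var i) (Var j)) xs \<longleftrightarrow> xs ! i = xs ! j"
  unfolding holds_def by auto

text \<open>The empty conjunction. It is quantified so as to be a sentence, hence in
  \<open>fml L m\<close> even for \<open>m = 0\<close>; its truth rests on \<open>is_struc\<close>
  making the universe nonempty.\<close>

definition Verum :: "('f, 'r) fm" where
  "Verum = Ex 0 (Eq (Var 0) (Var 0))"

lemma Verum_fml: "Verum \<in> fml L m"
  by (auto simp: Verum_def fml_def)

lemma holds_Verum: "is_struc L M \<Longrightarrow> holds M Verum xs"
  by (auto simp: Verum_def holds_def is_struc_def)

fun Exs :: "nat \<Rightarrow> nat \<Rightarrow> ('f, 'r) fm \<Rightarrow> ('f, 'r) fm" where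
  "Exs m 0 \<phi> = \<phi>"
| "Exs m (Suc k) \<phi> = Ex m (Exs (Suc m) k \<phi>)"

lemma Exs_fml: "\<phi> \<in> fml L (m + k) \<Longrightarrow> Exs m k \<phi> \<in> fml L m"
proof (induction k arbitrary: m)
  case (Suc k)
  then have "Exs (Suc m) k \<phi> \<in> fml L (Suc m)" by simp
  then show ?case unfolding fml_def by (auto simp: less_Suc_eq)
qed simp

lemma tup_Suc: "v \<in> tup B (Suc k) \<longleftrightarrow> (\<exists>x w. v = x # w \<and> x \<in> B \<and> w \<in> tup B k)"
  unfolding tup_def by (cases v) auto

lemma holds_Exs:
  "\<phi> \<in> fml L (length xs + k) \<Longrightarrow>
    holds M (Exs (length xs) k \<phi>) xs \<longleftrightarrow> (\<exists>v\<in>tup (univ M) k. holds M \<phi> (xs @ v))"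
proof (induction k arbitrary: xs)
  case 0
  then show ?case by (auto simp: tup_def)
next
  case (Suc k)
  have fml: "Exs (Suc (length xs)) k \<phi> \<in> fml L (length (xs @ [x]))" for x
    using Suc.prems by (auto intro: Exs_fml)
  have "holds M (Exs (length xs) (Suc k) \<phi>) xs \<longleftrightarrow>
      (\<exists>x\<in>univ M. sat M (((!) xs)(length xs := x)) (Exs (Suc (length xs)) k \<phi>))"
    by (simp add: holds_def)
  also have "\<dots> \<longleftrightarrow> (\<exists>x\<in>univ M. holds M (Exs (length (xs @ [x])) k \<phi>) (xs @ [x]))"
  proof (intro bex_cong refl)
    fix x
    show "sat M (((!) xs)(length xs := x)) (Exs (Suc (length xs)) k \<phi>) =
        holds M (Exs (length (xs @ [x])) k \<phi>) (xs @ [x])"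
      using holds_eq_sat [OF fml [of x], of "((!) xs)(length xs := x)" M] by (simp add: nth_append)
  qed
  also have "\<dots> \<longleftrightarrow> (\<exists>x\<in>univ M. \<exists>v\<in>tup (univ M) k. holds M \<phi> ((xs @ [x]) @ v))"
    using Suc.prems by (subst Suc.IH) auto
  also have "\<dots> \<longleftrightarrow> (\<exists>v\<in>tup (univ M) (Suc k). holds M \<phi> (xs @ v))"
    by (force simp: tup_Suc)
  finally show ?case .
qed

lemma map_nth_upt: "j \<le> length xs \<Longrightarrow> map ((!) xs) [i..<j] = take (j - i) (drop i xs)"
  by (rule nth_equalityI) auto

section \<open>Automorphisms\<close>

lemma tup_append: "length xs = i \<Longrightarrow> xs @ ys \<in> tup B (i + j) \<longleftrightarrow> xs \<in> tup B i \<and> ys \<in> tup B j"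
  unfolding tup_def by auto

lemma tval_in: "is_struc L M \<Longrightarrow> wf_tm L t \<Longrightarrow> (\<And>i. \<rho> i \<in> univ M) \<Longrightarrow> tval M \<rho> t \<in> univ M"
proof (induction t)
  case (Fn f ts)
  then have "map (tval M \<rho>) ts \<in> tup (univ M) (length ts)" by (auto simp: tup_def)
  then show ?case using Fn.prems unfolding is_struc_def by fastforce
qed simp

lemma automorphism_tval:
  assumes "is_struc L M" "automorphism L M \<sigma>" "\<And>i. \<rho> i \<in> univ M"
  shows "wf_tm L t \<Longrightarrow> tval M (\<lambda>i. \<sigma> (\<rho> i)) t = \<sigma> (tval M \<rho> t)"
proof (induction t)
  case (Fn f ts)
  have "map (tval M \<rho>) ts \<in> tup (univ M) (length ts)"
    using Fn.prems assms tval_in [of L M _ \<rho>] by (auto simp: tup_def)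
  then have "\<sigma> (fint M f (map (tval M \<rho>) ts)) = fint M f (map \<sigma> (map (tval M \<rho>) ts))"
    using Fn.prems assms(2) unfolding automorphism_def by fastforce
  moreover have "map (tval M (\<lambda>i. \<sigma> (\<rho> i))) ts = map \<sigma> (map (tval M \<rho>) ts)"
    using Fn by auto
  ultimately show ?case by (simp only: tval.simps)
qed simp

lemma automorphism_sat:
  assumes "is_struc L M" "automorphism L M \<sigma>"
  shows "wf_fm L \<phi> \<Longrightarrow> (\<And>i. \<rho> i \<in> univ M) \<Longrightarrow> sat M (\<lambda>i. \<sigma> (\<rho> i)) \<phi> = sat M \<rho> \<phi>"
proof (induction \<phi> arbitrary: \<rho>)
  case (Eq s t)
  have "inj_on \<sigma> (univ M)" using assms(2) by (auto simp: automorphism_def bij_betw_def)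
  then show ?case using Eq tval_in [OF assms(1), of _ \<rho>]
    by (simp add: automorphism_tval [OF assms] inj_on_eq_iff)
next
  case (Rel R ts)
  have "map (tval M \<rho>) ts \<in> tup (univ M) (length ts)"
    using Rel.prems assms tval_in [of L M _ \<rho>] by (auto simp: tup_def)
  then have "rint M R (map (tval M \<rho>) ts) = rint M R (map \<sigma> (map (tval M \<rho>) ts))"
    using Rel.prems assms(2) unfolding automorphism_def by fastforce
  moreover have "map (tval M (\<lambda>i. \<sigma> (\<rho> i))) ts = map \<sigma> (map (tval M \<rho>) ts)"
    using Rel automorphism_tval [OF assms] by auto
  ultimately show ?case by (simp only: sat.simps)
next
  case (Ex i \<phi>)
  \<comment> \<open>Surjectivity: every witness for the moved environment is the image of a
    witness.\<close>
  have img: "\<sigma> ` univ M = univ M" using assms(2) by (auto simp: automorphism_def bij_betw_def)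
  have "sat M ((\<lambda>i. \<sigma> (\<rho> i))(i := \<sigma> x)) \<phi> = sat M (\<rho>(i := x)) \<phi>" if "x \<in> univ M" for x
  proof -
    have "(\<lambda>j. \<sigma> ((\<rho>(i := x)) j)) = (\<lambda>j. \<sigma> (\<rho> j))(i := \<sigma> x)" by auto
    moreover have "sat M (\<lambda>j. \<sigma> ((\<rho>(i := x)) j)) \<phi> = sat M (\<rho>(i := x)) \<phi>"
      by (rule Ex.IH) (use Ex.prems that in auto)
    ultimately show ?thesis by (simp only:)
  qed
  then have "(\<exists>y\<in>\<sigma> ` univ M. sat M ((\<lambda>i. \<sigma> (\<rho> i))(i := y)) \<phi>) \<longleftrightarrow> (\<exists>x\<in>univ M. sat M (\<rho>(i := x)) \<phi>)"
    by auto
  then show ?case by (simp add: img)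
qed auto

lemma automorphism_holds:
  assumes "is_struc L M" "automorphism L M \<sigma>" "\<phi> \<in> fml L (length xs)" "set xs \<subseteq> univ M"
  shows "holds M \<phi> (map \<sigma> xs) = holds M \<phi> xs"
proof -
  obtain u where u: "u \<in> univ M" using assms(1) by (auto simp: is_struc_def)
  \<comment> \<open>\<open>(!) xs\<close> is unspecified past the end of the list. It is padded by
    an element of the universe, as \<open>automorphism_sat\<close> speaks of environments with all
    values there.\<close>
  define \<rho> where "\<rho> i = (if i < length xs then xs ! i else u)" for i
  have "holds M \<phi> (map \<sigma> xs) = sat M (\<lambda>i. \<sigma> (\<rho> i)) \<phi>"
    using assms(3) by (subst holds_eq_sat [where L = L]) (auto simp: \<rho>_def)
  also have "\<dots> = sat M \<rho> \<phi>"
    by (rule automorphism_sat [OF assms(1,2)]) (use assms u in \<open>auto simp: fml_def \<rho>_def\<close>)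
  also have "\<dots> = holds M \<phi> xs"
    using assms(3) by (subst holds_eq_sat [where L = L]) (auto simp: \<rho>_def)
  finally show ?thesis .
qed

lemma automorphism_comp:
  assumes "automorphism L M \<sigma>" "automorphism L M \<tau>"
  shows "automorphism L M (\<sigma> \<circ> \<tau>)"
proof -
  have map: "map \<tau> xs \<in> tup (univ M) m" if "xs \<in> tup (univ M) m" for xs m
    using that assms(2) unfolding tup_def automorphism_def bij_betw_def by auto
  have "(\<sigma> \<circ> \<tau>) (fint M f xs) = fint M f (map (\<sigma> \<circ> \<tau>) xs)"
    if f: "(f, m) \<in> fsyms L" and xs: "xs \<in> tup (univ M) m" for f m xs
  proof -
    have "\<tau> (fint M f xs) = fint M f (map \<tau> xs)"
      using assms(2) f xs unfolding automorphism_def by fast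
    moreover have "\<sigma> (fint M f (map \<tau> xs)) = fint M f (map \<sigma> (map \<tau> xs))"
      using assms(1) f map [OF xs] unfolding automorphism_def by fast
    ultimately show ?thesis by simp
  qed
  moreover have "rint M R xs = rint M R (map (\<sigma> \<circ> \<tau>) xs)"
    if R: "(R, m) \<in> rsyms L" and xs: "xs \<in> tup (univ M) m" for R m xs
  proof -
    have "rint M R xs = rint M R (map \<tau> xs)"
      using assms(2) R xs unfolding automorphism_def by fast
    moreover have "rint M R (map \<tau> xs) = rint M R (map \<sigma> (map \<tau> xs))"
      using assms(1) R map [OF xs] unfolding automorphism_def by fast
    ultimately show ?thesis by simp
  qed
  moreover have "bij_betw (\<sigma> \<circ> \<tau>) (univ M) (univ M)"
    using assms by (auto simp: automorphism_def intro: bij_betw_trans)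
  ultimately show ?thesis unfolding automorphism_def by blast
qed

lemma automorphism_inv:
  assumes "is_struc L M" "automorphism L M \<sigma>"
  shows "automorphism L M (inv_into (univ M) \<sigma>)"
proof -
  let ?i = "inv_into (univ M) \<sigma>"
  have bij: "bij_betw \<sigma> (univ M) (univ M)" using assms(2) by (auto simp: automorphism_def)
  have inv: "map \<sigma> (map ?i xs) = xs" "map ?i xs \<in> tup (univ M) m" if "xs \<in> tup (univ M) m" for xs m
    using that bij bij_betw_inv_into [OF bij]
    by (auto simp: tup_def map_idI bij_betw_inv_into_right subset_iff bij_betw_def)
  have "?i (fint M f xs) = fint M f (map ?i xs)"
    if f: "(f, m) \<in> fsyms L" and xs: "xs \<in> tup (univ M) m" for f m xs
  proof -
    have "\<sigma> (fint M f (map ?i xs)) = fint M f (map \<sigma> (map ?i xs))"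
      using assms(2) f inv(2) [OF xs] unfolding automorphism_def by fast
    also have "\<dots> = fint M f xs" by (simp only: inv(1) [OF xs])
    finally have "\<sigma> (fint M f (map ?i xs)) = fint M f xs" .
    moreover have "fint M f (map ?i xs) \<in> univ M"
      using assms(1) f inv(2) [OF xs] unfolding is_struc_def by fast
    ultimately show ?thesis using bij by (metis bij_betw_inv_into_left)
  qed
  moreover have "rint M R xs = rint M R (map ?i xs)"
    if R: "(R, m) \<in> rsyms L" and xs: "xs \<in> tup (univ M) m" for R m xs
  proof -
    have "rint M R (map ?i xs) = rint M R (map \<sigma> (map ?i xs))"
      using assms(2) R inv(2) [OF xs] unfolding automorphism_def by fast
    then show ?thesis by (simp only: inv(1) [OF xs])
  qed
  ultimately show ?thesis unfolding automorphism_def using bij_betw_inv_into [OF bij] by blast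
qed

section \<open>Block substitutions\<close>

text \<open>When a variable tuple is split into consecutive blocks of lengths \<open>ls\<close>, \<open>sel ls js \<phi>\<close> plugs
  the blocks number \<open>js ! 0, js ! 1, \<dots>\<close> into \<open>\<phi>\<close>.\<close>

definition block :: "nat list \<Rightarrow> nat \<Rightarrow> nat list" where
  "block ls j = [sum_list (take j ls)..<sum_list (take j ls) + ls ! j]"

definition sel :: "nat list \<Rightarrow> nat list \<Rightarrow> ('f, 'r) fm \<Rightarrow> ('f, 'r) fm" where
  "sel ls js = sub (concat (map (block ls) js))"

lemma sum_list_take_Suc_le: "j < length ls \<Longrightarrow> sum_list (take j ls) + ls ! j \<le> sum_list (ls :: nat list)"
  by (subst (3) id_take_nth_drop [of j ls]) auto

lemma map_nth_block:
  assumes "j < length xss"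
  shows "map ((!) (concat xss)) (block (map length xss) j) = xss ! j"
proof -
  have split: "xss = take j xss @ xss ! j # drop (Suc j) xss"
    using assms by (simp add: id_take_nth_drop)
  have len: "sum_list (take j (map length xss)) = length (concat (take j xss))"
    by (simp add: take_map length_concat)
  have "concat xss = concat (take j xss) @ xss ! j @ concat (drop (Suc j) xss)"
    by (subst split) simp
  then show ?thesis
    unfolding block_def len using assms by (auto intro!: nth_equalityI simp: nth_append)
qed

lemma length_blocks: "set js \<subseteq> {..<length ls} \<Longrightarrow>
    length (concat (map (block ls) js)) = sum_list (map ((!) ls) js)"
  by (induction js) (auto simp: block_def)

lemma sel_fml:
  assumes "\<phi> \<in> fml L (sum_list (map ((!) ls) js))" "set js \<subseteq> {..<length ls}" "m = sum_list ls"
  shows "sel ls js \<phi> \<in> fml L m"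
proof -
  have "i < m" if "j \<in> set js" "i \<in> set (block ls j)" for i j
    using that assms sum_list_take_Suc_le [of j ls] by (auto simp: block_def)
  then show ?thesis
    unfolding sel_def using assms length_blocks [OF assms(2)] by (intro sub_fml) auto
qed

lemma holds_sel:
  assumes "\<phi> \<in> fml L (length (concat (map ((!) xss) js)))" "set js \<subseteq> {..<length xss}"
    and "ls = map length xss" "xs = concat xss"
  shows "holds M (sel ls js \<phi>) xs = holds M \<phi> (concat (map ((!) xss) js))"
proof -
  have map: "map ((!) ls) js = map length (map ((!) xss) js)"
    using assms(2,3) by auto
  have "length (concat (map (block ls) js)) = sum_list (map ((!) ls) js)"
    using assms(2,3) by (intro length_blocks) auto
  then have "\<phi> \<in> fml L (length (concat (map (block ls) js)))"
    using assms(1) by (simp add: map length_concat del: map_map)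
  then have "holds M (sel ls js \<phi>) xs = holds M \<phi> (map ((!) xs) (concat (map (block ls) js)))"
    unfolding sel_def by (rule holds_sub)
  also have "map ((!) xs) (concat (map (block ls) js)) = concat (map ((!) xss) js)"
    using assms(2) unfolding assms(3,4) map_concat map_map o_def
    by (intro arg_cong [of _ _ concat] map_cong refl map_nth_block) auto
  finally show ?thesis .
qed

section \<open>Compactness\<close>

text \<open>Instances with different parameter tuples are conjoined by concatenating the parameters;
  \<open>sel\<close> lets each conjunct read its own block.\<close>

lemma finite_insts_conj:
  fixes B :: "'a set"
  assumes "finite q" "q \<subseteq> insts L m B"
  obtains \<theta> e where "(\<theta>, e) \<in> insts L m B"
    "\<And>xs. length xs = m \<Longrightarrow> is_struc L M \<Longrightarrow> holds M \<theta> (xs @ e) \<longleftrightarrow> (\<forall>(\<phi>, b)\<in>q. holds M \<phi> (xs @ b))"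
  using assms
proof (induction q arbitrary: thesis rule: finite_induct)
  case empty
  then show ?case
    by (intro empty(1) [of Verum "[]"]) (auto simp: holds_Verum Verum_fml insts_def)
next
  case (insert \<phi>b q)
  obtain \<phi> b where \<phi>b: "\<phi>b = (\<phi>, b)" by fastforce
  obtain \<theta> e where \<theta>: "(\<theta>, e) \<in> insts L m B"
    "\<And>xs. length xs = m \<Longrightarrow> is_struc L M \<Longrightarrow> holds M \<theta> (xs @ e) \<longleftrightarrow> (\<forall>(\<phi>, b)\<in>q. holds M \<phi> (xs @ b))"
    using insert by auto
  let ?ls = "[m, length b, length e]"
  have \<phi>': "\<phi> \<in> fml L (m + length b)" "\<theta> \<in> fml L (m + length e)" "set b \<subseteq> B" "set e \<subseteq> B"
    using insert.prems(2) \<theta>(1) by (auto simp: insts_def \<phi>b)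
  show ?case
  proof (rule insert.prems(1) [of "And (sel ?ls [0, 1] \<phi>) (sel ?ls [0, 2] \<theta>)" "b @ e"])
    show "(And (sel ?ls [0, 1] \<phi>) (sel ?ls [0, 2] \<theta>), b @ e) \<in> insts L m B"
      using \<phi>' by (auto simp: insts_def intro!: sel_fml)
  next
    fix xs :: "'a list" assume xs: "length xs = m" "is_struc L M"
    have "holds M (sel ?ls [0, 1] \<phi>) (xs @ b @ e) = holds M \<phi> (xs @ b)"
      using \<phi>' xs by (subst holds_sel [of _ L "[xs, b, e]"]) simp_all
    moreover have "holds M (sel ?ls [0, 2] \<theta>) (xs @ b @ e) = holds M \<theta> (xs @ e)"
      using \<phi>' xs by (subst holds_sel [of _ L "[xs, b, e]"]) simp_all
    ultimately show "holds M (And (sel ?ls [0, 1] \<phi>) (sel ?ls [0, 2] \<theta>)) (xs @ b @ e) \<longleftrightarrow>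
        (\<forall>(\<phi>, b)\<in>insert \<phi>b q. holds M \<phi> (xs @ b))"
      using \<theta>(2) [OF xs] by (auto simp: \<phi>b)
  qed
qed

text \<open>A maximal finitely satisfiable set is complete: if it omitted a formula and its
  negation, finite subsets refuting each of them would have an unsatisfiable union.\<close>

lemma extend_to_complete_type:
  assumes q: "q \<subseteq> insts L m B"
    and fin: "\<And>q'. q' \<subseteq> q \<Longrightarrow> finite q' \<Longrightarrow> \<exists>a. realizes M id m q' a"
  obtains p where "p \<in> types L M m B" "q \<subseteq> p"
proof -
  define \<A> where "\<A> = {p. q \<subseteq> p \<and> p \<subseteq> insts L m B \<and>
    (\<forall>q'\<subseteq>p. finite q' \<longrightarrow> (\<exists>a. realizes M id m q' a))}"
  have "\<exists>p\<in>\<A>. \<forall>X\<in>\<A>. p \<subseteq> X \<longrightarrow> X = p"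
  proof (rule subset_Zorn_nonempty)
    show "\<A> \<noteq> {}" unfolding \<A>_def using q fin by auto
  next
    fix \<C> assume "\<C> \<noteq> {}" and chain: "subset.chain \<A> \<C>"
    then have sub: "\<C> \<subseteq> \<A>" by (auto simp: subset.chain_def)
    have "\<exists>a. realizes M id m q' a" if "q' \<subseteq> \<Union>\<C>" "finite q'" for q'
    proof -
      obtain X where "X \<in> \<C>" "q' \<subseteq> X"
        using finite_subset_Union_chain [OF \<open>finite q'\<close> \<open>q' \<subseteq> \<Union>\<C>\<close> \<open>\<C> \<noteq> {}\<close> chain] .
      then show ?thesis using sub \<open>finite q'\<close> unfolding \<A>_def by auto
    qed
    then show "\<Union>\<C> \<in> \<A>" using sub \<open>\<C> \<noteq> {}\<close> unfolding \<A>_def by blast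
  qed
  then obtain p where p: "p \<in> \<A>" and max: "\<And>X. X \<in> \<A> \<Longrightarrow> p \<subseteq> X \<Longrightarrow> X = p" by blast
  have incons: "\<exists>q'\<subseteq>p. finite q' \<and> (\<forall>a. realizes M id m q' a \<longrightarrow> \<not> holds M \<phi> (a @ b))"
    if \<phi>: "(\<phi>, b) \<in> insts L m B" "(\<phi>, b) \<notin> p" for \<phi> b
  proof -
    have "insert (\<phi>, b) p \<notin> \<A>" using max that by blast
    then obtain q' where q': "q' \<subseteq> insert (\<phi>, b) p" "finite q'" "\<And>a. \<not> realizes M id m q' a"
      using p \<phi> unfolding \<A>_def by auto
    have "\<not> holds M \<phi> (a @ b)" if a: "realizes M id m (q' - {(\<phi>, b)}) a" for a
    proof
      assume "holds M \<phi> (a @ b)"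
      then have "case x of (\<phi>, b) \<Rightarrow> holds M \<phi> (a @ map id b)" if "x \<in> q'" for x
        using a that by (cases "x = (\<phi>, b)") (auto simp: realizes_def)
      then show False using a q'(3) [of a] unfolding realizes_def by blast
    qed
    then show ?thesis using q' by (intro exI [of _ "q' - {(\<phi>, b)}"]) auto
  qed
  have "(\<phi>, b) \<in> p \<or> (Neg \<phi>, b) \<in> p" if inst: "(\<phi>, b) \<in> insts L m B" for \<phi> b
  proof (rule ccontr)
    assume neg: "\<not> ?thesis"
    obtain q1 where q1: "q1 \<subseteq> p" "finite q1"
      "\<And>a. realizes M id m q1 a \<Longrightarrow> \<not> holds M \<phi> (a @ b)"
      using incons [OF inst] neg by blast
    have inst': "(Neg \<phi>, b) \<in> insts L m B" using inst by (simp add: insts_def)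
    obtain q2 where q2: "q2 \<subseteq> p" "finite q2"
      "\<And>a. realizes M id m q2 a \<Longrightarrow> \<not> holds M (Neg \<phi>) (a @ b)"
      using incons [OF inst'] neg by blast
    have "finite (q1 \<union> q2)" "q1 \<union> q2 \<subseteq> p" using q1(1,2) q2(1,2) by auto
    then obtain a where "realizes M id m (q1 \<union> q2) a"
      using p unfolding \<A>_def by blast
    then have "realizes M id m q1 a" "realizes M id m q2 a" unfolding realizes_def by auto
    then show False using q1(3) q2(3) by auto
  qed
  then have "p \<in> types L M m B" using p unfolding \<A>_def types_def by auto
  then show thesis using p that unfolding \<A>_def by blast
qed

section \<open>Monster models\<close>

locale monster =
  fixes L :: "('f, 'r) lang" and T :: "('f, 'r) fm set" and \<kappa> :: "'k rel"
    and M :: "('f, 'r, 'a) struc"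
  assumes monster: "monster_model L T \<kappa> M"
begin

lemma is_struc: "is_struc L M"
  using monster by (simp add: monster_model_def models_def)

text \<open>By definition \<kappa> exceeds the cardinality of \<open>nat\<close>. The closure of
  small sets under union rests on this.\<close>

lemma infinite_Field: "infinite (Field \<kappa>)"
proof
  assume "finite (Field \<kappa>)"
  moreover have "Well_order \<kappa>"
    using monster card_order_on_well_order_on by (auto simp: monster_model_def)
  ultimately have "(\<kappa>, card_of (UNIV :: nat set)) \<in> ordLess"
    by (intro finite_ordLess_infinite card_of_Well_order)
      (simp_all only: Field_card_of infinite_UNIV_nat not_False_eq_True)
  moreover have "(card_of (UNIV :: nat set), \<kappa>) \<in> ordLess"
    using monster by (simp add: monster_model_def small_def)
  ultimately show False using ordLess_transitive ordLess_irreflexive by blast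
qed

lemma small_Un [intro]: "small \<kappa> B \<Longrightarrow> small \<kappa> C \<Longrightarrow> small \<kappa> (B \<union> C)"
  unfolding small_def using monster infinite_Field
  by (intro card_of_Un_ordLess_infinite_Field) (auto simp: monster_model_def)

lemma small_countable: "countable B \<Longrightarrow> small \<kappa> B"
  using monster unfolding countable_card_of_nat monster_model_def small_def
  by (blast intro: ordLeq_ordLess_trans)

lemma small_finite [intro]: "finite B \<Longrightarrow> small \<kappa> B"
  by (simp add: small_countable countable_finite)

lemma compactness:
  assumes "B \<subseteq> univ M" "small \<kappa> B" "q \<subseteq> insts L m B"
    and "\<And>q'. q' \<subseteq> q \<Longrightarrow> finite q' \<Longrightarrow> \<exists>a. realizes M id m q' a"
  obtains a where "realizes M id m q a"
proof -
  obtain p where "p \<in> types L M m B" "q \<subseteq> p"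
    using extend_to_complete_type assms(3,4) by metis
  moreover obtain a where "realizes M id m p a"
    using monster assms(1,2) \<open>p \<in> types L M m B\<close> unfolding monster_model_def saturated_def by blast
  ultimately show thesis using that unfolding realizes_def by blast
qed

section \<open>Automorphisms over a set, and homogeneity\<close>

definition aut :: "'a set \<Rightarrow> ('a \<Rightarrow> 'a) set" where
  "aut B = {\<sigma>. automorphism L M \<sigma> \<and> (\<forall>b\<in>B. \<sigma> b = b)}"

lemma aut_mono: "\<sigma> \<in> aut C \<Longrightarrow> B \<subseteq> C \<Longrightarrow> \<sigma> \<in> aut B"
  unfolding aut_def by auto

lemma aut_comp: "\<sigma> \<in> aut B \<Longrightarrow> \<tau> \<in> aut B \<Longrightarrow> \<sigma> \<circ> \<tau> \<in> aut B"
  unfolding aut_def using automorphism_comp by auto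

lemma aut_image: "\<sigma> \<in> aut B \<Longrightarrow> \<sigma> ` univ M = univ M"
  unfolding aut_def automorphism_def bij_betw_def by auto

lemma aut_inj: "\<sigma> \<in> aut B \<Longrightarrow> inj_on \<sigma> (univ M)"
  unfolding aut_def automorphism_def bij_betw_def by auto

lemma aut_in [simp]: "\<sigma> \<in> aut B \<Longrightarrow> x \<in> univ M \<Longrightarrow> \<sigma> x \<in> univ M"
  using aut_image by blast

lemma aut_tup [simp]: "\<sigma> \<in> aut B \<Longrightarrow> xs \<in> tup (univ M) m \<Longrightarrow> map \<sigma> xs \<in> tup (univ M) m"
  unfolding tup_def by auto

lemma map_aut_id: "\<sigma> \<in> aut B \<Longrightarrow> set xs \<subseteq> B \<Longrightarrow> map \<sigma> xs = xs"
  unfolding aut_def by (auto intro!: map_idI)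

lemma aut_inv:
  assumes "\<sigma> \<in> aut B" "B \<subseteq> univ M"
  obtains \<tau> where "\<tau> \<in> aut B" "\<And>x. x \<in> univ M \<Longrightarrow> \<sigma> (\<tau> x) = x" "\<And>x. x \<in> univ M \<Longrightarrow> \<tau> (\<sigma> x) = x"
proof
  let ?\<tau> = "inv_into (univ M) \<sigma>"
  show left: "?\<tau> (\<sigma> x) = x" if "x \<in> univ M" for x
    using that aut_inj [OF assms(1)] by simp
  show "\<sigma> (?\<tau> x) = x" if "x \<in> univ M" for x
    using that aut_image [OF assms(1)] by (simp add: f_inv_into_f)
  have "?\<tau> b = b" if "b \<in> B" for b
    using left [of b] that assms unfolding aut_def by auto
  then show "?\<tau> \<in> aut B"
    using assms automorphism_inv [OF is_struc] unfolding aut_def by auto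
qed

lemma aut_holds:
  "\<sigma> \<in> aut B \<Longrightarrow> \<phi> \<in> fml L (length xs) \<Longrightarrow> set xs \<subseteq> univ M \<Longrightarrow> holds M \<phi> (map \<sigma> xs) = holds M \<phi> xs"
  unfolding aut_def using automorphism_holds [OF is_struc] by auto

lemma tp_aut:
  assumes "\<sigma> \<in> aut B" "set a \<subseteq> univ M" "B \<subseteq> univ M"
  shows "tp L M B (map \<sigma> a) = tp L M B a"
proof -
  have "holds M \<phi> (map \<sigma> a @ b) = holds M \<phi> (a @ b)" if "(\<phi>, b) \<in> insts L (length a) B" for \<phi> b
    using that assms map_aut_id [of \<sigma> B b] aut_holds [of \<sigma> B \<phi> "a @ b"] by (auto simp: insts_def)
  then show ?thesis unfolding tp_def by auto
qed

lemma tp_eq_holds: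
  assumes "tp L M B a = tp L M B a'" "length a = length a'"
    and "\<phi> \<in> fml L (length a + length b)" "set b \<subseteq> B"
  shows "holds M \<phi> (a @ b) = holds M \<phi> (a' @ b)"
proof -
  have "(\<phi>, b) \<in> tp L M B a \<longleftrightarrow> (\<phi>, b) \<in> tp L M B a'" using assms(1) by simp
  then show ?thesis using assms unfolding tp_def insts_def by auto
qed

text \<open>The map that fixes \<open>B\<close> and sends the entries of \<open>a\<close> to those
  of \<open>a'\<close> is partial elementary, and strong homogeneity extends it.\<close>

lemma ex_aut:
  assumes B: "B \<subseteq> univ M" "small \<kappa> B" and a: "set a \<subseteq> univ M" "set a' \<subseteq> univ M" "length a = length a'"
    and tp: "tp L M B a = tp L M B a'"
  obtains \<sigma> where "\<sigma> \<in> aut B" "map \<sigma> a = a'"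
proof -
  have agree: "(a @ b) ! i = (a @ b) ! j \<longleftrightarrow> (a' @ b) ! i = (a' @ b) ! j"
    if "set b \<subseteq> B" "i < length (a @ b)" "j < length (a @ b)" for i j b
    using tp_eq_holds [OF tp a(3), of "Eq (Var i) (Var j)" b] that by simp
  \<comment> \<open>An element may occur several times in \<open>a\<close>, or both in
    \<open>a\<close> and in \<open>B\<close>. The choice of index is harmless because the type
    contains the equations between entries, which is what \<open>agree\<close> says.\<close>
  define g where "g x = (if x \<in> B then x else a' ! (SOME i. i < length a \<and> a ! i = x))" for x
  have g_a: "g (a ! i) = a' ! i" if i: "i < length a" for i
  proof (cases "a ! i \<in> B")
    case True
    then show ?thesis
      using agree [of "[a ! i]" i "length a"] i a(3) by (simp add: g_def nth_append)
  next
    case False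
    define j where "j = (SOME j. j < length a \<and> a ! j = a ! i)"
    have "j < length a \<and> a ! j = a ! i"
      unfolding j_def by (rule someI [of _ i]) (use i in simp)
    then have "a' ! j = a' ! i"
      using agree [of "[]" j i] i by simp
    then show ?thesis using False by (simp add: g_def j_def)
  qed
  have "partial_elementary L M (B \<union> set a) g"
    unfolding partial_elementary_def
  proof (intro conjI allI impI ballI)
    show "B \<union> set a \<subseteq> univ M" using B a by auto
    show "g ` (B \<union> set a) \<subseteq> univ M"
    proof -
      have "g x \<in> univ M" if "x \<in> set a" for x
        using that g_a a by (metis in_set_conv_nth nth_mem subset_iff)
      moreover have "g x \<in> univ M" if "x \<in> B" for x
        using that B by (auto simp: g_def)
      ultimately show ?thesis by blast
    qed
    fix xs \<phi> assume xs: "set xs \<subseteq> B \<union> set a" and \<phi>: "\<phi> \<in> fml L (length xs)"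
    \<comment> \<open>\<open>xs\<close> mixes entries of \<open>B\<close> and of \<open>a\<close>.
      Listing the former as \<open>b\<close> turns \<open>\<phi>\<close> at \<open>xs\<close> into
      one formula about \<open>a @ b\<close>, with \<open>idx\<close> giving the position of each
      entry; the type over \<open>B\<close> decides it.\<close>
    define b where "b = filter (\<lambda>x. x \<in> B) xs"
    have b: "set b \<subseteq> B" by (auto simp: b_def)
    have "\<exists>i<length (a @ b). (a @ b) ! i = x \<and> (a' @ b) ! i = g x" if "x \<in> set xs" for x
    proof (cases "x \<in> B")
      case True
      then have "x \<in> set b" using that by (simp add: b_def)
      then obtain j where "j < length b" "b ! j = x" by (auto simp: in_set_conv_nth)
      then show ?thesis using True a(3)
        by (intro exI [of _ "length a + j"]) (auto simp: g_def nth_append)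
    next
      case False
      then have "x \<in> set a" using that xs by auto
      then obtain j where "j < length a" "a ! j = x" by (auto simp: in_set_conv_nth)
      then show ?thesis using g_a a(3) by (intro exI [of _ j]) (auto simp: nth_append)
    qed
    then obtain idx where idx: "\<And>x. x \<in> set xs \<Longrightarrow> idx x < length (a @ b) \<and>
        (a @ b) ! idx x = x \<and> (a' @ b) ! idx x = g x"
      by metis
    have sub: "sub (map idx xs) \<phi> \<in> fml L (length a + length b)"
      using idx \<phi> by (intro sub_fml) auto
    have "holds M (sub (map idx xs) \<phi>) (a @ b) = holds M (sub (map idx xs) \<phi>) (a' @ b)"
      by (rule tp_eq_holds [OF tp a(3) sub b])
    moreover have "holds M (sub (map idx xs) \<phi>) (a @ b) = holds M \<phi> (map ((!) (a @ b)) (map idx xs))"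
      "holds M (sub (map idx xs) \<phi>) (a' @ b) = holds M \<phi> (map ((!) (a' @ b)) (map idx xs))"
      by (rule holds_sub, use \<phi> in simp)+
    moreover have "map ((!) (a @ b)) (map idx xs) = xs" "map ((!) (a' @ b)) (map idx xs) = map g xs"
      unfolding map_map o_def using idx by (auto intro: map_idI)
    ultimately show "holds M \<phi> xs = holds M \<phi> (map g xs)" by (simp only:)
  qed
  moreover have "small \<kappa> (B \<union> set a)" using B by auto
  moreover have "strongly_homogeneous L \<kappa> M" using monster by (simp add: monster_model_def)
  ultimately have "\<exists>\<sigma>. automorphism L M \<sigma> \<and> (\<forall>b\<in>B \<union> set a. \<sigma> b = g b)"
    unfolding strongly_homogeneous_def by simp
  then obtain \<sigma> where \<sigma>: "automorphism L M \<sigma>" "\<And>b. b \<in> B \<union> set a \<Longrightarrow> \<sigma> b = g b"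
    by auto
  show thesis
  proof
    show "\<sigma> \<in> aut B" using \<sigma> by (auto simp: aut_def g_def)
    show "map \<sigma> a = a'" using \<sigma> a(3) g_a by (auto intro!: nth_equalityI)
  qed
qed

end
section \<open>Morley sequences\<close>

locale generically_stable_type = monster L T \<kappa> M
  for L :: "('f, 'r) lang" and T :: "('f, 'r) fm set" and \<kappa> :: "'k rel"
    and M :: "('f, 'r, 'a) struc" +
  fixes A :: "'a set" and n :: nat and p :: "(('f, 'r) fm \<times> 'a list) set"
  assumes A: "A \<subseteq> univ M" "small \<kappa> A"
    and p: "p \<in> types L M n (univ M)" "generically_stable L M n A p"
begin

definition real :: "'a set \<Rightarrow> 'a list \<Rightarrow> bool" where
  "real B x \<longleftrightarrow> realizes M id n (restr p B) x"

text \<open>Finite Morley sequences, over an arbitrary base. Absorbing each element into the base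
  lets inductions on the list vary \<open>B\<close> and reduces them to facts about a single
  realization.\<close>

fun mor :: "'a set \<Rightarrow> 'a list list \<Rightarrow> bool" where
  "mor B [] \<longleftrightarrow> True"
| "mor B (x # xs) \<longleftrightarrow> real B x \<and> mor (B \<union> set x) xs"

lemma p_fml: "(\<phi>, b) \<in> p \<Longrightarrow> \<phi> \<in> fml L (n + length b) \<and> set b \<subseteq> univ M"
  using p(1) unfolding types_def insts_def by auto

lemma p_Neg:
  assumes "\<phi> \<in> fml L (n + length b)" "set b \<subseteq> univ M"
  shows "(Neg \<phi>, b) \<in> p \<longleftrightarrow> (\<phi>, b) \<notin> p"
proof -
  have "\<not> ((\<phi>, b) \<in> p \<and> (Neg \<phi>, b) \<in> p)"
  proof
    assume "(\<phi>, b) \<in> p \<and> (Neg \<phi>, b) \<in> p"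
    then have "{(\<phi>, b), (Neg \<phi>, b)} \<subseteq> p" "finite {(\<phi>, b), (Neg \<phi>, b)}" by auto
    then obtain a where "realizes M id n {(\<phi>, b), (Neg \<phi>, b)} a"
      using p(1) unfolding types_def by blast
    then show False unfolding realizes_def by auto
  qed
  moreover have "(\<phi>, b) \<in> insts L n (univ M)" using assms by (simp add: insts_def)
  ultimately show ?thesis using p(1) unfolding types_def by blast
qed

lemma real_tup: "real B x \<Longrightarrow> x \<in> tup (univ M) n"
  unfolding real_def realizes_def by auto

lemma real_length [simp]: "real B x \<Longrightarrow> length x = n"
  and real_set: "real B x \<Longrightarrow> set x \<subseteq> univ M"
  using real_tup unfolding tup_def by auto

lemma real_mono: "real C x \<Longrightarrow> B \<subseteq> C \<Longrightarrow> real B x"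
  unfolding real_def realizes_def restr_def by blast

text \<open>One direction is the meaning of \<open>real\<close>; the other applies it to the
  negation, which lies in \<open>p\<close> when \<open>\<phi>\<close> does not.\<close>

lemma real_holds:
  assumes "real B x" "set b \<subseteq> B" "set b \<subseteq> univ M" "\<phi> \<in> fml L (n + length b)"
  shows "holds M \<phi> (x @ b) \<longleftrightarrow> (\<phi>, b) \<in> p"
proof -
  have imp: "holds M \<phi> (x @ b)" if "(\<phi>, b) \<in> p" for \<phi>
    using that assms(1,2) unfolding real_def realizes_def restr_def by auto
  show ?thesis using imp [of \<phi>] imp [of "Neg \<phi>"] p_Neg [OF assms(4,3)] by auto
qed

lemma realI:
  assumes "x \<in> tup (univ M) n" "\<And>\<phi> b. (\<phi>, b) \<in> p \<Longrightarrow> set b \<subseteq> B \<Longrightarrow> holds M \<phi> (x @ b)"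
  shows "real B x"
  using assms unfolding real_def realizes_def restr_def by auto

lemma ex_real:
  assumes "B \<subseteq> univ M" "small \<kappa> B"
  shows "\<exists>x. real B x"
proof -
  have sub: "restr p B \<subseteq> insts L n B"
    using p(1) unfolding types_def restr_def insts_def by auto
  have "\<exists>a. realizes M id n q' a" if "q' \<subseteq> restr p B" "finite q'" for q'
  proof -
    have "q' \<subseteq> p" using that unfolding restr_def by auto
    then show ?thesis using p(1) that(2) unfolding types_def by blast
  qed
  then show ?thesis unfolding real_def using compactness [OF assms sub] by metis
qed

lemma mor_mono: "mor C xs \<Longrightarrow> B \<subseteq> C \<Longrightarrow> mor B xs"
proof (induction xs arbitrary: B C)
  case (Cons x xs)
  have "mor (B \<union> set x) xs" by (rule Cons.IH [of "C \<union> set x"]) (use Cons.prems in auto)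
  then show ?case using Cons.prems real_mono by auto
qed simp

lemma mor_append: "mor B (xs @ ys) \<longleftrightarrow> mor B xs \<and> mor (B \<union> \<Union> (set ` set xs)) ys"
  by (induction xs arbitrary: B) (auto simp: Un_assoc)

lemma mor_set: "mor B xs \<Longrightarrow> x \<in> set xs \<Longrightarrow> real B x"
  by (induction xs arbitrary: B) (auto intro: real_mono)

lemma mor_concat: "mor B xs \<Longrightarrow> set (concat xs) \<subseteq> univ M"
  using mor_set real_set by fastforce

lemma mor_take: "mor B (xs @ ys) \<Longrightarrow> mor B (take i xs @ take j ys)"
proof -
  assume m: "mor B (xs @ ys)"
  have "mor B (take i xs @ drop i xs)" using m by (simp add: mor_append)
  then have "mor B (take i xs)" unfolding mor_append by simp
  moreover have "mor (B \<union> \<Union> (set ` set xs)) (take j ys @ drop j ys)"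
    using m by (simp add: mor_append)
  then have "mor (B \<union> \<Union> (set ` set xs)) (take j ys)" unfolding mor_append by simp
  then have "mor (B \<union> \<Union> (set ` set (take i xs))) (take j ys)"
    by (rule mor_mono) (use set_take_subset [of i xs] in auto)
  ultimately show ?thesis by (simp add: mor_append)
qed

section \<open>Existence of Morley sequences over small sets\<close>

lemma ex_mor_seq:
  assumes "B \<subseteq> univ M" "small \<kappa> B"
  obtains s where "\<And>k. mor B (map s [0..<k])"
proof -
  have "\<exists>f. \<forall>k. (mor B (f k) \<and> length (f k) = k) \<and> (\<exists>x. f (Suc k) = f k @ [x])"
  proof (rule dependent_nat_choice)
    show "\<exists>x. mor B x \<and> length x = 0" by auto
    fix xs k assume xs: "mor B xs \<and> length xs = k"
    let ?C = "B \<union> set (concat xs)"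
    have "?C \<subseteq> univ M" "small \<kappa> ?C" using assms mor_concat [of B xs] xs by auto
    then obtain x where "real ?C x" using ex_real by blast
    then have "mor B (xs @ [x])" using xs by (simp add: mor_append)
    then show "\<exists>ys. (mor B ys \<and> length ys = Suc k) \<and> (\<exists>x. ys = xs @ [x])" using xs by auto
  qed
  then obtain f where f: "\<And>k. mor B (f k)" "\<And>k. length (f k) = k" "\<And>k. \<exists>x. f (Suc k) = f k @ [x]"
    by blast
  \<comment> \<open>The lists extend one another, so the last entry of \<open>f (Suc i)\<close> is
    entry \<open>i\<close> of all longer lists.\<close>
  have "f k = map (\<lambda>i. f (Suc i) ! i) [0..<k]" for k
  proof (induction k)
    case (Suc k)
    obtain x where x: "f (Suc k) = f k @ [x]" using f(3) by blast
    then have "x = f (Suc k) ! k" by (simp add: f(2) nth_append)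
    with x have "f (Suc k) = f k @ [f (Suc k) ! k]" by simp
    also have "f k = map (\<lambda>i. f (Suc i) ! i) [0..<k]" by (rule Suc.IH)
    finally show ?case by simp
  qed (use f(2) [of 0] in simp)
  then show thesis using that [of "\<lambda>i. f (Suc i) ! i"] f(1) by metis
qed

lemma ex_mor:
  assumes "B \<subseteq> univ M" "small \<kappa> B"
  obtains xs where "mor B xs" "length xs = k"
  using ex_mor_seq [OF assms] by (metis diff_zero length_map length_upt)

section \<open>Action of automorphisms, and uniqueness of Morley sequences\<close>

lemma p_aut:
  assumes "\<sigma> \<in> aut A" "set b \<subseteq> univ M" "\<phi> \<in> fml L (n + length b)"
  shows "(\<phi>, map \<sigma> b) \<in> p \<longleftrightarrow> (\<phi>, b) \<in> p"
proof -
  have "tp L M A (map \<sigma> b) = tp L M A b" using assms A by (intro tp_aut)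
  moreover have "b \<in> tup (univ M) (length b)" using assms by (simp add: tup_def)
  moreover have "map \<sigma> b \<in> tup (univ M) (length b)" using assms(1) calculation(2) by (rule aut_tup)
  moreover have "invariant_type L M n A p" using p(2) by (simp add: generically_stable_def)
  ultimately show ?thesis using assms(3) unfolding invariant_type_def by blast
qed

text \<open>By invariance, automorphisms over \<open>A\<close> map \<open>p\<close> to itself.
  Parameters from the image of \<open>B\<close> are pulled back to \<open>B\<close>, over which
  \<open>x\<close> is known to realize \<open>p\<close>.\<close>

lemma real_aut:
  assumes "\<sigma> \<in> aut A" "B \<subseteq> univ M" "real B x"
  shows "real (\<sigma> ` B) (map \<sigma> x)"
proof (rule realI)
  show "map \<sigma> x \<in> tup (univ M) n" using assms(1) real_tup [OF assms(3)] by (rule aut_tup)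
  fix \<phi> b assume b: "(\<phi>, b) \<in> p" "set b \<subseteq> \<sigma> ` B"
  obtain \<tau> where \<tau>: "\<tau> \<in> aut A" "\<And>x. x \<in> univ M \<Longrightarrow> \<sigma> (\<tau> x) = x" "\<And>x. x \<in> univ M \<Longrightarrow> \<tau> (\<sigma> x) = x"
    using aut_inv [OF assms(1) A(1)] by blast
  have fml: "\<phi> \<in> fml L (n + length b)" "set b \<subseteq> univ M" using p_fml [OF b(1)] by auto
  define b' where "b' = map \<tau> b"
  have b': "map \<sigma> b' = b" using \<tau> fml by (auto simp: b'_def intro!: map_idI)
  have "\<tau> y \<in> B" if "y \<in> \<sigma> ` B" for y using that \<tau>(3) assms(2) by auto
  then have "set b' \<subseteq> B" using b(2) by (auto simp: b'_def)
  moreover have "(\<phi>, b') \<in> p" using p_aut [OF \<tau>(1) fml(2,1)] b(1) by (simp add: b'_def)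
  ultimately have "holds M \<phi> (x @ b')"
    using real_holds [OF assms(3)] fml assms(2) by (auto simp: b'_def)
  moreover have "holds M \<phi> (map \<sigma> (x @ b')) = holds M \<phi> (x @ b')"
    using assms fml \<open>set b' \<subseteq> B\<close> real_set [OF assms(3)]
    by (intro aut_holds) (auto simp: b'_def)
  ultimately show "holds M \<phi> (map \<sigma> x @ b)" by (simp add: b')
qed

lemma mor_aut: "\<sigma> \<in> aut A \<Longrightarrow> B \<subseteq> univ M \<Longrightarrow> mor B xs \<Longrightarrow> mor (\<sigma> ` B) (map (map \<sigma>) xs)"
proof (induction xs arbitrary: B)
  case (Cons x xs)
  have "B \<union> set x \<subseteq> univ M" using Cons.prems real_set by auto
  then have "mor (\<sigma> ` (B \<union> set x)) (map (map \<sigma>) xs)" using Cons by auto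
  then show ?case using Cons.prems real_aut by (simp add: image_Un)
qed simp

lemma real_unique:
  assumes "A \<subseteq> B" "B \<subseteq> univ M" "small \<kappa> B" "real B x" "real B y"
  obtains \<sigma> where "\<sigma> \<in> aut B" "map \<sigma> x = y"
proof (rule ex_aut [OF assms(2,3)])
  show "set x \<subseteq> univ M" "set y \<subseteq> univ M" "length x = length y" using assms(4,5) real_set by auto
  show "tp L M B x = tp L M B y"
    unfolding tp_def insts_def using assms real_holds [of B x] real_holds [of B y] by fastforce
qed (use that in blast)

text \<open>Once \<open>\<sigma>\<close> matches the first elements, the remaining target is pulled
  back by its inverse \<open>\<tau>0\<close>. Both tails are then Morley over the same base
  \<open>B \<union> set x\<close>, and the induction hypothesis applies.\<close>

lemma mor_unique:
  assumes "A \<subseteq> B" "B \<subseteq> univ M" "small \<kappa> B" "mor B xs" "mor B ys" "length xs = length ys"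
  obtains \<sigma> where "\<sigma> \<in> aut B" "map (map \<sigma>) xs = ys"
  using assms
proof (induction xs arbitrary: B ys thesis)
  case Nil
  have "automorphism L M id" by (auto simp: automorphism_def)
  then show ?case using Nil(7) by (intro Nil(1) [of id]) (auto simp: aut_def id_def)
next
  case (Cons x xs)
  obtain y ys' where ys: "ys = y # ys'" using Cons.prems(7) by (cases ys) auto
  obtain \<sigma> where \<sigma>: "\<sigma> \<in> aut B" "map \<sigma> x = y"
    using real_unique [OF Cons.prems(2,3,4), of x y] Cons.prems(5,6) by (auto simp: ys)
  have \<sigma>A: "\<sigma> \<in> aut A" using \<sigma>(1) Cons.prems(2) by (rule aut_mono)
  let ?B = "B \<union> set y"
  have x: "set x \<subseteq> univ M" "set y \<subseteq> univ M" using Cons.prems(5,6) real_set by (auto simp: ys)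
  have "\<sigma> ` B = B" using \<sigma>(1) by (force simp: aut_def)
  then have "\<sigma> ` (B \<union> set x) = ?B" using \<sigma>(2) by (auto simp: image_Un)
  have *: "A \<subseteq> ?B" "?B \<subseteq> univ M" "small \<kappa> ?B" "mor ?B ys'" "length xs = length ys'"
    using Cons.prems x by (auto simp: ys)
  obtain \<tau>0 where \<tau>0: "\<tau>0 \<in> aut A" "\<And>x. x \<in> univ M \<Longrightarrow> \<sigma> (\<tau>0 x) = x" "\<And>x. x \<in> univ M \<Longrightarrow> \<tau>0 (\<sigma> x) = x"
    using aut_inv [OF \<sigma>A A(1)] by blast
  have "mor (\<tau>0 ` ?B) (map (map \<tau>0) ys')" using * by (intro mor_aut [OF \<tau>0(1)]) auto
  moreover have "\<tau>0 ` ?B = B \<union> set x"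
  proof -
    have "\<tau>0 ` ?B = \<tau>0 ` \<sigma> ` (B \<union> set x)" using \<open>\<sigma> ` (B \<union> set x) = ?B\<close> by simp
    also have "\<dots> = id ` (B \<union> set x)"
      unfolding image_image using \<tau>0(3) x Cons.prems(3) by (intro image_cong) auto
    finally show ?thesis by simp
  qed
  ultimately have "mor (B \<union> set x) (map (map \<tau>0) ys')" by simp
  then obtain \<tau> where \<tau>: "\<tau> \<in> aut (B \<union> set x)" "map (map \<tau>) xs = map (map \<tau>0) ys'"
    using Cons.IH [of "B \<union> set x" "map (map \<tau>0) ys'"] Cons.prems x *(5) by auto
  show ?case
  proof (rule Cons.prems(1))
    show "\<sigma> \<circ> \<tau> \<in> aut B" using \<sigma> aut_mono [OF \<tau>(1)] by (intro aut_comp) auto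
    have "map (map (\<sigma> \<circ> \<tau>)) xs = map (map \<sigma>) (map (map \<tau>) xs)" by simp
    also have "\<dots> = ys'" unfolding \<tau>(2) using \<tau>0(2) mor_concat [OF *(4)]
      by (auto intro!: map_idI)
    finally have "map (map (\<sigma> \<circ> \<tau>)) xs = ys'" .
    moreover have "map (\<sigma> \<circ> \<tau>) x = y"
      using map_aut_id [OF \<tau>(1), of x] \<sigma>(2) by (metis Un_upper2 map_map)
    ultimately show "map (map (\<sigma> \<circ> \<tau>)) (x # xs) = ys" by (simp add: ys)
  qed
qed

end
section \<open>Consequences of generic stability\<close>

lemma realizesD: "realizes N h n q a \<Longrightarrow> (\<phi>, b) \<in> q \<Longrightarrow> holds N \<phi> (a @ map h b)"
  unfolding realizes_def by auto

text \<open>A well-order of type \<open>\<omega> + \<omega>\<close>: the even numbers followed by the odd ones.\<close>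

definition omega2 :: "('a + nat) rel" where
  "omega2 = {(Inr i, Inr j) | i j. even i \<and> odd j \<or> even i = even j \<and> i \<le> j}"

lemma Field_omega2: "Field omega2 = range Inr"
  unfolding Field_def omega2_def by auto

text \<open>Ordered by parity first and by value second, the numbers embed into a lexicographic
  product of two well-founded orders.\<close>

lemma Well_order_omega2: "Well_order (omega2 :: ('a + nat) rel)"
proof -
  define g :: "'a + nat \<Rightarrow> nat \<times> nat" where
    "g x = (case x of Inl _ \<Rightarrow> (0, 0) | Inr i \<Rightarrow> (i mod 2, i))" for x
  have "(omega2 :: ('a + nat) rel) - Id \<subseteq> inv_image (less_than <*lex*> less_than) g"
    unfolding omega2_def g_def by (auto simp: even_iff_mod_2_eq_zero odd_iff_mod_2_eq_one)
  then have "wf ((omega2 :: ('a + nat) rel) - Id)"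
    by (rule wf_subset [rotated]) (auto intro: wf_inv_image wf_lex_prod)
  moreover have "Linear_order (omega2 :: ('a + nat) rel)"
    unfolding order_on_defs Field_omega2
    by (auto simp: refl_on_def trans_def antisym_def total_on_def omega2_def)
  ultimately show ?thesis by (simp add: well_order_on_def)
qed

lemma underS_omega2: "underS omega2 (Inr i) =
    Inr ` {j. even j \<and> odd i \<or> even i = even j \<and> j < i}"
  unfolding underS_def omega2_def by (auto simp: order_less_le)

context generically_stable_type
begin

text \<open>Without a bound, alternations of every length exist, each on its own sequence. Finite
  Morley sequences of equal length are conjugate over \<open>A\<close>, so all alternations can be
  moved onto one fixed sequence \<open>s\<close> followed by \<open>t\<close>; then a single
  \<open>b\<close> realizes them all, against generic stability.\<close>

lemma no_alternation:
  assumes \<phi>: "\<phi> \<in> fml L (n + m)"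
  obtains K where "\<And>xs ys b. mor A (xs @ ys) \<Longrightarrow> K \<le> length xs \<Longrightarrow> K \<le> length ys \<Longrightarrow>
    b \<in> tup (univ M) m \<Longrightarrow> (\<And>x. x \<in> set xs \<Longrightarrow> holds M \<phi> (x @ b)) \<Longrightarrow>
    (\<And>y. y \<in> set ys \<Longrightarrow> \<not> holds M \<phi> (y @ b)) \<Longrightarrow> False"
proof (rule ccontr)
  note K = that
  assume not: "\<not> thesis"
  obtain s where s: "\<And>k. mor A (map s [0..<k])" using ex_mor_seq [OF A] by blast
  have s_real: "real (A \<union> (\<Union>j<i. set (s j))) (s i)" for i
    using s [of "Suc i"] by (auto simp: mor_append lessThan_atLeast0)
  \<comment> \<open>\<open>t\<close> is taken generic over all of \<open>s\<close>, so that the two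
    together form a Morley sequence of order type \<open>\<omega> + \<omega>\<close>.\<close>
  define C where "C = A \<union> (\<Union>i. set (s i))"
  have C1: "C \<subseteq> univ M" using A(1) real_set [OF s_real] by (auto simp: C_def)
  have C2: "small \<kappa> C" unfolding C_def by (rule small_Un [OF A(2) small_countable]) (auto intro: countable_finite)
  obtain t where t: "\<And>k. mor C (map t [0..<k])" using ex_mor_seq [OF C1 C2] by blast
  have t_real: "real (C \<union> (\<Union>j<i. set (t j))) (t i)" for i
    using t [of "Suc i"] by (auto simp: mor_append lessThan_atLeast0)
  have mor_st: "mor A (map s [0..<k] @ map t [0..<k])" for k
    using s [of k] t [of k] unfolding mor_append by (auto simp: C_def intro: mor_mono)
  \<comment> \<open>In the compactness argument \<open>b\<close> is the unknown, so its variables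
    must come first.\<close>
  define \<phi>' where "\<phi>' = sel [m, n] [1, 0] \<phi>"
  have \<phi>': "\<phi>' \<in> fml L (m + n)" using \<phi> by (auto simp: \<phi>'_def intro!: sel_fml)
  have holds_\<phi>': "holds M \<phi>' (b @ x) = holds M \<phi> (x @ b)" if "length b = m" "length x = n" for b x
    using that \<phi> holds_sel [of \<phi> L "[b, x]" "[1, 0]"] by (simp add: \<phi>'_def)
  define q where "q k = (\<Union>i<k. {(\<phi>', s i), (Neg \<phi>', t i)})" for k
  let ?C = "C \<union> (\<Union>i. set (t i))"
  have len: "length (s i) = n" "length (t i) = n" for i
    using real_length s_real t_real by blast+
  have fin: "\<exists>b. realizes M id m q' b" if q': "q' \<subseteq> (\<Union>k. q k)" "finite q'" for q'
  proof -
    obtain g where g: "\<And>x. x \<in> q' \<Longrightarrow> x \<in> q (g x)" using q'(1) by (metis UN_E subsetD)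
    \<comment> \<open>The sets \<open>q k\<close> increase, so a single one contains
      \<open>q'\<close>; the inserted 0 covers the case of empty \<open>q'\<close>.\<close>
    define k where "k = Max (insert 0 (g ` q'))"
    have "g x \<le> k" if "x \<in> q'" for x using that q'(2) by (auto simp: k_def)
    then have q'k: "q' \<subseteq> q k" using g unfolding q_def by fastforce
    obtain xs ys b where *: "mor A (xs @ ys)" "k \<le> length xs" "k \<le> length ys" "b \<in> tup (univ M) m"
      "\<And>x. x \<in> set xs \<Longrightarrow> holds M \<phi> (x @ b)" "\<And>y. y \<in> set ys \<Longrightarrow> \<not> holds M \<phi> (y @ b)"
      using not K [of k] by blast
    let ?l = "take k xs @ take k ys"
    have "mor A ?l" using *(1) by (rule mor_take)
    then obtain \<sigma> where \<sigma>: "\<sigma> \<in> aut A" "map (map \<sigma>) ?l = map s [0..<k] @ map t [0..<k]"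
      using mor_unique [OF subset_refl A _ mor_st [of k], of ?l] *(2,3) by auto
    have st: "s i = map \<sigma> (xs ! i)" "t i = map \<sigma> (ys ! i)" if "i < k" for i
      using arg_cong [OF \<sigma>(2), of "\<lambda>l. l ! i"] arg_cong [OF \<sigma>(2), of "\<lambda>l. l ! (k + i)"] that *(2,3)
      by (auto simp: nth_append)
    have "holds M \<phi> (map \<sigma> x @ map \<sigma> b) = holds M \<phi> (x @ b)" if "x \<in> set (xs @ ys)" for x
      using aut_holds [OF \<sigma>(1), of \<phi> "x @ b"] \<phi> *(4) real_tup [OF mor_set [OF *(1) that]]
      by (auto simp: tup_def)
    then have "holds M \<phi> (s i @ map \<sigma> b)" "\<not> holds M \<phi> (t i @ map \<sigma> b)" if "i < k" for i
      using *(2,3,5,6) that by (auto simp: st)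
    then have "realizes M id m (q k) (map \<sigma> b)"
      using *(4) \<sigma>(1) len by (auto simp: realizes_def q_def holds_\<phi>' tup_def)
    then show ?thesis using q'k unfolding realizes_def by blast
  qed
  have C3: "?C \<subseteq> univ M" using C1 real_set [OF t_real] by auto
  have C4: "small \<kappa> ?C"
    by (rule small_Un [OF C2 small_countable]) (auto intro: countable_finite)
  have sub: "(\<Union>k. q k) \<subseteq> insts L m ?C"
    using \<phi>' by (auto simp: q_def insts_def C_def len)
  obtain b where b: "realizes M id m (\<Union>k. q k) b"
    using compactness [OF C3 C4 sub fin] .
  have hst: "holds M \<phi> (s i @ b)" "\<not> holds M \<phi> (t i @ b)" for i
  proof -
    have "(\<phi>', s i) \<in> (\<Union>k. q k)" "(Neg \<phi>', t i) \<in> (\<Union>k. q k)" by (auto simp: q_def)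
    from this [THEN realizesD [OF b]] have "holds M \<phi>' (b @ s i)" "\<not> holds M \<phi>' (b @ t i)" by simp_all
    then show "holds M \<phi> (s i @ b)" "\<not> holds M \<phi> (t i @ b)"
      using holds_\<phi>' len b by (auto simp: realizes_def tup_def)
  qed
  \<comment> \<open>Even indices run through \<open>s\<close> and odd ones through \<open>t\<close>,
    matching \<open>omega2\<close>. The value at \<open>Inl\<close> is arbitrary, as these indices
    lie outside the field.\<close>
  define u :: "'a + nat \<Rightarrow> 'a list" where
    "u x = (case x of Inl _ \<Rightarrow> [] | Inr i \<Rightarrow> if even i then s (i div 2) else t (i div 2))" for x
  have "realizes M id n (restr p (A \<union> (\<Union>j\<in>underS omega2 (Inr i). set (u j)))) (u (Inr i))" for i
    unfolding real_def [symmetric]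
  proof (cases "even i")
    case True
    then have le: "(\<Union>j\<in>underS omega2 (Inr i). set (u j)) \<subseteq> (\<Union>j<i div 2. set (s j))"
      unfolding underS_omega2 u_def by fastforce
    show "real (A \<union> (\<Union>j\<in>underS omega2 (Inr i). set (u j))) (u (Inr i))"
    proof -
      have "u (Inr i) = s (i div 2)" using True by (simp add: u_def)
      moreover have "A \<union> (\<Union>j\<in>underS omega2 (Inr i). set (u j)) \<subseteq> A \<union> (\<Union>j<i div 2. set (s j))"
        using le by blast
      ultimately show ?thesis using real_mono [OF s_real] by simp
    qed
  next
    case False
    have "set (u (Inr j)) \<subseteq> C \<union> (\<Union>j<i div 2. set (t j))" if "even j \<or> odd j \<and> j < i" for j
    proof (cases "even j")
      case False
      then have "j div 2 < i div 2" using that \<open>odd i\<close> by presburger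
      then show ?thesis using False by (auto simp: u_def)
    qed (auto simp: u_def C_def)
    then have le: "(\<Union>j\<in>underS omega2 (Inr i). set (u j)) \<subseteq> C \<union> (\<Union>j<i div 2. set (t j))"
      using False unfolding underS_omega2 by auto
    show "real (A \<union> (\<Union>j\<in>underS omega2 (Inr i). set (u j))) (u (Inr i))"
    proof -
      have "u (Inr i) = t (i div 2)" using False by (simp add: u_def)
      moreover have "A \<union> (\<Union>j\<in>underS omega2 (Inr i). set (u j)) \<subseteq> C \<union> (\<Union>j<i div 2. set (t j))"
        using le by (auto simp: C_def)
      ultimately show ?thesis using real_mono [OF t_real] by simp
    qed
  qed
  then have "morley_sequence M n A p omega2 u"
    unfolding morley_sequence_def Field_omega2 by auto
  moreover have "infinite (Field (omega2 :: ('a + nat) rel))"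
    unfolding Field_omega2 by (simp add: finite_image_iff)
  ultimately have
    "{(\<phi>, b)\<in>insts L n (univ M). finite {i\<in>Field (omega2 :: ('a + nat) rel). \<not> holds M \<phi> (u i @ b)}}
      \<in> types L M n (univ M)"
    using p(2) Well_order_omega2 unfolding generically_stable_def by blast
  moreover have "(\<phi>, b) \<in> insts L n (univ M)"
    using b \<phi> by (auto simp: insts_def realizes_def tup_def)
  \<comment> \<open>The limit type contains \<open>\<phi>\<close> or its negation, so one of the two
    sets of exceptions would be finite; yet each contains an infinite range.\<close>
  ultimately have "finite {i\<in>Field (omega2 :: ('a + nat) rel). \<not> holds M \<phi> (u i @ b)} \<or>
      finite {i\<in>Field (omega2 :: ('a + nat) rel). holds M \<phi> (u i @ b)}"
    unfolding types_def by auto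
  moreover have "range (\<lambda>i. Inr (2 * i + 1)) \<subseteq> {i\<in>Field (omega2 :: ('a + nat) rel). \<not> holds M \<phi> (u i @ b)}"
    "range (\<lambda>i. Inr (2 * i)) \<subseteq> {i\<in>Field (omega2 :: ('a + nat) rel). holds M \<phi> (u i @ b)}"
    using hst by (auto simp: u_def Field_omega2)
  moreover have "infinite (range (\<lambda>i. Inr (2 * i + 1) :: 'a + nat))" "infinite (range (\<lambda>i. Inr (2 * i) :: 'a + nat))"
    by (auto simp: finite_image_iff inj_on_def)
  ultimately show False using finite_subset by blast
qed

text \<open>If symmetry failed, some formula over \<open>B\<close> would fail at pairs in Morley
  order and hold at pairs in the reverse order. An element in the middle of a Morley sequence, used
  as parameter, would then separate what precedes it from what follows it.\<close>

lemma real_swap: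
  assumes B: "A \<subseteq> B" "B \<subseteq> univ M" "small \<kappa> B" and xy: "real B x" "real (B \<union> set x) y"
  shows "real (B \<union> set y) x"
proof (rule ccontr)
  assume "\<not> real (B \<union> set y) x"
  have y: "real B y" using xy(2) by (rule real_mono) auto
  have "\<exists>\<phi> b. (\<phi>, b) \<in> p \<and> set b \<subseteq> B \<union> set y \<and> \<not> holds M \<phi> (x @ b)"
    using \<open>\<not> real (B \<union> set y) x\<close> realI real_tup [OF xy(1)] by blast
  then obtain \<phi>0 b0 where \<phi>0: "(\<phi>0, b0) \<in> p" "set b0 \<subseteq> B \<union> set y" "\<not> holds M \<phi>0 (x @ b0)"
    by blast
  \<comment> \<open>The parameters of \<open>\<phi>0\<close> come from \<open>B\<close> and from
    \<open>y\<close>. They are sorted into \<open>y @ b\<close> so that \<open>y\<close> can be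
    replaced by other elements.\<close>
  define b where "b = filter (\<lambda>z. z \<in> B) b0"
  have b: "set b \<subseteq> B" "set b \<subseteq> univ M" using B by (auto simp: b_def)
  have "\<exists>i<length (y @ b). (y @ b) ! i = z" if "z \<in> set b0" for z
    using that \<phi>0(2) unfolding in_set_conv_nth [symmetric] by (auto simp: b_def)
  then obtain idx where idx: "\<And>z. z \<in> set b0 \<Longrightarrow> idx z < length (y @ b) \<and> (y @ b) ! idx z = z"
    by metis
  have ylen: "length y = n" "length x = n" using xy by auto
  let ?I = "[0..<n] @ map (\<lambda>z. n + idx z) b0"
  define \<phi> where "\<phi> = sub ?I \<phi>0"
  have fml0: "\<phi>0 \<in> fml L (n + length b0)" using p_fml [OF \<phi>0(1)] by simp
  have \<phi>: "\<phi> \<in> fml L (n + (n + length b))"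
    using fml0 idx ylen unfolding \<phi>_def by (intro sub_fml) fastforce+
  have map_I: "map ((!) (w @ y @ b)) ?I = w @ b0" if "length w = n" for w
    using idx that by (auto simp: nth_append map_nth_upt intro!: map_idI)
  have holds_\<phi>: "holds M \<phi> (w @ y @ b) = holds M \<phi>0 (w @ b0)" if "length w = n" for w
    unfolding \<phi>_def using fml0 by (subst holds_sub) (auto simp: map_I [OF that] simp del: map_append)
  have p_\<phi>: "(\<phi>, y @ b) \<in> p"
  proof -
    have small: "small \<kappa> (B \<union> set y)" "B \<union> set y \<subseteq> univ M" using B real_set [OF y] by auto
    then obtain w where w: "real (B \<union> set y) w" using ex_real by blast
    have "holds M \<phi>0 (w @ b0)" using real_holds [OF w \<phi>0(2)] \<phi>0(1) fml0 p_fml by blast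
    then have "holds M \<phi> (w @ y @ b)" using holds_\<phi> w by simp
    then show ?thesis using real_holds [OF w, of "y @ b" \<phi>] b \<phi> real_set [OF y] by (auto simp: ylen)
  qed
  have not_\<phi>: "\<not> holds M \<phi> (x' @ y' @ b)" if mor': "mor B [x', y']" for x' y'
  proof -
    have "mor B [x, y]" using xy by simp
    then obtain \<sigma> where \<sigma>: "\<sigma> \<in> aut B" "map (map \<sigma>) [x, y] = [x', y']"
      using mor_unique [OF B _ mor'] by (metis length_Cons)
    have "holds M \<phi> (map \<sigma> (x @ y @ b)) = holds M \<phi> (x @ y @ b)"
      using b real_set xy y \<phi> by (intro aut_holds [OF \<sigma>(1)]) (auto simp: ylen)
    moreover have "map \<sigma> b = b" using \<sigma>(1) b(1) by (rule map_aut_id)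
    ultimately show ?thesis using \<sigma>(2) holds_\<phi> [of x] \<phi>0(3) by (simp add: ylen)
  qed
  have yes_\<phi>: "holds M \<phi> (x' @ y' @ b)" if "mor B [y', x']" for x' y'
  proof -
    have y': "real B y'" "real (B \<union> set y') x'" using that by auto
    obtain \<sigma> where \<sigma>: "\<sigma> \<in> aut B" "map \<sigma> y = y'"
      using real_unique [OF B y y'(1)] .
    have "(\<phi>, map \<sigma> (y @ b)) \<in> p"
      using p_\<phi> aut_mono [OF \<sigma>(1) B(1)] b real_set [OF y] \<phi> by (subst p_aut) (auto simp: ylen)
    moreover have "map \<sigma> b = b" using \<sigma>(1) b(1) by (rule map_aut_id)
    ultimately have "(\<phi>, y' @ b) \<in> p" using \<sigma>(2) by simp
    then show ?thesis
      using real_holds [OF y'(2), of "y' @ b" \<phi>] b p_fml [of \<phi> "y' @ b"] by auto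
  qed
  \<comment> \<open>\<open>no_alternation\<close> wants truth on the first half, and
    \<open>\<phi>\<close> fails before the middle element; hence the negation.\<close>
  have "Neg \<phi> \<in> fml L (n + (n + length b))" using \<phi> by simp
  from no_alternation [OF this] obtain K where K: "\<And>xs ys b'. mor A (xs @ ys) \<Longrightarrow> K \<le> length xs \<Longrightarrow> K \<le> length ys \<Longrightarrow>
    b' \<in> tup (univ M) (n + length b) \<Longrightarrow> (\<And>x. x \<in> set xs \<Longrightarrow> holds M (Neg \<phi>) (x @ b')) \<Longrightarrow>
    (\<And>y. y \<in> set ys \<Longrightarrow> \<not> holds M (Neg \<phi>) (y @ b')) \<Longrightarrow> False"
    by blast
  \<comment> \<open>\<open>K\<close> elements precede the middle one and \<open>K\<close> follow
    it.\<close>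
  obtain zs where zs: "mor B zs" "length zs = K + Suc K" using ex_mor [OF B(2,3)] by blast
  define xs z ys where "xs = take K zs" and "z = zs ! K" and "ys = drop (Suc K) zs"
  have split: "zs = xs @ z # ys" using zs(2) by (simp add: xs_def z_def ys_def id_take_nth_drop)
  have len: "length xs = K" "length ys = K" using zs(2) by (auto simp: xs_def ys_def)
  have mor_xs: "mor B xs" "real (B \<union> \<Union> (set ` set xs)) z" "mor (B \<union> \<Union> (set ` set xs) \<union> set z) ys"
    using zs(1) unfolding split mor_append by auto
  show False
  proof (rule K [of xs ys "z @ b"])
    have "mor (B \<union> \<Union> (set ` set xs)) ys" using mor_xs(3) by (rule mor_mono) auto
    then have "mor B (xs @ ys)" using mor_xs by (simp add: mor_append)
    then show "mor A (xs @ ys)" using B(1) by (rule mor_mono)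
    show "z @ b \<in> tup (univ M) (n + length b)" using real_tup [OF mor_xs(2)] b by (auto simp: tup_def)
    show "holds M (Neg \<phi>) (x @ z @ b)" if "x \<in> set xs" for x
    proof -
      have "mor B [x, z]" using mor_set [OF mor_xs(1) that] real_mono [OF mor_xs(2), of "B \<union> set x"] that by auto
      then show ?thesis using not_\<phi> by simp
    qed
    show "\<not> holds M (Neg \<phi>) (y @ z @ b)" if "y \<in> set ys" for y
    proof -
      have "mor B [z, y]"
        using real_mono [OF mor_set [OF mor_xs(3) that], of "B \<union> set z"] real_mono [OF mor_xs(2), of B]
        by auto
      then show ?thesis using yes_\<phi> by simp
    qed
  qed (use len in auto)
qed

text \<open>Adjacent exchanges, each an instance of \<open>real_swap\<close>, bring \<open>x\<close>
  to the front. Any member of a Morley sequence can thus be treated as its first.\<close>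

lemma mor_move:
  "A \<subseteq> B \<Longrightarrow> B \<subseteq> univ M \<Longrightarrow> small \<kappa> B \<Longrightarrow> mor B (us @ x # ws) \<Longrightarrow> mor B (x # us @ ws)"
proof (induction us arbitrary: B)
  case (Cons u us)
  have u: "real B u" "mor (B \<union> set u) (us @ x # ws)" using Cons.prems by auto
  have "mor (B \<union> set u) (x # us @ ws)"
    using Cons.prems real_set [OF u(1)] u(2) by (intro Cons.IH) auto
  then have x: "real (B \<union> set u) x" "mor (B \<union> set u \<union> set x) (us @ ws)" by auto
  have "real (B \<union> set x) u" using real_swap [OF Cons.prems(1-3) u(1) x(1)] .
  moreover have "real B x" using x(1) by (rule real_mono) auto
  ultimately show ?case using x(2) by (simp add: Un_ac)
qed simp

end
section \<open>Definability\<close>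

context monster
begin

lemma conj_inst:
  assumes "finite q" "q \<subseteq> insts L m B"
  obtains \<theta> e where "(\<theta>, e) \<in> insts L m B"
    "\<And>xs. length xs = m \<Longrightarrow> holds M \<theta> (xs @ e) \<longleftrightarrow> (\<forall>(\<phi>, b)\<in>q. holds M \<phi> (xs @ b))"
  by (rule finite_insts_conj [OF assms, where M = M], rule that [OF _ _]) (use is_struc in blast)+

text \<open>Checking one formula of the type at a time is enough because a type is closed under
  finite conjunction. The tuple \<open>z\<close> is an auxiliary unknown: empty in the application
  to definability, a pair of function values in the one to germs.\<close>

lemma tp_compactness:
  assumes B: "B \<subseteq> univ M" "small \<kappa> B" and uw: "set u \<subseteq> univ M" "set w \<subseteq> univ M" "set g \<subseteq> univ M"
    and l: "length w = l" and G: "G \<in> fml L (l + k + length g)"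
    and fin: "\<And>\<theta> e. (\<theta>, e) \<in> tp L M B (u @ w) \<Longrightarrow>
      \<exists>y\<in>tup (univ M) l. \<exists>z\<in>tup (univ M) k. holds M \<theta> (u @ y @ e) \<and> holds M G (y @ z @ g)"
  obtains y z where "y \<in> tup (univ M) l" "z \<in> tup (univ M) k"
    "tp L M B (u @ y) = tp L M B (u @ w)" "holds M G (y @ z @ g)"
proof -
  \<comment> \<open>The unknowns are \<open>y\<close> and \<open>z\<close>. The fixed tuple
    \<open>u\<close> moves to the parameters, and \<open>z\<close> is a dummy block for the formulas
    of the type.\<close>
  define f where "f = (\<lambda>(\<theta>, e). (sel [l, k, length u, length e] [2, 0, 3] \<theta> :: ('f, 'r) fm, u @ e))"
  let ?tp = "tp L M B (u @ w)"
  let ?C = "B \<union> (set u \<union> set g)"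
  have tp_insts: "?tp \<subseteq> insts L (length u + l) B" using l by (auto simp: tp_def)
  have holds_f: "holds M (fst (f (\<theta>, e))) ((y @ z) @ snd (f (\<theta>, e))) = holds M \<theta> (u @ y @ e)"
    if "(\<theta>, e) \<in> insts L (length u + l) B" "length y = l" "length z = k" for \<theta> e y z
    using that holds_sel [of \<theta> L "[y, z, u, e]" "[2, 0, 3]"] by (simp add: f_def insts_def add.assoc)
  have f_insts: "f x \<in> insts L (l + k) ?C" if "x \<in> insts L (length u + l) B" for x
    using that by (auto simp: f_def insts_def add.assoc intro!: sel_fml)
  have C: "?C \<subseteq> univ M" "small \<kappa> ?C" using B uw by auto
  have sub: "insert (G, g) (f ` ?tp) \<subseteq> insts L (l + k) ?C"
  proof -
    have "(G, g) \<in> insts L (l + k) ?C" using G by (auto simp: insts_def)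
    then show ?thesis using f_insts tp_insts by blast
  qed
  have "\<exists>a. realizes M id (l + k) q a" if q: "q \<subseteq> insert (G, g) (f ` ?tp)" "finite q" for q
  proof -
    have "q - {(G, g)} \<subseteq> f ` ?tp" "finite (q - {(G, g)})" using q by auto
    then obtain S where S: "S \<subseteq> ?tp" "finite S" "q - {(G, g)} = f ` S"
      by (metis finite_subset_image)
    obtain \<theta> e where \<theta>: "(\<theta>, e) \<in> insts L (length u + l) B"
      "\<And>xs. length xs = length u + l \<Longrightarrow> holds M \<theta> (xs @ e) \<longleftrightarrow> (\<forall>(\<phi>, b)\<in>S. holds M \<phi> (xs @ b))"
      by (rule conj_inst [OF S(2) subset_trans [OF S(1) tp_insts]]) blast
    have "(\<theta>, e) \<in> ?tp"
      using \<theta>(1) \<theta>(2) [of "u @ w"] S(1) l by (auto simp: tp_def)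
    then obtain y z where yz: "y \<in> tup (univ M) l" "z \<in> tup (univ M) k"
      "holds M \<theta> (u @ y @ e)" "holds M G (y @ z @ g)"
      using fin by blast
    have len: "length y = l" "length z = k" using yz(1,2) by (auto simp: tup_def)
    have "holds M (fst (f x)) ((y @ z) @ snd (f x))" if "x \<in> S" for x
    proof -
      obtain \<theta>' e' where x: "x = (\<theta>', e')" by fastforce
      have "holds M \<theta>' (u @ y @ e')" using \<theta>(2) [of "u @ y"] yz(3) that len x by auto
      then show ?thesis using holds_f [of \<theta>' e' y z] that x S(1) tp_insts len by auto
    qed
    then have "holds M (fst x) ((y @ z) @ snd x)" if "x \<in> q - {(G, g)}" for x
      using that unfolding S(3) by blast
    then have "case x of (\<phi>, b) \<Rightarrow> holds M \<phi> ((y @ z) @ map id b)" if "x \<in> q" for x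
      using that yz(4) by (cases "x = (G, g)") (auto simp: case_prod_beta)
    moreover have "y @ z \<in> tup (univ M) (l + k)" using yz by (auto simp: tup_def)
    ultimately show ?thesis unfolding realizes_def by blast
  qed
  from compactness [OF C sub this]
  obtain a where a: "realizes M id (l + k) (insert (G, g) (f ` ?tp)) a" .
  define y z where "y = take l a" and "z = drop l a"
  have a_eq: "a = y @ z" by (simp add: y_def z_def)
  have yz: "y \<in> tup (univ M) l" "z \<in> tup (univ M) k"
    using a set_take_subset [of l a] set_drop_subset [of l a]
    by (auto simp: realizes_def tup_def y_def z_def)
  have len: "length y = l" "length z = k" using yz by (auto simp: tup_def)
  show thesis
  proof
    show "y \<in> tup (univ M) l" "z \<in> tup (univ M) k" by fact+
    show "holds M G (y @ z @ g)" using realizesD [OF a, of G g] by (simp add: a_eq)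
    have imp: "holds M \<theta> (u @ y @ e)" if "(\<theta>, e) \<in> ?tp" for \<theta> e
    proof -
      have "f (\<theta>, e) = (fst (f (\<theta>, e)), snd (f (\<theta>, e)))" by simp
      then have "holds M (fst (f (\<theta>, e))) (a @ snd (f (\<theta>, e)))"
        using realizesD [OF a, of "fst (f (\<theta>, e))" "snd (f (\<theta>, e))"] that by simp
      then show ?thesis using holds_f [of \<theta> e y z] that tp_insts len by (auto simp: a_eq)
    qed
    \<comment> \<open>The converse implication comes from applying \<open>imp\<close> to the
      negation.\<close>
    have "holds M \<theta> (u @ y @ e) \<longleftrightarrow> holds M \<theta> (u @ w @ e)" if "(\<theta>, e) \<in> insts L (length u + l) B" for \<theta> e
      using imp [of \<theta> e] imp [of "Neg \<theta>" e] that l by (auto simp: tp_def insts_def)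
    then show "tp L M B (u @ y) = tp L M B (u @ w)" using len l by (auto simp: tp_def)
  qed
qed

end

context generically_stable_type
begin

section \<open>Definability of \<open>p\<close> over \<open>A\<close>\<close>

lemma p_invariant:
  "tp L M A b = tp L M A b' \<Longrightarrow> b \<in> tup (univ M) m \<Longrightarrow> b' \<in> tup (univ M) m \<Longrightarrow> \<phi> \<in> fml L (n + m) \<Longrightarrow>
    (\<phi>, b) \<in> p \<longleftrightarrow> (\<phi>, b') \<in> p"
  using p(2) unfolding generically_stable_def invariant_type_def by blast

text \<open>If the instance were not in \<open>p\<close>, then \<open>K\<close> further elements
  realizing \<open>p\<close> over everything so far would violate it and complete an
  alternation.\<close>

lemma mem_p_of_mor:
  assumes \<phi>: "\<phi> \<in> fml L (n + m)"
  obtains K where "\<And>zs b. mor A zs \<Longrightarrow> K \<le> length zs \<Longrightarrow> b \<in> tup (univ M) m \<Longrightarrow>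
    (\<And>z. z \<in> set zs \<Longrightarrow> holds M \<phi> (z @ b)) \<Longrightarrow> (\<phi>, b) \<in> p"
proof -
  obtain K where K: "\<And>xs ys b. mor A (xs @ ys) \<Longrightarrow> K \<le> length xs \<Longrightarrow> K \<le> length ys \<Longrightarrow>
    b \<in> tup (univ M) m \<Longrightarrow> (\<And>x. x \<in> set xs \<Longrightarrow> holds M \<phi> (x @ b)) \<Longrightarrow>
    (\<And>y. y \<in> set ys \<Longrightarrow> \<not> holds M \<phi> (y @ b)) \<Longrightarrow> False"
    using no_alternation [OF \<phi>] by blast
  show thesis
  proof (rule that [of K], rule ccontr)
    fix zs b assume zs: "mor A zs" "K \<le> length zs" and b: "b \<in> tup (univ M) m"
      and holds: "\<And>z. z \<in> set zs \<Longrightarrow> holds M \<phi> (z @ b)" and not: "(\<phi>, b) \<notin> p"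
    let ?C = "A \<union> (set (concat zs) \<union> set b)"
    have "?C \<subseteq> univ M" "small \<kappa> ?C" using A mor_concat [OF zs(1)] b by (auto simp: tup_def)
    then obtain ys where ys: "mor ?C ys" "length ys = K" using ex_mor by blast
    have "mor (A \<union> \<Union> (set ` set zs)) ys" using ys(1) by (rule mor_mono) auto
    then have "mor A (zs @ ys)" using zs by (simp add: mor_append)
    moreover have "\<not> holds M \<phi> (y @ b)" if "y \<in> set ys" for y
      using real_holds [OF mor_set [OF ys(1) that], of b \<phi>] not b \<phi> by (auto simp: tup_def)
    ultimately show False using K [of zs ys b] zs(2) ys(2) b holds by simp
  qed
qed

text \<open>Membership in \<open>p\<close> can be tested along one fixed Morley sequence
  \<open>zs\<close>, but only after moving \<open>b\<close> by an automorphism over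
  \<open>A\<close>. Two uses of compactness remove \<open>zs\<close>: the set of \<open>b\<close>
  whose instance is in \<open>p\<close> is a union of sets defined over \<open>A\<close>, and
  finitely many of these suffice.\<close>

lemma p_definable:
  assumes \<phi>: "\<phi> \<in> fml L (n + m)"
  obtains \<theta> e where "(\<theta>, e) \<in> insts L m A"
    "\<And>b. b \<in> tup (univ M) m \<Longrightarrow> (\<phi>, b) \<in> p \<longleftrightarrow> holds M \<theta> (b @ e)"
proof -
  obtain K1 where K1: "\<And>zs b. mor A zs \<Longrightarrow> K1 \<le> length zs \<Longrightarrow> b \<in> tup (univ M) m \<Longrightarrow>
    (\<And>z. z \<in> set zs \<Longrightarrow> holds M \<phi> (z @ b)) \<Longrightarrow> (\<phi>, b) \<in> p"
    using mem_p_of_mor [OF \<phi>] by blast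
  have "Neg \<phi> \<in> fml L (n + m)" using \<phi> by simp
  then obtain K2 where K2: "\<And>zs b. mor A zs \<Longrightarrow> K2 \<le> length zs \<Longrightarrow> b \<in> tup (univ M) m \<Longrightarrow>
    (\<And>z. z \<in> set zs \<Longrightarrow> holds M (Neg \<phi>) (z @ b)) \<Longrightarrow> (Neg \<phi>, b) \<in> p"
    using mem_p_of_mor by blast
  \<comment> \<open>Long enough for both bounds: a constant truth value along \<open>zs\<close>
    decides membership either way.\<close>
  obtain zs where zs: "mor A zs" "length zs = max K1 K2" using ex_mor [OF A] by blast
  have z_len: "length z = n" "set z \<subseteq> univ M" if "z \<in> set zs" for z
    using mor_set [OF zs(1) that] real_set by auto
  have pos: "(\<phi>, b) \<in> p" if "b \<in> tup (univ M) m" "\<And>z. z \<in> set zs \<Longrightarrow> holds M \<phi> (z @ b)" for b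
    using K1 [OF zs(1)] zs(2) that by simp
  have neg: "(\<phi>, b) \<notin> p" if "b \<in> tup (univ M) m" "\<And>z. z \<in> set zs \<Longrightarrow> \<not> holds M \<phi> (z @ b)" for b
    using K2 [OF zs(1), of b] zs(2) that p_Neg [of \<phi> b] \<phi> by (auto simp: tup_def)
  \<comment> \<open>Along a Morley sequence over \<open>A b\<close> the truth value is constant;
    carrying that sequence onto \<open>zs\<close> takes \<open>b\<close> to a conjugate with the
    same property.\<close>
  have conj: "\<exists>\<sigma>\<in>aut A. \<forall>z\<in>set zs. holds M \<phi> (z @ map \<sigma> b) \<longleftrightarrow> (\<phi>, b) \<in> p"
    if b: "b \<in> tup (univ M) m" for b
  proof -
    have "A \<union> set b \<subseteq> univ M" "small \<kappa> (A \<union> set b)" using A b by (auto simp: tup_def)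
    then obtain ys where ys: "mor (A \<union> set b) ys" "length ys = length zs" using ex_mor by blast
    have "mor A ys" using ys(1) by (rule mor_mono) auto
    then obtain \<sigma> where \<sigma>: "\<sigma> \<in> aut A" "map (map \<sigma>) ys = zs"
      using mor_unique [OF subset_refl A _ zs(1)] ys(2) by metis
    have "holds M \<phi> (z @ map \<sigma> b) \<longleftrightarrow> (\<phi>, b) \<in> p" if z: "z \<in> set zs" for z
    proof -
      obtain y where y: "y \<in> set ys" "z = map \<sigma> y" using z unfolding \<sigma>(2) [symmetric] by auto
      have "real (A \<union> set b) y" using ys(1) y(1) by (rule mor_set)
      then show ?thesis
        using real_holds [of "A \<union> set b" y b \<phi>] aut_holds [OF \<sigma>(1), of \<phi> "y @ b"] b \<phi> real_set [of _ y] y(2)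
        by (auto simp: tup_def)
    qed
    then show ?thesis using \<sigma>(1) by blast
  qed
  define \<phi>' where "\<phi>' = sel [m, n] [1, 0] \<phi>"
  have \<phi>': "\<phi>' \<in> fml L (m + n)" using \<phi> by (auto simp: \<phi>'_def intro!: sel_fml)
  have holds_\<phi>': "holds M \<phi>' (b @ x) = holds M \<phi> (x @ b)" if "length b = m" "length x = n" for b x
    using that \<phi> holds_sel [of \<phi> L "[b, x]" "[1, 0]"] by (simp add: \<phi>'_def)
  have invariant: "holds M \<theta> (map \<sigma> b @ e) = holds M \<theta> (b @ e)"
    if "(\<theta>, e) \<in> insts L m A" "\<sigma> \<in> aut A" "b \<in> tup (univ M) m" for \<theta> e \<sigma> b
    using that aut_holds [of \<sigma> A \<theta> "b @ e"] map_aut_id [of \<sigma> A e] A(1)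
    by (auto simp: insts_def tup_def)
  \<comment> \<open>The formulas over \<open>A\<close> that imply membership; \<open>nbhd\<close>
    shows that they cover all members.\<close>
  define X where "X = {(\<theta>, e)\<in>insts L m A. \<forall>b\<in>tup (univ M) m. holds M \<theta> (b @ e) \<longrightarrow> (\<phi>, b) \<in> p}"
  have nbhd: "\<exists>(\<theta>, e)\<in>X. holds M \<theta> (b @ e)" if b: "b \<in> tup (univ M) m" "(\<phi>, b) \<in> p" for b
  proof (rule ccontr)
    assume not: "\<not> ?thesis"
    let ?C = "set (concat zs)"
    have G_insts: "(\<lambda>z. (Neg \<phi>', z)) ` set zs \<subseteq> insts L m ?C" using \<phi>' z_len by (auto simp: insts_def)
    \<comment> \<open>\<open>G\<close> says that \<open>\<phi>\<close> fails along
      \<open>zs\<close>. If no formula true of \<open>b\<close> were in \<open>X\<close>, some tuple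
      of the same type over \<open>A\<close> would satisfy \<open>G\<close>, and its instance would
      be outside \<open>p\<close>, against invariance.\<close>
    obtain G g where G: "(G, g) \<in> insts L m ?C"
      "\<And>xs. length xs = m \<Longrightarrow> holds M G (xs @ g) \<longleftrightarrow> (\<forall>(\<phi>, b)\<in>(\<lambda>z. (Neg \<phi>', z)) ` set zs. holds M \<phi> (xs @ b))"
      by (rule conj_inst [OF finite_imageI [OF finite_set] G_insts]) blast
    have holds_G: "holds M G (y @ g) \<longleftrightarrow> (\<forall>z\<in>set zs. \<not> holds M \<phi> (z @ y))" if "y \<in> tup (univ M) m" for y
      using that G(2) [of y] holds_\<phi>' z_len by (auto simp: tup_def)
    have fin: "\<exists>y\<in>tup (univ M) m. \<exists>z\<in>tup (univ M) 0. holds M \<theta> ([] @ y @ e) \<and> holds M G (y @ z @ g)"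
      if \<theta>: "(\<theta>, e) \<in> tp L M A ([] @ b)" for \<theta> e
    proof -
      have \<theta>': "(\<theta>, e) \<in> insts L m A" "holds M \<theta> (b @ e)" using \<theta> b by (auto simp: tp_def tup_def)
      then have "(\<theta>, e) \<notin> X" using not by auto
      then obtain b' where b': "b' \<in> tup (univ M) m" "holds M \<theta> (b' @ e)" "(\<phi>, b') \<notin> p"
        using \<theta>'(1) unfolding X_def by auto
      then obtain \<sigma> where \<sigma>: "\<sigma> \<in> aut A" "\<forall>z\<in>set zs. \<not> holds M \<phi> (z @ map \<sigma> b')" using conj by blast
      have "holds M \<theta> (map \<sigma> b' @ e)" using invariant [OF \<theta>'(1) \<sigma>(1) b'(1)] b'(2) by simp
      moreover have "map \<sigma> b' \<in> tup (univ M) m" using \<sigma>(1) b'(1) by (rule aut_tup)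
      ultimately show ?thesis using holds_G \<sigma>(2) by (intro bexI [of _ "map \<sigma> b'"] bexI [of _ "[]"]) (auto simp: tup_def)
    qed
    have bg: "set [] \<subseteq> univ M" "set b \<subseteq> univ M" "set g \<subseteq> univ M" "length b = m" "G \<in> fml L (m + 0 + length g)"
      using b G(1) mor_concat [OF zs(1)] by (auto simp: tup_def insts_def)
    obtain y z where y: "y \<in> tup (univ M) m" "z \<in> tup (univ M) 0" "tp L M A ([] @ y) = tp L M A ([] @ b)"
        "holds M G (y @ z @ g)"
      using tp_compactness [OF A bg fin] .
    have "z = []" using y(2) by (simp add: tup_def)
    then have "(\<phi>, y) \<notin> p" using neg [OF y(1)] holds_G [OF y(1)] y(4) by auto
    moreover have "(\<phi>, y) \<in> p \<longleftrightarrow> (\<phi>, b) \<in> p" using p_invariant [OF _ y(1) b(1) \<phi>] y(3) by simp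
    ultimately show False using b(2) by simp
  qed
  \<comment> \<open>No tuple satisfies \<open>\<phi>\<close> along \<open>zs\<close> and avoids all
    of \<open>X\<close>. By compactness finitely many formulas of \<open>X\<close> cover the tuples
    of the first kind, and by conjugation all members.\<close>
  let ?q1 = "(\<lambda>(\<theta>, e). (Neg \<theta>, e)) ` X" and ?q2 = "(\<lambda>z. (\<phi>', z)) ` set zs"
  let ?C = "A \<union> set (concat zs)"
  have C: "?C \<subseteq> univ M" "small \<kappa> ?C" using A mor_concat [OF zs(1)] by auto
  have sub1: "?q1 \<subseteq> insts L m A" by (auto simp: X_def insts_def)
  have sub: "?q1 \<union> ?q2 \<subseteq> insts L m ?C" using sub1 \<phi>' z_len by (auto simp: insts_def)
  have "\<not> realizes M id m (?q1 \<union> ?q2) b" for b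
  proof
    assume b: "realizes M id m (?q1 \<union> ?q2) b"
    then have b_tup: "b \<in> tup (univ M) m" by (simp add: realizes_def)
    have "holds M \<phi> (z @ b)" if "z \<in> set zs" for z
      using realizesD [OF b, of \<phi>' z] that holds_\<phi>' z_len b_tup by (auto simp: tup_def)
    then have "(\<phi>, b) \<in> p" using pos b_tup by blast
    then obtain \<theta> e where "(\<theta>, e) \<in> X" "holds M \<theta> (b @ e)" using nbhd b_tup by blast
    then show False using realizesD [OF b, of "Neg \<theta>" e] by force
  qed
  then obtain q where q: "q \<subseteq> ?q1 \<union> ?q2" "finite q" "\<And>b. \<not> realizes M id m q b"
    using compactness [OF C sub] by metis
  have q1: "finite (q \<inter> ?q1)" "q \<inter> ?q1 \<subseteq> insts L m A" using q(2) sub1 by auto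
  obtain \<theta> e where \<theta>: "(\<theta>, e) \<in> insts L m A"
    "\<And>xs. length xs = m \<Longrightarrow> holds M \<theta> (xs @ e) \<longleftrightarrow> (\<forall>(\<phi>, b)\<in>q \<inter> ?q1. holds M \<phi> (xs @ b))"
    by (rule conj_inst [OF q1]) blast
  show thesis
  \<comment> \<open>Up to equivalence, \<open>Neg \<theta>\<close> is the disjunction of these
    finitely many members of \<open>X\<close>.\<close>
  proof (rule that [of "Neg \<theta>" e])
    show "(Neg \<theta>, e) \<in> insts L m A" using \<theta>(1) by (simp add: insts_def)
    fix b assume b: "b \<in> tup (univ M) m"
    show "(\<phi>, b) \<in> p \<longleftrightarrow> holds M (Neg \<theta>) (b @ e)"
    proof
      assume "(\<phi>, b) \<in> p"
      then obtain \<sigma> where \<sigma>: "\<sigma> \<in> aut A" "\<forall>z\<in>set zs. holds M \<phi> (z @ map \<sigma> b)" using conj [OF b] by blast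
      have b': "map \<sigma> b \<in> tup (univ M) m" using \<sigma>(1) b by (rule aut_tup)
      have "\<not> holds M \<theta> (map \<sigma> b @ e)"
      proof
        assume "holds M \<theta> (map \<sigma> b @ e)"
        then have 1: "\<forall>(\<phi>, b')\<in>q \<inter> ?q1. holds M \<phi> (map \<sigma> b @ b')" using \<theta>(2) [of "map \<sigma> b"] b by (simp add: tup_def)
        have 2: "holds M \<phi>' (map \<sigma> b @ z)" if "z \<in> set zs" for z
          using holds_\<phi>' \<sigma>(2) that z_len b by (auto simp: tup_def)
        have "case x of (\<phi>, b') \<Rightarrow> holds M \<phi> (map \<sigma> b @ map id b')" if "x \<in> q" for x
        proof (cases "x \<in> ?q1")
          case True
          then show ?thesis using 1 that by auto
        next
          case False
          then show ?thesis using 2 that q(1) by auto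
        qed
        then show False using q(3) [of "map \<sigma> b"] b' unfolding realizes_def by blast
      qed
      then show "holds M (Neg \<theta>) (b @ e)" using invariant [OF \<theta>(1) \<sigma>(1) b] by simp
    next
      assume "holds M (Neg \<theta>) (b @ e)"
      then obtain x where "x \<in> X" "\<not> holds M (Neg (fst x)) (b @ snd x)"
        using \<theta>(2) [of b] b by (auto simp: tup_def)
      then show "(\<phi>, b) \<in> p" using b unfolding X_def by auto
    qed
  qed
qed

end
section \<open>Functions with the same germ and conjugate parameters\<close>

text \<open>Agreement of two values includes their existence, so the instance with both parameters
  equal expresses that the function is defined. As a formula it is decided by
  \<open>p\<close>.\<close>

definition agr :: "nat \<Rightarrow> nat \<Rightarrow> nat \<Rightarrow> ('f, 'r) fm \<Rightarrow> ('f, 'r) fm" where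
  "agr n k l \<psi> = Exs (n + l + l) k (And (sel [n, l, l, k] [0, 3, 1] \<psi>) (sel [n, l, l, k] [0, 3, 2] \<psi>))"

lemma agr_fml: "\<psi> \<in> fml L (n + k + l) \<Longrightarrow> agr n k l \<psi> \<in> fml L (n + (l + l))"
proof -
  assume "\<psi> \<in> fml L (n + k + l)"
  then have "And (sel [n, l, l, k] [0, 3, 1] \<psi>) (sel [n, l, l, k] [0, 3, 2] \<psi>) \<in> fml L (n + l + l + k)"
    by (auto intro!: sel_fml simp: add.assoc)
  then show ?thesis unfolding agr_def by (metis Exs_fml add.assoc)
qed

lemma holds_agr:
  assumes "\<psi> \<in> fml L (n + k + l)" "length x = n" "length c1 = l" "length c2 = l"
  shows "holds M (agr n k l \<psi>) (x @ c1 @ c2) \<longleftrightarrow> (\<exists>v. fun_val M k \<psi> c1 x v \<and> fun_val M k \<psi> c2 x v)"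
proof -
  let ?\<chi> = "And (sel [n, l, l, k] [0, 3, 1] \<psi>) (sel [n, l, l, k] [0, 3, 2] \<psi>)"
  have \<chi>: "?\<chi> \<in> fml L (length (x @ c1 @ c2) + k)"
    using assms by (auto intro!: sel_fml simp: add.assoc)
  have len: "n + l + l = length (x @ c1 @ c2)" using assms by simp
  have "holds M (agr n k l \<psi>) (x @ c1 @ c2) \<longleftrightarrow> (\<exists>v\<in>tup (univ M) k. holds M ?\<chi> ((x @ c1 @ c2) @ v))"
    unfolding agr_def len using \<chi> by (rule holds_Exs)
  also have "\<dots> \<longleftrightarrow> (\<exists>v\<in>tup (univ M) k. holds M \<psi> (x @ v @ c1) \<and> holds M \<psi> (x @ v @ c2))"
  proof (rule bex_cong [OF refl])
    fix v assume "v \<in> tup (univ M) k"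
    then show "holds M ?\<chi> ((x @ c1 @ c2) @ v) \<longleftrightarrow> holds M \<psi> (x @ v @ c1) \<and> holds M \<psi> (x @ v @ c2)"
      using assms holds_sel [of \<psi> L "[x, c1, c2, v]" "[0, 3, 1]"] holds_sel [of \<psi> L "[x, c1, c2, v]" "[0, 3, 2]"]
      by (simp add: tup_def add.assoc)
  qed
  finally show ?thesis by (auto simp: fun_val_def)
qed

context generically_stable_type
begin

text \<open>Two values of the conjugate are pulled back by the inverse of \<open>\<tau>\<close> to
  two values of \<open>f_c\<close>. Single-valuedness is assumed for \<open>c\<close>, while later
  arguments pass through its conjugates.\<close>

lemma conjugate_partial_definable_function:
  assumes f: "partial_definable_function L M n k \<psi> c" and \<tau>: "\<tau> \<in> aut A"
  shows "partial_definable_function L M n k \<psi> (map \<tau> c)"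
  unfolding partial_definable_function_def
proof (intro conjI ballI allI impI)
  have \<psi>: "\<psi> \<in> fml L (n + k + length c)" and c: "set c \<subseteq> univ M"
    using f by (auto simp: partial_definable_function_def)
  show c': "set (map \<tau> c) \<subseteq> univ M" using \<tau> c by auto
  show "\<psi> \<in> fml L (n + k + length (map \<tau> c))" using \<psi> by simp
  fix x v w assume x: "x \<in> tup (univ M) n"
    and vw: "fun_val M k \<psi> (map \<tau> c) x v \<and> fun_val M k \<psi> (map \<tau> c) x w"
  obtain \<rho> where \<rho>: "\<rho> \<in> aut A" "\<And>x. x \<in> univ M \<Longrightarrow> \<tau> (\<rho> x) = x" "\<And>x. x \<in> univ M \<Longrightarrow> \<rho> (\<tau> x) = x"
    using aut_inv [OF \<tau> A(1)] by blast
  have \<rho>c: "map \<rho> (map \<tau> c) = c" using \<rho>(3) c by (auto intro!: map_idI)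
  have *: "fun_val M k \<psi> c (map \<rho> x) (map \<rho> u)" if "fun_val M k \<psi> (map \<tau> c) x u" for u
  proof -
    have "holds M \<psi> (map \<rho> (x @ u @ map \<tau> c)) = holds M \<psi> (x @ u @ map \<tau> c)"
      using that x c' \<psi> by (intro aut_holds [OF \<rho>(1)]) (auto simp: fun_val_def tup_def add.assoc)
    then show ?thesis using that aut_tup [OF \<rho>(1)] \<rho>c unfolding fun_val_def by (simp del: map_map)
  qed
  have "map \<rho> v = map \<rho> w"
    using f aut_tup [OF \<rho>(1) x] * vw unfolding partial_definable_function_def by blast
  moreover have "set v \<subseteq> univ M" "set w \<subseteq> univ M" using vw by (auto simp: fun_val_def tup_def)
  ultimately show "v = w"
    using aut_inj [OF \<rho>(1)] by (metis Un_least inj_on_map_eq_map inj_on_subset)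
qed

lemma partial_definable_functionD:
  "partial_definable_function L M n k \<psi> c \<Longrightarrow> a \<in> tup (univ M) n \<Longrightarrow>
    fun_val M k \<psi> c a v \<Longrightarrow> fun_val M k \<psi> c a w \<Longrightarrow> v = w"
  unfolding partial_definable_function_def by blast

text \<open>If \<open>f\<^sub>c\<close> and \<open>f\<^bsub>\<sigma> c\<^esub>\<close> have the same germ but differ at \<open>a\<close>, then by indiscernibility any set of
  elements of a Morley sequence over \<open>A c\<close> is the set where \<open>f\<^sub>c\<close> and a suitable conjugate of \<open>f\<^sub>c\<close>
  differ, against \<open>no_alternation\<close>.\<close>

lemma conjugate_same_germ_agree:
  assumes f: "partial_definable_function L M n k \<psi> c" and l: "length c = l"
    and dfd: "(agr n k l \<psi>, c @ c) \<in> p"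
    and a: "real (A \<union> set c) a" and \<sigma>: "\<sigma> \<in> aut (A \<union> set a)"
    and germ: "(agr n k l \<psi>, c @ map \<sigma> c) \<in> p"
  shows "holds M (agr n k l \<psi>) (a @ c @ map \<sigma> c)"
proof (rule ccontr)
  have \<psi>: "\<psi> \<in> fml L (n + k + l)" and c: "c \<in> tup (univ M) l"
    using f l by (auto simp: partial_definable_function_def tup_def)
  define ag where "ag c1 c2 x \<longleftrightarrow> (\<exists>v. fun_val M k \<psi> c1 x v \<and> fun_val M k \<psi> c2 x v)" for c1 c2 x
  have holds_ag: "holds M (agr n k l \<psi>) (x @ c1 @ c2) \<longleftrightarrow> ag c1 c2 x"
    if "x \<in> tup (univ M) n" "c1 \<in> tup (univ M) l" "c2 \<in> tup (univ M) l" for x c1 c2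
    unfolding ag_def using that \<psi> by (intro holds_agr) (auto simp: tup_def)
  have agr: "agr n k l \<psi> \<in> fml L (n + (l + l))" using \<psi> by (rule agr_fml)
  assume "\<not> holds M (agr n k l \<psi>) (a @ c @ map \<sigma> c)"
  then have not_ag: "\<not> ag c (map \<sigma> c) a"
    using holds_ag real_tup [OF a] c aut_tup [OF \<sigma> c] by blast
  have ag_sym: "ag c1 c2 x \<Longrightarrow> ag c2 c1 x" for c1 c2 x unfolding ag_def by blast
  \<comment> \<open>Transitivity needs only the middle function to be single-valued, so only its
    parameter has to be conjugate to \<open>c\<close>.\<close>
  have ag_trans: "ag c1 c2 x" if "\<tau> \<in> aut A" "x \<in> tup (univ M) n" "ag c1 (map \<tau> c) x" "ag (map \<tau> c) c2 x"
    for \<tau> c1 c2 x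
    using that partial_definable_functionD [OF conjugate_partial_definable_function [OF f that(1)] that(2)]
    unfolding ag_def by metis
  have id: "id \<in> aut A" by (auto simp: aut_def automorphism_def id_def bij_betw_def)
  have ag_aut: "ag (map \<tau> c1) (map \<tau> c2) (map \<tau> x) \<longleftrightarrow> ag c1 c2 x"
    if "\<tau> \<in> aut A" "x \<in> tup (univ M) n" "c1 \<in> tup (univ M) l" "c2 \<in> tup (univ M) l" for \<tau> x c1 c2
  proof -
    have "holds M (agr n k l \<psi>) (map \<tau> (x @ c1 @ c2)) = holds M (agr n k l \<psi>) (x @ c1 @ c2)"
      using that agr by (intro aut_holds [OF that(1)]) (auto simp: tup_def)
    then show ?thesis using holds_ag that aut_tup [OF that(1)] by simp
  qed
  define B where "B = A \<union> set c"
  have B: "A \<subseteq> B" "B \<subseteq> univ M" "small \<kappa> B" using A c by (auto simp: B_def tup_def)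
  \<comment> \<open>A prescribed pattern: disagreement on \<open>us\<close>, agreement on
    \<open>ws\<close>. Fixing the elements pointwise is what allows patterns to be composed.\<close>
  define Q where "Q us ws g \<longleftrightarrow> g \<in> aut A \<and> (\<forall>x\<in>set us \<union> set ws. map g x = x) \<and>
    (\<forall>x\<in>set us. \<not> ag c (map g c) x) \<and> (\<forall>x\<in>set ws. ag c (map g c) x)" for us ws g
  have \<sigma>A: "\<sigma> \<in> aut A" and \<sigma>a: "map \<sigma> a = a" using aut_mono [OF \<sigma>] map_aut_id [OF \<sigma>, of a] by auto
  have single: "\<exists>g. Q [x] ws g" if mor: "mor B (x # ws)" for x ws
  proof -
    \<comment> \<open>\<open>ys\<close> is generic over both parameters, so the two functions agree
      on it. \<open>?D\<close> leaves out \<open>c\<close>, since the image of \<open>ys\<close>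
      under \<open>\<sigma>\<close> is known to be Morley only over the image of
      \<open>A c a\<close>.\<close>
    let ?C = "A \<union> (set c \<union> set (map \<sigma> c) \<union> set a)" and ?D = "A \<union> (set (map \<sigma> c) \<union> set a)"
    have c': "map \<sigma> c \<in> tup (univ M) l" using \<sigma> c by (rule aut_tup)
    have C: "?C \<subseteq> univ M" "small \<kappa> ?C" and D: "?D \<subseteq> univ M" "small \<kappa> ?D" "A \<subseteq> ?D"
      using A c c' real_set [OF a] by (auto simp: tup_def)
    obtain ys where ys: "mor ?C ys" "length ys = length ws" using ex_mor [OF C] by blast
    have "mor (A \<union> (set c \<union> set a)) ys" using ys(1) by (rule mor_mono) auto
    then have "mor (\<sigma> ` (A \<union> (set c \<union> set a))) (map (map \<sigma>) ys)"
      using C by (intro mor_aut [OF \<sigma>A]) auto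
    moreover have "\<sigma> ` A = A" "\<sigma> ` set a = set a" using \<sigma> by (force simp: aut_def)+
    then have "\<sigma> ` (A \<union> (set c \<union> set a)) = ?D" by (simp add: image_Un)
    ultimately have "mor ?D (map (map \<sigma>) ys)" by simp
    moreover have "mor ?D ys" using ys(1) by (rule mor_mono) auto
    \<comment> \<open>\<open>\<delta>\<close> brings the moved tail back while fixing
      \<open>A\<close>, \<open>a\<close> and the image of \<open>c\<close>. Applied after
      \<open>\<sigma>\<close>, it leaves the effect on \<open>c\<close> unchanged and makes the
      composition fix \<open>a\<close> and \<open>ys\<close>.\<close>
    ultimately obtain \<delta> where \<delta>: "\<delta> \<in> aut ?D" "map (map \<delta>) (map (map \<sigma>) ys) = ys"
      using mor_unique [OF D(3,1,2)] by (metis length_map)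
    define \<gamma> where "\<gamma> = \<delta> \<circ> \<sigma>"
    have \<gamma>: "\<gamma> \<in> aut A" unfolding \<gamma>_def using aut_mono [OF \<delta>(1) D(3)] \<sigma>A by (rule aut_comp)
    have \<gamma>c: "map \<gamma> c = map \<sigma> c"
      using map_aut_id [OF \<delta>(1), of "map \<sigma> c"] unfolding \<gamma>_def by (auto simp: subset_iff)
    have \<gamma>a: "map \<gamma> a = a"
      using map_aut_id [OF \<delta>(1), of a] \<sigma>a by (metis \<gamma>_def Un_upper2 le_sup_iff map_map)
    have \<gamma>ys: "map \<gamma> y = y" if "y \<in> set ys" for y
    proof -
      have "map (map \<gamma>) ys = map id ys" using \<delta>(2) by (simp add: \<gamma>_def)
      then show ?thesis using that by (simp only: map_eq_conv) simp
    qed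
    have ys_ag: "ag c (map \<sigma> c) y" if "y \<in> set ys" for y
    proof -
      have y: "real ?C y" using ys(1) that by (rule mor_set)
      have "set (c @ map \<sigma> c) \<subseteq> univ M" "length (c @ map \<sigma> c) = l + l" using c c' by (auto simp: tup_def)
      then have "holds M (agr n k l \<psi>) (y @ c @ map \<sigma> c)"
        using real_holds [OF y, of "c @ map \<sigma> c" "agr n k l \<psi>"] germ agr by auto
      then show ?thesis using holds_ag [OF real_tup [OF y] c c'] by simp
    qed
    have "mor (B \<union> set a) ys" using ys(1) by (rule mor_mono) (auto simp: B_def)
    then have "mor B (a # ys)" using a by (simp add: B_def)
    \<comment> \<open>\<open>a # ys\<close> and the given sequence are both Morley over
      \<open>B\<close>, so conjugation by an automorphism over \<open>A c\<close> transports the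
      pattern.\<close>
    then obtain \<tau> where \<tau>: "\<tau> \<in> aut B" "map (map \<tau>) (a # ys) = x # ws"
      using mor_unique [OF B _ mor] ys(2) by (metis length_Cons)
    obtain \<rho> where \<rho>: "\<rho> \<in> aut B" "\<And>x. x \<in> univ M \<Longrightarrow> \<tau> (\<rho> x) = x" "\<And>x. x \<in> univ M \<Longrightarrow> \<rho> (\<tau> x) = x"
      using aut_inv [OF \<tau>(1) B(2)] by blast
    define g where "g = \<tau> \<circ> \<gamma> \<circ> \<rho>"
    have \<tau>A: "\<tau> \<in> aut A" and \<rho>A: "\<rho> \<in> aut A" using \<tau> \<rho> B(1) by (auto intro: aut_mono)
    have g: "g \<in> aut A" unfolding g_def using \<tau>A \<rho>A \<gamma> by (intro aut_comp)
    have \<rho>\<tau>: "map \<rho> (map \<tau> y) = y" if "set y \<subseteq> univ M" for y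
      using that \<rho>(3) by (auto intro!: map_idI)
    have g_\<tau>: "map g (map \<tau> y) = map \<tau> (map \<gamma> y)" if "set y \<subseteq> univ M" for y
    proof -
      have "map g (map \<tau> y) = map \<tau> (map \<gamma> (map \<rho> (map \<tau> y)))" by (simp add: g_def)
      then show ?thesis by (simp only: \<rho>\<tau> [OF that])
    qed
    have \<tau>c: "map \<tau> c = c" using \<tau>(1) by (rule map_aut_id) (simp add: B_def)
    have gc: "map g c = map \<tau> (map \<sigma> c)" using g_\<tau> [of c] c by (simp add: \<tau>c \<gamma>c tup_def)
    have g_ag: "ag c (map g c) (map \<tau> y) \<longleftrightarrow> ag c (map \<sigma> c) y" if "y \<in> tup (univ M) n" for y
      using ag_aut [OF \<tau>A that c c'] by (simp only: gc \<tau>c)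
    have x: "x = map \<tau> a" "ws = map (map \<tau>) ys" using \<tau>(2) by auto
    have "map g x = x" using g_\<tau> [of a] real_set [OF a] \<gamma>a by (simp only: x)
    moreover have "\<not> ag c (map g c) x" using g_ag [OF real_tup [OF a]] not_ag by (simp add: x del: map_map)
    moreover have "map g w = w \<and> ag c (map g c) w" if w: "w \<in> set ws" for w
    proof -
      obtain y where y: "y \<in> set ys" "w = map \<tau> y" using w unfolding x(2) by auto
      have "real ?C y" using ys(1) y(1) by (rule mor_set)
      then have "y \<in> tup (univ M) n" "set y \<subseteq> univ M" using real_tup real_set by blast+
      then show ?thesis using g_\<tau> [of y] g_ag [of y] \<gamma>ys [OF y(1)] ys_ag [OF y(1)] by (simp only: y(2))
    qed
    ultimately have "Q [x] ws g" using g by (simp add: Q_def)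
    then show ?thesis by blast
  qed
  have all: "\<exists>g. Q us ws g" if "mor B (us @ ws)" for us ws
    using that
  \<comment> \<open>The last element of \<open>us\<close> starts on the agreeing side, where the
    induction hypothesis covers it, and then changes sides.\<close>
  proof (induction us arbitrary: ws rule: rev_induct)
    case Nil
    have "ag c c x" if x: "x \<in> set ws" for x
    proof -
      have x': "real B x" using mor_set Nil x by simp
      have "holds M (agr n k l \<psi>) (x @ c @ c)"
        using real_holds [OF x', of "c @ c" "agr n k l \<psi>"] dfd agr c by (auto simp: B_def tup_def)
      then show ?thesis using holds_ag [OF real_tup [OF x'] c c] by simp
    qed
    then have "Q [] ws id" using id by (simp add: Q_def)
    then show ?case by blast
  next
    case (snoc x us)
    have mor: "mor B (us @ x # ws)" using snoc.prems by simp
    obtain g where g: "Q us (x # ws) g" using snoc.IH [OF mor] by blast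
    \<comment> \<open>By symmetry \<open>x\<close> may stand first, with all other elements after
      it, as \<open>single\<close> demands.\<close>
    obtain \<gamma> where \<gamma>: "Q [x] (us @ ws) \<gamma>" using single [OF mor_move [OF B mor]] by blast
    have gA: "g \<in> aut A" and \<gamma>A: "\<gamma> \<in> aut A" using g \<gamma> by (auto simp: Q_def)
    have \<gamma>g: "\<gamma> \<circ> g \<in> aut A" using \<gamma>A gA by (rule aut_comp)
    have tup: "y \<in> tup (univ M) n" if "y \<in> set (us @ x # ws)" for y
      using real_tup [OF mor_set [OF mor that]] .
    have fixed: "map \<gamma> y = y" "map g y = y" if "y \<in> set (us @ x # ws)" for y
      using g \<gamma> that by (auto simp: Q_def)
    \<comment> \<open>\<open>\<gamma>\<close> fixes \<open>y\<close>, so the comparison of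
      \<open>c\<close> with its image under \<open>g\<close> may be made after applying
      \<open>\<gamma>\<close> to both. Away from \<open>x\<close>, replacing \<open>c\<close> by its
      image under \<open>\<gamma>\<close> does not affect the value, so the pattern of
      \<open>g\<close> survives there; at \<open>x\<close> it is reversed.\<close>
    have shift: "ag (map \<gamma> c) (map (\<gamma> \<circ> g) c) y \<longleftrightarrow> ag c (map g c) y" if "y \<in> set (us @ x # ws)" for y
      using ag_aut [OF \<gamma>A tup [OF that] c aut_tup [OF gA c]] fixed(1) [OF that] by simp
    have "\<not> ag c (map (\<gamma> \<circ> g) c) y" if y: "y \<in> set us" for y
    proof
      assume "ag c (map (\<gamma> \<circ> g) c) y"
      moreover have "ag (map \<gamma> c) c y" using \<gamma> y by (auto simp: Q_def intro: ag_sym)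
      ultimately have "ag (map \<gamma> c) (map (\<gamma> \<circ> g) c) y"
        using ag_trans [OF id tup, of y "map \<gamma> c" "map (\<gamma> \<circ> g) c"] y by simp
      then show False using shift [of y] g y by (auto simp: Q_def)
    qed
    moreover have "\<not> ag c (map (\<gamma> \<circ> g) c) x"
    proof
      assume "ag c (map (\<gamma> \<circ> g) c) x"
      moreover have "ag (map (\<gamma> \<circ> g) c) (map \<gamma> c) x"
        using shift [of x] g by (auto simp: Q_def intro: ag_sym)
      ultimately have "ag c (map \<gamma> c) x" using ag_trans [OF \<gamma>g tup] by simp
      then show False using \<gamma> by (auto simp: Q_def)
    qed
    moreover have "ag c (map (\<gamma> \<circ> g) c) y" if y: "y \<in> set ws" for y
    proof (rule ag_trans [OF \<gamma>A tup])
      show "ag c (map \<gamma> c) y" using \<gamma> y by (auto simp: Q_def)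
      show "ag (map \<gamma> c) (map (\<gamma> \<circ> g) c) y" using shift [of y] g y by (auto simp: Q_def)
    qed (use y in simp)
    moreover have "map (\<gamma> \<circ> g) y = y" if "y \<in> set (us @ x # ws)" for y
      using fixed [OF that] by (metis map_map)
    ultimately have "Q (us @ [x]) ws (\<gamma> \<circ> g)" using \<gamma>g by (auto simp: Q_def)
    then show ?case by blast
  qed
  have "Neg (agr n k l \<psi>) \<in> fml L (n + (l + l))" using agr by simp
  then obtain K where K: "\<And>xs ys b. mor A (xs @ ys) \<Longrightarrow> K \<le> length xs \<Longrightarrow> K \<le> length ys \<Longrightarrow>
    b \<in> tup (univ M) (l + l) \<Longrightarrow> (\<And>x. x \<in> set xs \<Longrightarrow> holds M (Neg (agr n k l \<psi>)) (x @ b)) \<Longrightarrow>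
    (\<And>y. y \<in> set ys \<Longrightarrow> \<not> holds M (Neg (agr n k l \<psi>)) (y @ b)) \<Longrightarrow> False"
    using no_alternation by blast
  obtain zs where zs: "mor B zs" "length zs = K + K" using ex_mor [OF B(2,3)] by blast
  define us ws where "us = take K zs" and "ws = drop K zs"
  have split: "zs = us @ ws" by (simp add: us_def ws_def)
  have mor: "mor B (us @ ws)" using zs(1) split by simp
  then obtain g where g: "Q us ws g" using all by blast
  have gc: "map g c \<in> tup (univ M) l" using g c by (auto simp: Q_def)
  have tup: "y \<in> tup (univ M) n" if "y \<in> set (us @ ws)" for y
    using real_tup [OF mor_set [OF mor that]] .
  show False
  proof (rule K [of us ws "c @ map g c"])
    show "mor A (us @ ws)" using mor B(1) by (rule mor_mono)
    show "K \<le> length us" "K \<le> length ws" using zs(2) by (auto simp: us_def ws_def)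
    show "c @ map g c \<in> tup (univ M) (l + l)" using c gc by (auto simp: tup_def)
    show "holds M (Neg (agr n k l \<psi>)) (x @ c @ map g c)" if "x \<in> set us" for x
      using holds_ag [OF tup c gc] that g by (simp add: Q_def)
    show "\<not> holds M (Neg (agr n k l \<psi>)) (y @ c @ map g c)" if "y \<in> set ws" for y
      using holds_ag [OF tup c gc] that g by (simp add: Q_def)
  qed
qed

end
section \<open>Imaginaries\<close>

lemma eq_formulaI:
  assumes "F \<in> fml L (m + m)" "\<And>x. x \<in> tup (univ M) m \<Longrightarrow> holds M F (x @ x)"
    and "\<And>x y. x \<in> tup (univ M) m \<Longrightarrow> y \<in> tup (univ M) m \<Longrightarrow> holds M F (x @ y) \<Longrightarrow> holds M F (y @ x)"
    and "\<And>x y z. x \<in> tup (univ M) m \<Longrightarrow> y \<in> tup (univ M) m \<Longrightarrow> z \<in> tup (univ M) m \<Longrightarrow>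
      holds M F (x @ y) \<Longrightarrow> holds M F (y @ z) \<Longrightarrow> holds M F (x @ z)"
  shows "eq_formula L M m F"
  using assms(1) unfolding eq_formula_def equiv_def refl_on_def sym_def trans_def
  by (auto intro: assms(2-4))

lemma
  assumes "eq_formula L M m F"
  shows eq_formula_fml: "F \<in> fml L (m + m)"
    and eq_formula_refl: "x \<in> tup (univ M) m \<Longrightarrow> holds M F (x @ x)"
    and eq_formula_sym: "x \<in> tup (univ M) m \<Longrightarrow> y \<in> tup (univ M) m \<Longrightarrow> holds M F (x @ y) \<Longrightarrow> holds M F (y @ x)"
    and eq_formula_trans: "x \<in> tup (univ M) m \<Longrightarrow> y \<in> tup (univ M) m \<Longrightarrow> z \<in> tup (univ M) m \<Longrightarrow>
      holds M F (x @ y) \<Longrightarrow> holds M F (y @ z) \<Longrightarrow> holds M F (x @ z)"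
  using assms unfolding eq_formula_def equiv_def refl_on_def sym_def trans_def by blast+

lemma eclass_eq:
  assumes "eq_formula L M m F" "x \<in> tup (univ M) m" "y \<in> tup (univ M) m"
  shows "eclass M m F x = eclass M m F y \<longleftrightarrow> holds M F (x @ y)"
proof
  assume "eclass M m F x = eclass M m F y"
  moreover have "y \<in> eclass M m F y" using assms eq_formula_refl by (auto simp: eclass_def)
  ultimately show "holds M F (x @ y)" by (auto simp: eclass_def)
next
  assume "holds M F (x @ y)"
  then show "eclass M m F x = eclass M m F y"
    using assms eq_formula_sym [OF assms(1)] eq_formula_trans [OF assms(1)]
    unfolding eclass_def by blast
qed

lemma tup_split:
  assumes "x \<in> tup B (i + j)"
  obtains y z where "x = y @ z" "y \<in> tup B i" "z \<in> tup B j"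
  using assms that [of "take i x" "drop i x"] set_take_subset [of i x] set_drop_subset [of i x]
  by (auto simp: tup_def)

lemma elementary_ext_holds:
  "elementary_ext L M N h \<Longrightarrow> set xs \<subseteq> univ M \<Longrightarrow> \<phi> \<in> fml L (length xs) \<Longrightarrow>
    holds N \<phi> (map h xs) = holds M \<phi> xs"
  unfolding elementary_ext_def by auto

lemma elementary_ext_tup:
  "elementary_ext L M N h \<Longrightarrow> x \<in> tup (univ M) m \<Longrightarrow> map h x \<in> tup (univ N) m"
  unfolding elementary_ext_def tup_def by auto

section \<open>Being an equivalence relation as a first-order sentence\<close>

definition eqv1 :: "nat \<Rightarrow> ('f, 'r) fm \<Rightarrow> ('f, 'r) fm" where
  "eqv1 m F = Neg (sel [m] [0, 0] F)"

definition eqv2 :: "nat \<Rightarrow> ('f, 'r) fm \<Rightarrow> ('f, 'r) fm" where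
  "eqv2 m F = And F (Neg (sel [m, m] [1, 0] F))"

definition eqv3 :: "nat \<Rightarrow> ('f, 'r) fm \<Rightarrow> ('f, 'r) fm" where
  "eqv3 m F = And (sel [m, m, m] [0, 1] F) (And (sel [m, m, m] [1, 2] F) (Neg (sel [m, m, m] [0, 2] F)))"

text \<open>The three parts describe counterexamples to reflexivity, symmetry and transitivity.
  \<open>eq_formula\<close> is a condition on a structure; this sentence carries it over to
  elementary extensions.\<close>

definition eqv :: "nat \<Rightarrow> ('f, 'r) fm \<Rightarrow> ('f, 'r) fm" where
  "eqv m F = And (Neg (Exs 0 m (eqv1 m F)))
    (And (Neg (Exs 0 (m + m) (eqv2 m F))) (Neg (Exs 0 (m + (m + m)) (eqv3 m F))))"

lemma eqv_parts_fml:
  assumes "F \<in> fml L (m + m)"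
  shows "eqv1 m F \<in> fml L (length [] + m)" "eqv2 m F \<in> fml L (length [] + (m + m))"
    "eqv3 m F \<in> fml L (length [] + (m + (m + m)))"
  using assms by (auto simp: eqv1_def eqv2_def eqv3_def intro!: sel_fml)

lemma eqv_fml: "F \<in> fml L (m + m) \<Longrightarrow> eqv m F \<in> fml L 0"
  using eqv_parts_fml [of F L m] Exs_fml [of "eqv1 m F" L 0 m] Exs_fml [of "eqv2 m F" L 0 "m + m"]
    Exs_fml [of "eqv3 m F" L 0 "m + (m + m)"]
  by (simp add: eqv_def)

lemma holds_eqv:
  assumes F: "F \<in> fml L (m + m)"
  shows "holds M (eqv m F) [] \<longleftrightarrow> eq_formula L M m F"
proof -
  have h1: "holds M (eqv1 m F) x \<longleftrightarrow> \<not> holds M F (x @ x)" if "x \<in> tup (univ M) m" for x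
    using F that holds_sel [of F L "[x]" "[0, 0]"] by (auto simp: eqv1_def tup_def)
  have h2: "holds M (eqv2 m F) (x @ y) \<longleftrightarrow> holds M F (x @ y) \<and> \<not> holds M F (y @ x)"
    if "x \<in> tup (univ M) m" "y \<in> tup (univ M) m" for x y
    using F that holds_sel [of F L "[x, y]" "[1, 0]"] by (auto simp: eqv2_def tup_def)
  have h3: "holds M (eqv3 m F) (x @ y @ z) \<longleftrightarrow> holds M F (x @ y) \<and> holds M F (y @ z) \<and> \<not> holds M F (x @ z)"
    if "x \<in> tup (univ M) m" "y \<in> tup (univ M) m" "z \<in> tup (univ M) m" for x y z
    using F that holds_sel [of F L "[x, y, z]" "[0, 1]"] holds_sel [of F L "[x, y, z]" "[1, 2]"]
      holds_sel [of F L "[x, y, z]" "[0, 2]"] by (auto simp: eqv3_def tup_def)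
  have e: "holds M (eqv m F) [] \<longleftrightarrow> (\<forall>v\<in>tup (univ M) m. \<not> holds M (eqv1 m F) v) \<and>
      (\<forall>v\<in>tup (univ M) (m + m). \<not> holds M (eqv2 m F) v) \<and> (\<forall>v\<in>tup (univ M) (m + (m + m)). \<not> holds M (eqv3 m F) v)"
    using holds_Exs [OF eqv_parts_fml(1) [OF F], of M] holds_Exs [OF eqv_parts_fml(2) [OF F], of M] holds_Exs [OF eqv_parts_fml(3) [OF F], of M]
    by (simp add: eqv_def)
  show ?thesis
  proof
    assume \<chi>: "holds M (eqv m F) []"
    show "eq_formula L M m F"
    proof (rule eq_formulaI [OF F])
      show "holds M F (x @ x)" if "x \<in> tup (univ M) m" for x
        using \<chi> that h1 unfolding e by blast
      show "holds M F (y @ x)" if "x \<in> tup (univ M) m" "y \<in> tup (univ M) m" "holds M F (x @ y)" for x y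
        using \<chi> that h2 [OF that(1,2)] tup_append [of x m y "univ M" m] unfolding e by (auto simp: tup_def)
      show "holds M F (x @ z)" if "x \<in> tup (univ M) m" "y \<in> tup (univ M) m" "z \<in> tup (univ M) m"
          "holds M F (x @ y)" "holds M F (y @ z)" for x y z
      proof -
        have "x @ y @ z \<in> tup (univ M) (m + (m + m))" using that by (auto simp: tup_def)
        then show ?thesis using \<chi> that h3 [OF that(1-3)] unfolding e by blast
      qed
    qed
  next
    assume F': "eq_formula L M m F"
    have "\<not> holds M (eqv2 m F) v" if v: "v \<in> tup (univ M) (m + m)" for v
    proof -
      obtain x y where "v = x @ y" "x \<in> tup (univ M) m" "y \<in> tup (univ M) m" using tup_split [OF v] .
      then show ?thesis using h2 eq_formula_sym [OF F'] by blast
    qed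
    moreover have "\<not> holds M (eqv3 m F) v" if v: "v \<in> tup (univ M) (m + (m + m))" for v
    proof -
      obtain x w where w: "v = x @ w" "x \<in> tup (univ M) m" "w \<in> tup (univ M) (m + m)" using tup_split [OF v] .
      obtain y z where "w = y @ z" "y \<in> tup (univ M) m" "z \<in> tup (univ M) m" using tup_split [OF w(3)] .
      then show ?thesis using w h3 eq_formula_trans [OF F'] by blast
    qed
    ultimately show "holds M (eqv m F) []" using h1 eq_formula_refl [OF F'] unfolding e by blast
  qed
qed

lemma elementary_ext_eq_formula:
  assumes "elementary_ext L M N h" "eq_formula L M m F"
  shows "eq_formula L N m F"
  using assms(2) eq_formula_fml [OF assms(2)] elementary_ext_holds [OF assms(1), of "[]" "eqv m F"]
  by (simp add: eqv_fml holds_eqv)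

text \<open>Elementarity preserves \<open>F\<close>, so all representatives of the class land in a
  single class of \<open>N\<close>, and the union in \<open>eq_map\<close> is that class.\<close>

lemma eq_map_eclass:
  assumes ext: "elementary_ext L M N h" and F: "eq_formula L M m F" and x: "x \<in> tup (univ M) m"
  shows "eq_map N h (Imag m F (eclass M m F x)) = Imag m F (eclass N m F (map h x))"
proof -
  have "eclass N m F (map h y) = eclass N m F (map h x)" if "y \<in> eclass M m F x" for y
  proof -
    have y: "y \<in> tup (univ M) m" "holds M F (x @ y)" using that by (auto simp: eclass_def)
    have "holds N F (map h (x @ y))"
      using elementary_ext_holds [OF ext, of "x @ y" F] x y eq_formula_fml [OF F] by (auto simp: tup_def)
    then have "eclass N m F (map h x) = eclass N m F (map h y)"
      using eclass_eq [OF elementary_ext_eq_formula [OF ext F]] elementary_ext_tup [OF ext] x y(1) by auto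
    then show ?thesis by simp
  qed
  moreover have "x \<in> eclass M m F x" using x eq_formula_refl [OF F] by (auto simp: eclass_def)
  ultimately have "(\<Union>y\<in>eclass M m F x. eclass N m F (map h y)) = eclass N m F (map h x)" by blast
  then show ?thesis by simp
qed

section \<open>One-sorted formulas inside the language of imaginaries\<close>

fun tr_tm :: "'f tm \<Rightarrow> ('f, 'r) etm" where
  "tr_tm (Var i) = EVar Home i"
| "tr_tm (Fn f ts) = EFn f (map tr_tm ts)"

fun tr :: "('f, 'r) fm \<Rightarrow> ('f, 'r) efm" where
  "tr (Eq s t) = EEq (tr_tm s) (tr_tm t)"
| "tr (Rel R ts) = ERel R (map tr_tm ts)"
| "tr (Neg \<phi>) = ENeg (tr \<phi>)"
| "tr (And \<phi> \<psi>) = EAnd (tr \<phi>) (tr \<psi>)"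
| "tr (Ex i \<phi>) = EEx Home i (tr \<phi>)"

lemma sort_of_tr_tm [simp]: "sort_of (tr_tm t) = Home"
  by (cases t) auto

lemma wf_tr_tm: "wf_etm L M (tr_tm t) \<longleftrightarrow> wf_tm L t"
  by (induction t) auto

lemma wf_tr: "wf_efm L M (tr \<phi>) \<longleftrightarrow> wf_fm L \<phi>"
  by (induction \<phi>) (auto simp: wf_tr_tm)

lemma fv_tr_tm: "fv_etm (tr_tm t) = Pair Home ` fv_tm t"
  by (induction t) auto

lemma fv_tr: "fv_efm (tr \<phi>) = Pair Home ` fv \<phi>"
  by (induction \<phi>) (auto simp: fv_tr_tm)

lemma etval_tr:
  assumes "\<And>i. \<rho> (Home, i) = Real (\<rho>' i)"
  shows "etval M \<rho> (tr_tm t) = Real (tval M \<rho>' t)"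
proof (induction t)
  case (Fn f ts)
  then have "map (\<lambda>t. the_real (etval M \<rho> t)) (map tr_tm ts) = map (tval M \<rho>') ts" by simp
  then show ?case by (simp only: tr_tm.simps etval.simps tval.simps)
qed (simp add: assms)

lemma esat_tr: "(\<And>i. \<rho> (Home, i) = Real (\<rho>' i)) \<Longrightarrow> esat M \<rho> (tr \<phi>) \<longleftrightarrow> sat M \<rho>' \<phi>"
proof (induction \<phi> arbitrary: \<rho> \<rho>')
  case (Rel R ts)
  have "map (\<lambda>t. the_real (etval M \<rho> t)) (map tr_tm ts) = map (tval M \<rho>') ts"
    by (simp add: etval_tr [of \<rho> \<rho>', OF Rel])
  then show ?case by (simp only: tr.simps esat.simps sat.simps)
next
  case (Ex i \<phi>)
  have "esat M (\<rho>((Home, i) := Real x)) (tr \<phi>) \<longleftrightarrow> sat M (\<rho>'(i := x)) \<phi>" for x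
    by (rule Ex.IH) (simp add: Ex.prems)
  then show ?case by simp
next
  case (Eq s t)
  then show ?case by (simp add: etval_tr [of \<rho> \<rho>', OF Eq])
qed auto

fun EExs :: "nat \<Rightarrow> nat \<Rightarrow> ('f, 'r) efm \<Rightarrow> ('f, 'r) efm" where
  "EExs m 0 \<chi> = \<chi>"
| "EExs m (Suc k) \<chi> = EEx Home m (EExs (Suc m) k \<chi>)"

lemma wf_EExs: "wf_efm L M (EExs m k \<chi>) \<longleftrightarrow> wf_efm L M \<chi>"
  by (induction k arbitrary: m) auto

lemma fv_EExs: "fv_efm (EExs m k \<chi>) = fv_efm \<chi> - Pair Home ` {m..<m + k}"
proof (induction k arbitrary: m)
  case (Suc k)
  have "{m..<m + Suc k} = insert m {Suc m..<Suc m + k}" by auto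
  then show ?case by (auto simp: Suc.IH)
qed simp

definition eupd :: "(('f, 'r) esort \<times> nat \<Rightarrow> ('f, 'r, 'a) eqel) \<Rightarrow> nat \<Rightarrow> 'a list \<Rightarrow>
    ('f, 'r) esort \<times> nat \<Rightarrow> ('f, 'r, 'a) eqel" where
  "eupd \<rho> m v = (\<lambda>(S, i). if S = Home \<and> m \<le> i \<and> i < m + length v then Real (v ! (i - m)) else \<rho> (S, i))"

lemma esat_EExs: "esat M \<rho> (EExs m k \<chi>) \<longleftrightarrow> (\<exists>v\<in>tup (univ M) k. esat M (eupd \<rho> m v) \<chi>)"
proof (induction k arbitrary: m \<rho>)
  case 0
  have "eupd \<rho> m [] = \<rho>" by (auto simp: eupd_def fun_eq_iff)
  then show ?case by (simp add: tup_def)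
next
  case (Suc k)
  have "eupd (\<rho>((Home, m) := Real x)) (Suc m) v = eupd \<rho> m (x # v)" for x v
    by (auto simp: eupd_def fun_eq_iff nth_Cons' Suc_diff_Suc not_less_eq_eq)
  then have "esat M \<rho> (EExs m (Suc k) \<chi>) \<longleftrightarrow>
      (\<exists>x\<in>univ M. \<exists>v\<in>tup (univ M) k. esat M (eupd \<rho> m (x # v)) \<chi>)"
    by (simp add: Suc.IH del: fun_upd_apply)
  also have "\<dots> \<longleftrightarrow> (\<exists>v\<in>tup (univ M) (Suc k). esat M (eupd \<rho> m v) \<chi>)"
    unfolding tup_Suc Bex_def by blast
  finally show ?case .
qed
section \<open>Germs\<close>

text \<open>\<open>same_row l r D\<close> is the equivalence relation \<open>\<forall>y''. D(y, y'', w) \<longleftrightarrow> D(y', y'', w')\<close> between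
  \<open>y w\<close> and \<open>y' w'\<close>, where \<open>y, y', y''\<close> have length \<open>l\<close> and \<open>w, w'\<close> have length \<open>r\<close>.\<close>

definition same_row_body :: "nat \<Rightarrow> nat \<Rightarrow> ('f, 'r) fm \<Rightarrow> ('f, 'r) fm" where
  "same_row_body l r D = (let \<alpha> = sel [l, r, l, r, l] [0, 4, 1] D; \<beta> = sel [l, r, l, r, l] [2, 4, 3] D
     in And (Neg (And \<alpha> \<beta>)) (Neg (And (Neg \<alpha>) (Neg \<beta>))))"

definition same_row :: "nat \<Rightarrow> nat \<Rightarrow> ('f, 'r) fm \<Rightarrow> ('f, 'r) fm" where
  "same_row l r D = Neg (Exs ((l + r) + (l + r)) l (same_row_body l r D))"

lemma same_row_body_fml:
  "D \<in> fml L (l + l + r) \<Longrightarrow> same_row_body l r D \<in> fml L (((l + r) + (l + r)) + l)"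
  by (auto simp: same_row_body_def Let_def add.assoc intro!: sel_fml)

lemma same_row_fml: "D \<in> fml L (l + l + r) \<Longrightarrow> same_row l r D \<in> fml L ((l + r) + (l + r))"
  unfolding same_row_def by (simp add: Exs_fml same_row_body_fml)

lemma holds_same_row:
  assumes D: "D \<in> fml L (l + l + r)"
    and len: "length y = l" "length w = r" "length y' = l" "length w' = r"
  shows "holds M (same_row l r D) ((y @ w) @ (y' @ w')) \<longleftrightarrow>
    (\<forall>y''\<in>tup (univ M) l. holds M D (y @ y'' @ w) \<longleftrightarrow> holds M D (y' @ y'' @ w'))"
proof -
  let ?xs = "(y @ w) @ (y' @ w')"
  have lx: "(l + r) + (l + r) = length ?xs" using len by simp
  have "holds M (same_row l r D) ?xs \<longleftrightarrow>
      \<not> (\<exists>y''\<in>tup (univ M) l. holds M (same_row_body l r D) (?xs @ y''))"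
    unfolding same_row_def lx holds_Neg
    using holds_Exs [of "same_row_body l r D" L ?xs l M] same_row_body_fml [OF D] lx by simp
  also have "\<dots> \<longleftrightarrow> (\<forall>y''\<in>tup (univ M) l. \<not> holds M (same_row_body l r D) (?xs @ y''))" by blast
  also have "\<dots> \<longleftrightarrow> (\<forall>y''\<in>tup (univ M) l. holds M D (y @ y'' @ w) \<longleftrightarrow> holds M D (y' @ y'' @ w'))"
  proof (rule ball_cong [OF refl])
    fix y'' assume "y'' \<in> tup (univ M) l"
    then have "length y'' = l" by (simp add: tup_def)
    then show "(\<not> holds M (same_row_body l r D) (?xs @ y'')) \<longleftrightarrow>
        (holds M D (y @ y'' @ w) \<longleftrightarrow> holds M D (y' @ y'' @ w'))"
      using D len holds_sel [of D L "[y, w, y', w', y'']" "[0, 4, 1]"]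
        holds_sel [of D L "[y, w, y', w', y'']" "[2, 4, 3]"]
      by (auto simp: same_row_body_def Let_def add.assoc)
  qed
  finally show ?thesis .
qed

text \<open>Having equal rows is the kernel of a map, hence an equivalence relation on all tuples
  whatever \<open>D\<close> is. This is the reason for not using \<open>D\<close> itself.\<close>

lemma eq_formula_same_row:
  assumes D: "D \<in> fml L (l + l + r)"
  shows "eq_formula L M (l + r) (same_row l r D)"
proof -
  define R where "R x y'' \<longleftrightarrow> holds M D (take l x @ y'' @ drop l x)" for x y''
  have holds: "holds M (same_row l r D) (x @ x') \<longleftrightarrow> (\<forall>y''\<in>tup (univ M) l. R x y'' \<longleftrightarrow> R x' y'')"
    if "x \<in> tup (univ M) (l + r)" "x' \<in> tup (univ M) (l + r)" for x x'
    using holds_same_row [OF D, of "take l x" "drop l x" "take l x'" "drop l x'" M] that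
    by (simp add: tup_def R_def)
  show ?thesis
    by (rule eq_formulaI [OF same_row_fml [OF D]]) (auto simp: holds)
qed

section \<open>Formulas that separate and isolate values\<close>

lemma bex_tup_append:
  "(\<exists>v\<in>tup B (i + j). P v) \<longleftrightarrow> (\<exists>x\<in>tup B i. \<exists>y\<in>tup B j. P (x @ y))"
proof
  assume "\<exists>v\<in>tup B (i + j). P v"
  then show "\<exists>x\<in>tup B i. \<exists>y\<in>tup B j. P (x @ y)" by (metis tup_split)
next
  assume "\<exists>x\<in>tup B i. \<exists>y\<in>tup B j. P (x @ y)"
  then obtain x y where "x \<in> tup B i" "y \<in> tup B j" "P (x @ y)" by blast
  then show "\<exists>v\<in>tup B (i + j). P v" by (intro bexI [of _ "x @ y"]) (auto simp: tup_def)
qed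

text \<open>\<open>separating\<close>, in variables \<open>y, z, z', x, u, w\<close>, says that \<open>y w\<close> and \<open>u w\<close> are \<open>F\<close>-equivalent
  and that \<open>f\<^sub>y(x) = z\<close> and \<open>f\<^sub>u(x) = z'\<close> differ in coordinate \<open>j\<close>.\<close>

definition separating :: "nat \<Rightarrow> nat \<Rightarrow> nat \<Rightarrow> nat \<Rightarrow> nat \<Rightarrow> ('f, 'r) fm \<Rightarrow> ('f, 'r) fm \<Rightarrow> ('f, 'r) fm" where
  "separating n k l r j F \<psi> = (let ls = [l, k, k, n, l, r] in
     And (sel ls [0, 5, 4, 5] F) (And (sel ls [3, 1, 0] \<psi>) (And (sel ls [3, 2, 4] \<psi>)
       (Neg (Eq (Var (l + j)) (Var (l + k + j)))))))"

lemma separating_fml: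
  "F \<in> fml L ((l + r) + (l + r)) \<Longrightarrow> \<psi> \<in> fml L (n + k + l) \<Longrightarrow> j < k \<Longrightarrow>
    separating n k l r j F \<psi> \<in> fml L (l + (k + k) + (n + l + r))"
  by (auto simp: separating_def Let_def add.assoc intro!: sel_fml)

lemma holds_separating:
  assumes "F \<in> fml L ((l + r) + (l + r))" "\<psi> \<in> fml L (n + k + l)" "j < k"
    and "length y = l" "length z = k" "length z' = k" "length x = n" "length u = l" "length w = r"
  shows "holds M (separating n k l r j F \<psi>) (y @ (z @ z') @ x @ u @ w) \<longleftrightarrow>
    holds M F ((y @ w) @ (u @ w)) \<and> holds M \<psi> (x @ z @ y) \<and> holds M \<psi> (x @ z' @ u) \<and> z ! j \<noteq> z' ! j"
  using assms holds_sel [of F L "[y, z, z', x, u, w]" "[0, 5, 4, 5]"]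
    holds_sel [of \<psi> L "[y, z, z', x, u, w]" "[3, 1, 0]"] holds_sel [of \<psi> L "[y, z, z', x, u, w]" "[3, 2, 4]"]
  by (simp add: separating_def Let_def add.assoc nth_append)

text \<open>In variables \<open>x, u, s, w\<close>: no \<open>y\<close> with \<open>\<theta>(x, y, s)\<close> is part of a solution of \<open>separating\<close>.\<close>

definition isolating :: "nat \<Rightarrow> nat \<Rightarrow> nat \<Rightarrow> nat \<Rightarrow> nat \<Rightarrow> nat \<Rightarrow> ('f, 'r) fm \<Rightarrow> ('f, 'r) fm \<Rightarrow> ('f, 'r) fm \<Rightarrow> ('f, 'r) fm" where
  "isolating n k l r r' j F \<psi> \<theta> = (let ls = [n, l, r', r, l, k, k] in
     Neg (Exs (n + (l + r' + r)) (l + (k + k))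
       (And (sel ls [0, 4, 2] \<theta>) (sel ls [4, 5, 6, 0, 1, 3] (separating n k l r j F \<psi>)))))"

lemma
  assumes F: "F \<in> fml L ((l + r) + (l + r))" and \<psi>: "\<psi> \<in> fml L (n + k + l)" and j: "j < k"
    and \<theta>: "\<theta> \<in> fml L (n + l + r')"
  shows isolating_fml: "isolating n k l r r' j F \<psi> \<theta> \<in> fml L (n + (l + r' + r))"
    and holds_isolating: "length x = n \<Longrightarrow> length u = l \<Longrightarrow> length s = r' \<Longrightarrow> length w = r \<Longrightarrow>
      holds M (isolating n k l r r' j F \<psi> \<theta>) (x @ u @ s @ w) \<longleftrightarrow>
      (\<forall>y\<in>tup (univ M) l. \<forall>z\<in>tup (univ M) k. \<forall>z'\<in>tup (univ M) k.
        \<not> (holds M \<theta> (x @ y @ s) \<and> holds M (separating n k l r j F \<psi>) (y @ (z @ z') @ x @ u @ w)))"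
proof -
  let ?ls = "[n, l, r', r, l, k, k]"
  let ?\<chi> = "And (sel ?ls [0, 4, 2] \<theta>) (sel ?ls [4, 5, 6, 0, 1, 3] (separating n k l r j F \<psi>))"
  have sep: "separating n k l r j F \<psi> \<in> fml L (l + (k + k) + (n + l + r))"
    using F \<psi> j by (rule separating_fml)
  have "sel ?ls [0, 4, 2] \<theta> \<in> fml L (n + (l + r' + r) + (l + (k + k)))"
    using \<theta> by (auto simp: add.assoc intro!: sel_fml)
  moreover have "sel ?ls [4, 5, 6, 0, 1, 3] (separating n k l r j F \<psi>) \<in> fml L (n + (l + r' + r) + (l + (k + k)))"
    by (rule sel_fml) (use sep in \<open>simp_all add: add.assoc\<close>)
  ultimately have \<chi>: "?\<chi> \<in> fml L (n + (l + r' + r) + (l + (k + k)))" by simp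
  then show "isolating n k l r r' j F \<psi> \<theta> \<in> fml L (n + (l + r' + r))"
    unfolding isolating_def Let_def by (simp only: Neg_fml) (rule Exs_fml)
  assume len: "length x = n" "length u = l" "length s = r'" "length w = r"
  have lx: "n + (l + r' + r) = length (x @ u @ s @ w)" using len by simp
  have "holds M (isolating n k l r r' j F \<psi> \<theta>) (x @ u @ s @ w) \<longleftrightarrow>
      \<not> (\<exists>v\<in>tup (univ M) (l + (k + k)). holds M ?\<chi> ((x @ u @ s @ w) @ v))"
    using holds_Exs [of ?\<chi> L "x @ u @ s @ w" "l + (k + k)" M] \<chi>
    unfolding isolating_def Let_def lx holds_Neg by blast
  also have "\<dots> \<longleftrightarrow> (\<forall>y\<in>tup (univ M) l. \<forall>z\<in>tup (univ M) k. \<forall>z'\<in>tup (univ M) k.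
      \<not> holds M ?\<chi> ((x @ u @ s @ w) @ y @ z @ z'))"
    unfolding bex_tup_append by blast
  also have "\<dots> \<longleftrightarrow> (\<forall>y\<in>tup (univ M) l. \<forall>z\<in>tup (univ M) k. \<forall>z'\<in>tup (univ M) k.
        \<not> (holds M \<theta> (x @ y @ s) \<and> holds M (separating n k l r j F \<psi>) (y @ (z @ z') @ x @ u @ w)))"
  proof (intro ball_cong refl)
    fix y z z' assume "y \<in> tup (univ M) l" "z \<in> tup (univ M) k" "z' \<in> tup (univ M) k"
    then have len': "length y = l" "length z = k" "length z' = k" by (auto simp: tup_def)
    have "holds M (sel ?ls [0, 4, 2] \<theta>) ((x @ u @ s @ w) @ y @ z @ z') = holds M \<theta> (x @ y @ s)"
      using \<theta> len len' holds_sel [of \<theta> L "[x, u, s, w, y, z, z']" "[0, 4, 2]"] by (simp add: add.assoc)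
    moreover have "holds M (sel ?ls [4, 5, 6, 0, 1, 3] (separating n k l r j F \<psi>)) ((x @ u @ s @ w) @ y @ z @ z') =
        holds M (separating n k l r j F \<psi>) (y @ (z @ z') @ x @ u @ w)"
      using sep len len' holds_sel [of "separating n k l r j F \<psi>" L "[x, u, s, w, y, z, z']" "[4, 5, 6, 0, 1, 3]"]
      by (simp add: add.assoc)
    ultimately show "(\<not> holds M ?\<chi> ((x @ u @ s @ w) @ y @ z @ z')) \<longleftrightarrow>
        \<not> (holds M \<theta> (x @ y @ s) \<and> holds M (separating n k l r j F \<psi>) (y @ (z @ z') @ x @ u @ w))"
      by simp
  qed
  finally show "holds M (isolating n k l r r' j F \<psi> \<theta>) (x @ u @ s @ w) \<longleftrightarrow>
      (\<forall>y\<in>tup (univ M) l. \<forall>z\<in>tup (univ M) k. \<forall>z'\<in>tup (univ M) k.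
        \<not> (holds M \<theta> (x @ y @ s) \<and> holds M (separating n k l r j F \<psi>) (y @ (z @ z') @ x @ u @ w)))" .
qed

context generically_stable_type
begin

section \<open>The germ as an imaginary, and its isolation\<close>

lemma realized_holds:
  assumes "realizes N h n p a" "\<phi> \<in> fml L (n + length b)" "set b \<subseteq> univ M"
  shows "holds N \<phi> (a @ map h b) \<longleftrightarrow> (\<phi>, b) \<in> p"
  using realizesD [OF assms(1), of \<phi> b] realizesD [OF assms(1), of "Neg \<phi>" b] p_Neg [OF assms(2,3)] by auto

text \<open>Agreement is decided by \<open>p\<close>, so the choice of extension and realization is
  immaterial; the given \<open>N\<close> and \<open>a\<close> ensure that there is one to
  choose.\<close>

lemma germ_rel_iff:
  fixes N :: "('f, 'r, 'b) struc"
  assumes ext: "elementary_ext L M N h" and a: "realizes N h n p a"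
    and \<psi>: "\<psi> \<in> fml L (n + k + l)" and c: "c1 \<in> tup (univ M) l" "c2 \<in> tup (univ M) l"
  shows "germ_rel TYPE('b) L M n p k \<psi> c1 c2 \<longleftrightarrow> (agr n k l \<psi>, c1 @ c2) \<in> p"
proof -
  have fml: "agr n k l \<psi> \<in> fml L (n + length (c1 @ c2))" and set: "set (c1 @ c2) \<subseteq> univ M"
    using agr_fml [OF \<psi>] c by (auto simp: tup_def)
  have *: "(\<exists>v. fun_val N' k \<psi> (map h' c1) a' v \<and> fun_val N' k \<psi> (map h' c2) a' v) \<longleftrightarrow>
      (agr n k l \<psi>, c1 @ c2) \<in> p" if "realizes N' h' n p a'" for N' :: "('f, 'r, 'b) struc" and h' a'
    using realized_holds [OF that fml set] holds_agr [OF \<psi>, of a' "map h' c1" "map h' c2" N'] that c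
    by (auto simp: tup_def realizes_def)
  show ?thesis
  proof
    assume "germ_rel TYPE('b) L M n p k \<psi> c1 c2"
    then show "(agr n k l \<psi>, c1 @ c2) \<in> p" unfolding germ_rel_def using * by blast
  next
    assume "(agr n k l \<psi>, c1 @ c2) \<in> p"
    then show "germ_rel TYPE('b) L M n p k \<psi> c1 c2" unfolding germ_rel_def using * [OF a] ext a by blast
  qed
qed

lemma realizes_tp_conjugate:
  assumes "set c \<subseteq> univ M" "realizes M id (length c) (tp L M A c) c'"
  obtains \<sigma> where "\<sigma> \<in> aut A" "c' = map \<sigma> c"
proof -
  have c': "set c' \<subseteq> univ M" "length c = length c'" using assms(2) by (auto simp: realizes_def tup_def)
  have imp: "holds M \<phi> (c' @ b)" if "(\<phi>, b) \<in> tp L M A c" for \<phi> b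
    using realizesD [OF assms(2) that] by simp
  have "holds M \<phi> (c @ b) \<longleftrightarrow> holds M \<phi> (c' @ b)" if "(\<phi>, b) \<in> insts L (length c) A" for \<phi> b
    using imp [of \<phi> b] imp [of "Neg \<phi>" b] that by (auto simp: tp_def insts_def)
  then have "tp L M A c = tp L M A c'" using c'(2) by (auto simp: tp_def)
  then show thesis using ex_aut [OF A assms(1) c'] that by metis
qed

lemma conjugate_realizes_tp:
  assumes "set c \<subseteq> univ M" "\<sigma> \<in> aut A"
  shows "realizes M id (length c) (tp L M A c) (map \<sigma> c)"
proof -
  have "tp L M A (map \<sigma> c) = tp L M A c" using assms A by (intro tp_aut)
  then have "holds M \<phi> (map \<sigma> c @ b)" if "(\<phi>, b) \<in> tp L M A c" for \<phi> b
    using that by (auto simp: tp_def)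
  then show ?thesis using assms by (auto simp: realizes_def tup_def)
qed

text \<open>Definability of \<open>p\<close> turns agreement into a formula \<open>D\<close> with
  parameters \<open>d\<close> in \<open>A\<close>. Between conjugates of \<open>c\<close>, equal
  rows amount to equal germs: the row of \<open>c2\<close> contains \<open>c2\<close> by
  definedness, and two functions with the same value at a generic point agree there with the same
  others.\<close>

lemma ex_germ:
  fixes N :: "('f, 'r, 'b) struc"
  assumes ext: "elementary_ext L M N h" and a: "realizes N h n p a"
    and f: "partial_definable_function L M n k \<psi> c" and l: "length c = l"
    and dfd: "(agr n k l \<psi>, c @ c) \<in> p"
  shows "\<exists>e. is_germ TYPE('b) L M n A p k \<psi> c e"
proof -
  have \<psi>: "\<psi> \<in> fml L (n + k + l)" and c: "c \<in> tup (univ M) l"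
    using f l by (auto simp: partial_definable_function_def tup_def)
  have agr: "agr n k l \<psi> \<in> fml L (n + (l + l))" using \<psi> by (rule agr_fml)
  obtain D d where D: "(D, d) \<in> insts L (l + l) A"
    "\<And>b. b \<in> tup (univ M) (l + l) \<Longrightarrow> (agr n k l \<psi>, b) \<in> p \<longleftrightarrow> holds M D (b @ d)"
    using p_definable [OF agr] by blast
  define r where "r = length d"
  have D': "D \<in> fml L (l + l + r)" "set d \<subseteq> A" using D(1) by (auto simp: insts_def r_def)
  define F where "F = same_row l r D"
  have "germ_rel TYPE('b) L M n p k \<psi> c1 c2 \<longleftrightarrow> holds M F ((c1 @ d) @ (c2 @ d))"
    if c12: "realizes M id (length c) (tp L M A c) c1" "realizes M id (length c) (tp L M A c) c2" for c1 c2
  proof -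
    have c_set: "set c \<subseteq> univ M" using c by (simp add: tup_def)
    obtain \<sigma>1 where \<sigma>1: "\<sigma>1 \<in> aut A" "c1 = map \<sigma>1 c" using realizes_tp_conjugate [OF c_set c12(1)] .
    obtain \<sigma>2 where \<sigma>2: "\<sigma>2 \<in> aut A" "c2 = map \<sigma>2 c" using realizes_tp_conjugate [OF c_set c12(2)] .
    note \<sigma> = \<sigma>1 \<sigma>2
    have c1: "c1 \<in> tup (univ M) l" and c2: "c2 \<in> tup (univ M) l" using \<sigma> c by auto
    have "map \<sigma>2 (c @ c) = c2 @ c2" using \<sigma> by simp
    then have dfd2: "(agr n k l \<psi>, c2 @ c2) \<in> p"
      using p_aut [OF \<sigma>(3), of "c @ c" "agr n k l \<psi>"] dfd agr c l by (auto simp: tup_def)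
    have f1: "partial_definable_function L M n k \<psi> c1" and f2: "partial_definable_function L M n k \<psi> c2"
      using \<sigma> conjugate_partial_definable_function [OF f] by auto
    have row: "holds M D (c' @ y @ d) \<longleftrightarrow> (agr n k l \<psi>, c' @ y) \<in> p"
      if "c' \<in> tup (univ M) l" "y \<in> tup (univ M) l" for c' y
      using D(2) [of "c' @ y"] that by (auto simp: tup_def)
    have "holds M F ((c1 @ d) @ (c2 @ d)) \<longleftrightarrow>
        (\<forall>y\<in>tup (univ M) l. holds M D (c1 @ y @ d) \<longleftrightarrow> holds M D (c2 @ y @ d))"
      unfolding F_def by (rule holds_same_row [OF D'(1)]) (use c1 c2 in \<open>auto simp: tup_def r_def\<close>)
    also have "\<dots> \<longleftrightarrow> (\<forall>y\<in>tup (univ M) l. (agr n k l \<psi>, c1 @ y) \<in> p \<longleftrightarrow> (agr n k l \<psi>, c2 @ y) \<in> p)"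
      by (intro ball_cong refl) (simp only: row [OF c1] row [OF c2])
    also have "\<dots> \<longleftrightarrow> (agr n k l \<psi>, c1 @ c2) \<in> p"
    proof
      assume "\<forall>y\<in>tup (univ M) l. (agr n k l \<psi>, c1 @ y) \<in> p \<longleftrightarrow> (agr n k l \<psi>, c2 @ y) \<in> p"
      then show "(agr n k l \<psi>, c1 @ c2) \<in> p" using c2 dfd2 by blast
    next
      assume c1c2: "(agr n k l \<psi>, c1 @ c2) \<in> p"
      show "\<forall>y\<in>tup (univ M) l. (agr n k l \<psi>, c1 @ y) \<in> p \<longleftrightarrow> (agr n k l \<psi>, c2 @ y) \<in> p"
      proof
        fix y assume y: "y \<in> tup (univ M) l"
        have "set c1 \<union> set c2 \<union> set y \<subseteq> univ M" "small \<kappa> (set c1 \<union> set c2 \<union> set y)"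
          using c1 c2 y by (auto simp: tup_def)
        \<comment> \<open>A realization over all three parameters decides the three agreements at
          once.\<close>
        then obtain x where x: "real (set c1 \<union> set c2 \<union> set y) x" using ex_real by blast
        have holds: "(agr n k l \<psi>, u @ w) \<in> p \<longleftrightarrow> (\<exists>v. fun_val M k \<psi> u x v \<and> fun_val M k \<psi> w x v)"
          if "set (u @ w) \<subseteq> set c1 \<union> set c2 \<union> set y" "u \<in> tup (univ M) l" "w \<in> tup (univ M) l" for u w
          using real_holds [OF x that(1), of "agr n k l \<psi>"] holds_agr [OF \<psi>, of x u w M] that agr x
          by (auto simp: tup_def)
        obtain v where v: "fun_val M k \<psi> c1 x v" "fun_val M k \<psi> c2 x v"
          using holds [of c1 c2] c1c2 c1 c2 by auto
        \<comment> \<open>At \<open>x\<close> the relation with parameter \<open>y\<close> may have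
          several values. Both memberships only ask whether the common value \<open>v\<close> of the
          other two functions is among them.\<close>
        have eq1: "w = v" if "fun_val M k \<psi> c1 x w" for w
          using partial_definable_functionD [OF f1 real_tup [OF x] that v(1)] .
        have "(agr n k l \<psi>, c1 @ y) \<in> p \<longleftrightarrow> (\<exists>w. fun_val M k \<psi> c1 x w \<and> fun_val M k \<psi> y x w)"
          using c1 y by (intro holds) auto
        then have iff1: "(agr n k l \<psi>, c1 @ y) \<in> p \<longleftrightarrow> fun_val M k \<psi> y x v"
          using eq1 v(1) by blast
        have eq2: "w = v" if "fun_val M k \<psi> c2 x w" for w
          using partial_definable_functionD [OF f2 real_tup [OF x] that v(2)] .
        have "(agr n k l \<psi>, c2 @ y) \<in> p \<longleftrightarrow> (\<exists>w. fun_val M k \<psi> c2 x w \<and> fun_val M k \<psi> y x w)"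
          using c2 y by (intro holds) auto
        then have iff2: "(agr n k l \<psi>, c2 @ y) \<in> p \<longleftrightarrow> fun_val M k \<psi> y x v"
          using eq2 v(2) by blast
        show "(agr n k l \<psi>, c1 @ y) \<in> p \<longleftrightarrow> (agr n k l \<psi>, c2 @ y) \<in> p" using iff1 iff2 by simp
      qed
    qed
    finally show ?thesis using germ_rel_iff [OF ext a \<psi> c1 c2] by simp
  qed
  moreover have "eq_formula L M (length c + length d) F"
    unfolding F_def using eq_formula_same_row [OF D'(1)] by (simp add: l r_def)
  ultimately show ?thesis unfolding is_germ_def Let_def using D'(2) by blast
qed

text \<open>Otherwise compactness gives \<open>y\<close> with the type of \<open>c\<close> over
  \<open>A a0\<close> and the same germ, but another value at \<open>a0\<close>. Homogeneity makes
  \<open>y\<close> the image of \<open>c\<close> under an automorphism fixing \<open>A\<close> and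
  \<open>a0\<close>, against \<open>conjugate_same_germ_agree\<close>. Hence one formula
  \<open>\<theta>\<close> of the type is enough.\<close>

lemma germ_isolating:
  fixes N :: "('f, 'r, 'b) struc"
  assumes ext: "elementary_ext L M N h" and a: "realizes N h n p a"
    and f: "partial_definable_function L M n k \<psi> c" and l: "length c = l"
    and dfd: "(agr n k l \<psi>, c @ c) \<in> p"
    and d: "set d \<subseteq> A" "length d = r" and F: "eq_formula L M (l + r) F"
    and germ: "\<And>c1 c2. realizes M id l (tp L M A c) c1 \<Longrightarrow> realizes M id l (tp L M A c) c2 \<Longrightarrow>
      germ_rel TYPE('b) L M n p k \<psi> c1 c2 \<longleftrightarrow> holds M F ((c1 @ d) @ (c2 @ d))"
    and j: "j < k"
  obtains \<theta> e where "set e \<subseteq> A" "\<theta> \<in> fml L (n + l + length e)"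
    "holds N \<theta> (a @ map h (c @ e))"
    "holds N (isolating n k l r (length e) j F \<psi> \<theta>) (a @ map h (c @ e @ d))"
proof -
  have \<psi>: "\<psi> \<in> fml L (n + k + l)" and c: "c \<in> tup (univ M) l"
    using f l by (auto simp: partial_definable_function_def tup_def)
  have c_set: "set c \<subseteq> univ M" using c by (simp add: tup_def)
  have d_set: "set d \<subseteq> univ M" using d A by auto
  have F_fml: "F \<in> fml L ((l + r) + (l + r))" using F by (rule eq_formula_fml)
  have "A \<union> set c \<subseteq> univ M" "small \<kappa> (A \<union> set c)" using A c by (auto simp: tup_def)
  then obtain a0 where a0: "real (A \<union> set c) a0" using ex_real by blast
  have a0': "length a0 = n" "set a0 \<subseteq> univ M" "a0 \<in> tup (univ M) n"
    using a0 real_set real_tup by auto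
  let ?sep = "separating n k l r j F \<psi>"
  have "\<exists>(\<theta>, e)\<in>tp L M A (a0 @ c). \<forall>y\<in>tup (univ M) l. \<forall>z\<in>tup (univ M) (k + k).
      \<not> (holds M \<theta> (a0 @ y @ e) \<and> holds M ?sep (y @ z @ a0 @ c @ d))"
  proof (rule ccontr)
    assume "\<not> ?thesis"
    then have fin: "\<exists>y\<in>tup (univ M) l. \<exists>z\<in>tup (univ M) (k + k).
        holds M \<theta> (a0 @ y @ e) \<and> holds M ?sep (y @ z @ a0 @ c @ d)"
      if "(\<theta>, e) \<in> tp L M A (a0 @ c)" for \<theta> e
      using that by blast
    have g: "set (a0 @ c @ d) \<subseteq> univ M" using a0'(2) c_set d_set by auto
    have sep: "?sep \<in> fml L (l + (k + k) + length (a0 @ c @ d))"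
      using separating_fml [OF F_fml \<psi> j] a0'(1) l d(2) by (simp add: add.assoc)
    obtain y zz where yz: "y \<in> tup (univ M) l" "zz \<in> tup (univ M) (k + k)"
      "tp L M A (a0 @ y) = tp L M A (a0 @ c)" "holds M ?sep (y @ zz @ a0 @ c @ d)"
      using tp_compactness [OF A a0'(2) c_set g l sep fin] .
    obtain z z' where z: "zz = z @ z'" "z \<in> tup (univ M) k" "z' \<in> tup (univ M) k"
      using tup_split [OF yz(2)] .
    have holds: "holds M F ((y @ d) @ (c @ d))" "holds M \<psi> (a0 @ z @ y)" "holds M \<psi> (a0 @ z' @ c)" "z ! j \<noteq> z' ! j"
      using holds_separating [OF F_fml \<psi> j, of y z z' a0 c d M] yz(1,4) z a0'(1) l d(2) by (auto simp: tup_def)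
    have "set (a0 @ c) \<subseteq> univ M" "set (a0 @ y) \<subseteq> univ M" "length (a0 @ c) = length (a0 @ y)"
      using a0'(2) c_set yz(1) l by (auto simp: tup_def)
    then obtain \<sigma> where \<sigma>: "\<sigma> \<in> aut A" "map \<sigma> (a0 @ c) = a0 @ y"
      using ex_aut [OF A _ _ _ yz(3) [symmetric]] by blast
    have \<sigma>': "map \<sigma> a0 = a0" "map \<sigma> c = y" using \<sigma>(2) by (auto simp: append_eq_append_conv)
    have "\<sigma> \<in> aut (A \<union> set a0)" using \<sigma>(1) \<sigma>'(1) by (auto simp: aut_def map_eq_conv [of \<sigma> a0 id, simplified])
    moreover have "(agr n k l \<psi>, c @ map \<sigma> c) \<in> p"
    proof -
      have id: "id \<in> aut A" by (auto simp: aut_def automorphism_def id_def bij_betw_def)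
      \<comment> \<open>\<open>F\<close> is known to express equality of germs only on realizations
        of the type of \<open>c\<close> over \<open>A\<close>; \<open>y\<close> is one, being a
        conjugate of \<open>c\<close>.\<close>
      have "realizes M id l (tp L M A c) c" "realizes M id l (tp L M A c) y"
        using conjugate_realizes_tp [OF c_set id] conjugate_realizes_tp [OF c_set \<sigma>(1)] \<sigma>'(2) l by auto
      moreover have "holds M F ((c @ d) @ (y @ d))"
        using eq_formula_sym [OF F _ _ holds(1)] yz(1) c d_set d(2) by (auto simp: tup_def)
      ultimately have "germ_rel TYPE('b) L M n p k \<psi> c y" using germ by blast
      then show ?thesis using germ_rel_iff [OF ext a \<psi> c yz(1)] \<sigma>'(2) by simp
    qed
    ultimately have "holds M (agr n k l \<psi>) (a0 @ c @ map \<sigma> c)"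
      by (rule conjugate_same_germ_agree [OF f l dfd a0])
    then obtain v where v: "fun_val M k \<psi> c a0 v" "fun_val M k \<psi> y a0 v"
      using holds_agr [OF \<psi>, of a0 c y M] a0'(1) l yz(1) \<sigma>'(2) by (auto simp: tup_def)
    have "fun_val M k \<psi> y a0 z" "fun_val M k \<psi> c a0 z'" using holds z by (auto simp: fun_val_def)
    moreover have "partial_definable_function L M n k \<psi> y"
      using conjugate_partial_definable_function [OF f \<sigma>(1)] \<sigma>'(2) by simp
    ultimately have "z = v" "z' = v"
      using v partial_definable_functionD [OF _ a0'(3)] f by blast+
    then show False using holds(4) by simp
  qed
  then obtain \<theta> e where \<theta>: "(\<theta>, e) \<in> tp L M A (a0 @ c)"
    "\<And>y z. y \<in> tup (univ M) l \<Longrightarrow> z \<in> tup (univ M) (k + k) \<Longrightarrow>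
      \<not> (holds M \<theta> (a0 @ y @ e) \<and> holds M ?sep (y @ z @ a0 @ c @ d))"
    by blast
  have e: "set e \<subseteq> A" "\<theta> \<in> fml L (n + l + length e)" "holds M \<theta> (a0 @ c @ e)"
    using \<theta>(1) a0'(1) l by (auto simp: tp_def insts_def)
  let ?iso = "isolating n k l r (length e) j F \<psi> \<theta>"
  have iso: "?iso \<in> fml L (n + length (c @ e @ d))"
    using isolating_fml [OF F_fml \<psi> j e(2)] l d(2) by (simp add: add.assoc)
  have "holds M ?iso (a0 @ c @ e @ d)"
  proof (subst holds_isolating [OF F_fml \<psi> j e(2) a0'(1) l refl d(2)], intro ballI)
    fix y z z' assume "y \<in> tup (univ M) l" "z \<in> tup (univ M) k" "z' \<in> tup (univ M) k"
    moreover from this have "z @ z' \<in> tup (univ M) (k + k)" by (auto simp: tup_def)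
    ultimately show "\<not> (holds M \<theta> (a0 @ y @ e) \<and> holds M ?sep (y @ (z @ z') @ a0 @ c @ d))"
      using \<theta>(2) by blast
  qed
  moreover have "set (c @ e @ d) \<subseteq> A \<union> set c" "set (c @ e @ d) \<subseteq> univ M" using e(1) d(1) A c_set by auto
  \<comment> \<open>The parameters lie in \<open>A c\<close>, over which \<open>a0\<close> realizes
    \<open>p\<close>. What was shown in the monster model thus belongs to \<open>p\<close> and
    reaches \<open>a\<close> in \<open>N\<close>.\<close>
  ultimately have "(?iso, c @ e @ d) \<in> p" using real_holds [OF a0 _ _ iso] by simp
  moreover have "(\<theta>, c @ e) \<in> p"
    using real_holds [OF a0, of "c @ e" \<theta>] e A c_set l by (auto simp: add.assoc)
  ultimately have "holds N ?iso (a @ map h (c @ e @ d))" "holds N \<theta> (a @ map h (c @ e))"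
    using realizesD [OF a] by blast+
  then show thesis using that e by blast
qed

end
section \<open>Strong germs\<close>

text \<open>The value \<open>t\<close> of coordinate \<open>j\<close> of \<open>f\<^sub>y(x)\<close>, as a formula in variables \<open>t, x, s, w, y\<close>
  that also requires \<open>\<theta>(x, y, s)\<close>.\<close>

definition coord :: "nat \<Rightarrow> nat \<Rightarrow> nat \<Rightarrow> nat \<Rightarrow> nat \<Rightarrow> nat \<Rightarrow> ('f, 'r) fm \<Rightarrow> ('f, 'r) fm \<Rightarrow> ('f, 'r) fm" where
  "coord n k l r r' j \<psi> \<theta> = (let ls = [1, n, r', r, l, k]; m = 1 + n + r' + r + l in
     Exs m k (And (sel ls [1, 4, 2] \<theta>) (And (sel ls [1, 5, 4] \<psi>) (Eq (Var 0) (Var (m + j))))))"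

lemma
  assumes \<psi>: "\<psi> \<in> fml L (n + k + l)" and j: "j < k" and \<theta>: "\<theta> \<in> fml L (n + l + r')"
  shows coord_fml: "coord n k l r r' j \<psi> \<theta> \<in> fml L (1 + n + r' + r + l)"
    and holds_coord: "length x = n \<Longrightarrow> length s = r' \<Longrightarrow> length w = r \<Longrightarrow> length y = l \<Longrightarrow>
      holds M (coord n k l r r' j \<psi> \<theta>) (t # x @ s @ w @ y) \<longleftrightarrow>
      (\<exists>z\<in>tup (univ M) k. holds M \<theta> (x @ y @ s) \<and> holds M \<psi> (x @ z @ y) \<and> t = z ! j)"
proof -
  let ?ls = "[1, n, r', r, l, k]" and ?m = "1 + n + r' + r + l"
  let ?\<chi> = "And (sel ?ls [1, 4, 2] \<theta>) (And (sel ?ls [1, 5, 4] \<psi>) (Eq (Var 0) (Var (?m + j))))"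
  have "sel ?ls [1, 4, 2] \<theta> \<in> fml L (?m + k)" "sel ?ls [1, 5, 4] \<psi> \<in> fml L (?m + k)"
    using \<theta> \<psi> by (auto simp: add.assoc intro!: sel_fml)
  then have \<chi>: "?\<chi> \<in> fml L (?m + k)" using j by simp
  then show "coord n k l r r' j \<psi> \<theta> \<in> fml L ?m"
    unfolding coord_def Let_def by (rule Exs_fml)
  assume len: "length x = n" "length s = r'" "length w = r" "length y = l"
  let ?xs = "t # x @ s @ w @ y"
  have lx: "?m = length ?xs" using len by simp
  have "holds M (coord n k l r r' j \<psi> \<theta>) ?xs \<longleftrightarrow> (\<exists>z\<in>tup (univ M) k. holds M ?\<chi> (?xs @ z))"
    unfolding coord_def Let_def using holds_Exs [of ?\<chi> L ?xs k M] \<chi> unfolding lx by blast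
  also have "\<dots> \<longleftrightarrow> (\<exists>z\<in>tup (univ M) k. holds M \<theta> (x @ y @ s) \<and> holds M \<psi> (x @ z @ y) \<and> t = z ! j)"
  proof (rule bex_cong [OF refl])
    fix z assume "z \<in> tup (univ M) k"
    then have z: "length z = k" by (simp add: tup_def)
    have "holds M (sel ?ls [1, 4, 2] \<theta>) (?xs @ z) = holds M \<theta> (x @ y @ s)"
      using \<theta> len z holds_sel [of \<theta> L "[[t], x, s, w, y, z]" "[1, 4, 2]"] by (simp add: add.assoc)
    moreover have "holds M (sel ?ls [1, 5, 4] \<psi>) (?xs @ z) = holds M \<psi> (x @ z @ y)"
      using \<psi> len z holds_sel [of \<psi> L "[[t], x, s, w, y, z]" "[1, 5, 4]"] by (simp add: add.assoc)
    moreover have "(?xs @ z) ! (?m + j) = z ! j" unfolding lx by (rule nth_append_length_plus)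
    ultimately show "holds M ?\<chi> (?xs @ z) \<longleftrightarrow>
        holds M \<theta> (x @ y @ s) \<and> holds M \<psi> (x @ z @ y) \<and> t = z ! j"
      by (simp add: holds_Eq_Var)
  qed
  finally show "holds M (coord n k l r r' j \<psi> \<theta>) ?xs \<longleftrightarrow>
      (\<exists>z\<in>tup (univ M) k. holds M \<theta> (x @ y @ s) \<and> holds M \<psi> (x @ z @ y) \<and> t = z ! j)" .
qed

text \<open>The defining formula asks for a home tuple \<open>y\<close> whose class with
  \<open>d\<close> is the germ, which satisfies \<open>\<theta>\<close> together with
  \<open>a\<close> and \<open>e\<close>, and for which the tested element is coordinate
  \<open>j\<close> of a value at \<open>a\<close>. The tuple \<open>c\<close> witnesses this for
  \<open>v ! j\<close>, and \<open>isolating\<close> excludes any other element. Everything happens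
  inside \<open>N\<close>.\<close>

lemma coordinate_in_dcl:
  fixes L :: "('f, 'r) lang" and N :: "('f, 'r, 'a) struc"
  assumes F: "eq_formula L N (l + r) F" and \<psi>: "\<psi> \<in> fml L (n + k + l)" and j: "j < k"
    and \<theta>: "\<theta> \<in> fml L (n + l + r')"
    and a: "a \<in> tup (univ N) n" and c: "c \<in> tup (univ N) l" and e: "e \<in> tup (univ N) r'" and d: "d \<in> tup (univ N) r"
    and v: "fun_val N k \<psi> c a v"
    and \<theta>c: "holds N \<theta> (a @ c @ e)"
    and iso: "holds N (isolating n k l r r' j F \<psi> \<theta>) (a @ c @ e @ d)"
  shows "Real (v ! j) \<in> dcl_eq L N
    ({Imag (l + r) F (eclass N (l + r) F (c @ d))} \<union> Real ` set a \<union> Real ` (set e \<union> set d))"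
proof -
  define B where "B = {Imag (l + r) F (eclass N (l + r) F (c @ d))} \<union> Real ` set a \<union> Real ` (set e \<union> set d)"
  define germ where "germ = Imag (l + r) F (eclass N (l + r) F (c @ d))"
  let ?Q = "Quot (l + r) F"
  \<comment> \<open>The home variables below \<open>m\<close> hold the tested element,
    \<open>a\<close>, \<open>e\<close> and \<open>d\<close> in this order. The bound tuple
    \<open>y\<close> occupies the next \<open>l\<close> positions, and \<open>P\<close> projects
    \<open>y @ d\<close>.\<close>
  define m where "m = 1 + n + r' + r"
  define C where "C = coord n k l r r' j \<psi> \<theta>"
  define P where "P = EProj (l + r) F (map (EVar Home) ([m..<m + l] @ [1 + n + r'..<m]))"
  define \<chi> where "\<chi> = EExs m l (EAnd (tr C) (EEq P (EVar ?Q 0)))"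
  \<comment> \<open>Entry 0 is a placeholder that the tested element overwrites. Every quotient
    variable receives the germ, though at most index 0 of \<open>?Q\<close> occurs free.\<close>
  define \<rho> :: "('f, 'r) esort \<times> nat \<Rightarrow> ('f, 'r, 'a) eqel" where
    "\<rho> = (\<lambda>(S, i). if S = Home then Real ((v ! j # a @ e @ d) ! i) else germ)"
  have len: "length a = n" "length c = l" "length e = r'" "length d = r" "length v = k" and v': "v \<in> tup (univ N) k"
    using a c e d v by (auto simp: tup_def fun_val_def)
  have C: "C \<in> fml L (m + l)" using coord_fml [OF \<psi> j \<theta>] by (simp add: C_def m_def)
  have wf: "wf_efm L N \<chi>"
    using C F by (auto simp: \<chi>_def wf_EExs wf_tr P_def fml_def m_def)
  have "fv_efm \<chi> \<subseteq> Pair Home ` {..<m} \<union> {(?Q, 0)}"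
    using C unfolding \<chi>_def fv_EExs by (auto simp: fv_tr fml_def P_def m_def image_iff)
  moreover have "\<rho> (Home, i) \<in> B \<inter> edom N Home" if "i < m" "i \<noteq> 0" for i
  proof -
    have "(v ! j # a @ e @ d) ! i \<in> set (a @ e @ d)"
      using that len by (cases i) (auto simp: m_def simp del: set_append intro!: nth_mem)
    then show ?thesis using a e d by (auto simp: \<rho>_def B_def tup_def)
  qed
  moreover have "\<rho> (?Q, 0) \<in> B \<inter> edom N ?Q"
    using c d by (auto simp: \<rho>_def B_def germ_def tup_def intro!: imageI)
  ultimately have fv: "\<forall>(S, i)\<in>fv_efm \<chi> - {(Home, 0)}. \<rho> (S, i) \<in> B \<inter> edom N S" by fastforce
  have F_fml: "F \<in> fml L ((l + r) + (l + r))" using F by (rule eq_formula_fml)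
  have main: "esat N (\<rho>((Home, 0) := Real t)) \<chi> \<longleftrightarrow> t = v ! j" if "t \<in> univ N" for t
  proof -
    let ?\<rho> = "\<rho>((Home, 0) := Real t)"
    have env: "eupd ?\<rho> m y (Home, i) = Real ((t # a @ e @ d @ y) ! i)" if "i < m + l" "length y = l" for i y
    proof (cases "i < m")
      case True
      then show ?thesis using len by (cases i) (auto simp: eupd_def \<rho>_def m_def nth_append)
    next
      case False
      have "(t # a @ e @ d @ y) ! i = ((t # a @ e @ d) @ y) ! (length (t # a @ e @ d) + (i - m))"
        using False len by (simp add: m_def)
      also have "\<dots> = y ! (i - m)" by (rule nth_append_length_plus)
      finally show ?thesis using False that by (simp add: eupd_def)
    qed
    have body: "esat N (eupd ?\<rho> m y) (EAnd (tr C) (EEq P (EVar ?Q 0))) \<longleftrightarrow>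
        (\<exists>z\<in>tup (univ N) k. holds N \<theta> (a @ y @ e) \<and> holds N \<psi> (a @ z @ y) \<and> t = z ! j) \<and>
        holds N F ((y @ d) @ (c @ d))" if y: "y \<in> tup (univ N) l" for y
    proof -
      have ylen: "length y = l" using y by (simp add: tup_def)
      have real: "\<exists>u. eupd ?\<rho> m y (Home, i) = Real u" for i
        by (auto simp: eupd_def \<rho>_def)
      then have "esat N (eupd ?\<rho> m y) (tr C) \<longleftrightarrow> sat N (\<lambda>i. the_real (eupd ?\<rho> m y (Home, i))) C"
        by (intro esat_tr) (metis eqel.sel)
      also have "\<dots> \<longleftrightarrow> holds N C (t # a @ e @ d @ y)"
        using C len ylen env by (intro holds_eq_sat [where L = L, symmetric]) (auto simp: m_def add.assoc)
      also have "\<dots> \<longleftrightarrow> (\<exists>z\<in>tup (univ N) k. holds N \<theta> (a @ y @ e) \<and> holds N \<psi> (a @ z @ y) \<and> t = z ! j)"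
        unfolding C_def using len ylen by (intro holds_coord [OF \<psi> j \<theta>]) auto
      finally have 1: "esat N (eupd ?\<rho> m y) (tr C) \<longleftrightarrow>
        (\<exists>z\<in>tup (univ N) k. holds N \<theta> (a @ y @ e) \<and> holds N \<psi> (a @ z @ y) \<and> t = z ! j)" .
      have "map (\<lambda>i. the_real (eupd ?\<rho> m y (Home, i))) [m..<m + l] = y"
        using ylen by (intro nth_equalityI) (auto simp: eupd_def)
      moreover have "map (\<lambda>i. the_real (eupd ?\<rho> m y (Home, i))) [1 + n + r'..<m] = d"
      proof (rule nth_equalityI)
        fix i assume "i < length (map (\<lambda>i. the_real (eupd ?\<rho> m y (Home, i))) [1 + n + r'..<m])"
        then have i: "i < m - (1 + n + r')" by (simp only: length_map length_upt)
        then have "[1 + n + r'..<m] ! i = 1 + n + r' + i" by (simp only: nth_upt)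
        moreover have "eupd ?\<rho> m y (Home, 1 + n + r' + i) = Real ((t # a @ e @ d @ y) ! (1 + n + r' + i))"
          using i ylen by (intro env) auto
        moreover have "(t # a @ e @ d @ y) ! (1 + n + r' + i) = d ! i"
          using i len by (simp add: m_def nth_append)
        ultimately show "map (\<lambda>i. the_real (eupd ?\<rho> m y (Home, i))) [1 + n + r'..<m] ! i = d ! i"
          using i by (simp only: nth_map length_upt eqel.sel)
      qed (simp only: length_map length_upt m_def len)
      ultimately have "etval N (eupd ?\<rho> m y) P = Imag (l + r) F (eclass N (l + r) F (y @ d))"
        by (simp add: P_def comp_def)
      moreover have "eupd ?\<rho> m y (?Q, 0) = germ" by (simp add: eupd_def \<rho>_def)
      moreover have "y @ d \<in> tup (univ N) (l + r)" "c @ d \<in> tup (univ N) (l + r)"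
        using y c d by (auto simp: tup_def)
      ultimately show ?thesis using 1 eclass_eq [OF F] by (simp add: germ_def)
    qed
    show ?thesis
    proof
      assume "esat N ?\<rho> \<chi>"
      then obtain y where y: "y \<in> tup (univ N) l" "esat N (eupd ?\<rho> m y) (EAnd (tr C) (EEq P (EVar ?Q 0)))"
        unfolding \<chi>_def esat_EExs by blast
      then obtain z where z: "z \<in> tup (univ N) k" "holds N \<theta> (a @ y @ e)" "holds N \<psi> (a @ z @ y)" "t = z ! j"
        "holds N F ((y @ d) @ (c @ d))"
        using body by blast
      \<comment> \<open>The value \<open>z\<close> at \<open>y\<close> is compared with the value
        \<open>v\<close> at \<open>c\<close>: the two classes coincide, so a difference in
        coordinate \<open>j\<close> is ruled out.\<close>
      have "\<not> holds N (separating n k l r j F \<psi>) (y @ (z @ v) @ a @ c @ d)"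
        using iso holds_isolating [OF F_fml \<psi> j \<theta> len(1-4), of N] y(1) z(1,2) v' by blast
      then show "t = v ! j"
        using holds_separating [OF F_fml \<psi> j, of y z v a c d N] y(1) z v len by (auto simp: tup_def fun_val_def)
    next
      assume "t = v ! j"
      moreover have "holds N \<psi> (a @ v @ c)" using v by (simp add: fun_val_def)
      moreover have "holds N F ((c @ d) @ (c @ d))"
        using c d by (intro eq_formula_refl [OF F]) (auto simp: tup_def)
      ultimately have "esat N (eupd ?\<rho> m c) (EAnd (tr C) (EEq P (EVar ?Q 0)))"
        unfolding body [OF c] using v' \<theta>c by blast
      then show "esat N ?\<rho> \<chi>" unfolding \<chi>_def esat_EExs using c by blast
    qed
  qed
  have vj: "v ! j \<in> univ N" using v' j by (auto simp: tup_def)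
  have "\<forall>y\<in>edom N Home. esat N (\<rho>((Home, 0) := y)) \<chi> \<longleftrightarrow> y = Real (v ! j)"
    using main by auto
  then have "\<exists>S \<chi> \<rho>. is_sort L N S \<and> Real (v ! j) \<in> edom N S \<and> wf_efm L N \<chi> \<and>
     (\<forall>(S', i)\<in>fv_efm \<chi> - {(S, 0)}. \<rho> (S', i) \<in> B \<inter> edom N S') \<and>
     (\<forall>y\<in>edom N S. esat N (\<rho>((S, 0) := y)) \<chi> \<longleftrightarrow> y = Real (v ! j))"
    using wf fv vj by (intro exI [of _ Home] exI [of _ \<chi>] exI [of _ \<rho>]) simp
  then show ?thesis unfolding dcl_eq_def B_def by simp
qed

lemma dcl_eq_mono: "B \<subseteq> C \<Longrightarrow> dcl_eq L M B \<subseteq> dcl_eq L M C"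
  unfolding dcl_eq_def by blast

theorem theorem2p2:
  fixes L :: "('f, 'r) lang" and T :: "('f, 'r) fm set" and \<kappa> :: "'k rel"
    and \<CC> :: "('f, 'r, 'a) struc" and A :: "'a set"
    and n k :: nat and p :: "(('f, 'r) fm \<times> 'a list) set"
    and \<psi> :: "('f, 'r) fm" and c :: "'a list"
  assumes "complete_theory L T"
    and "monster_model L T \<kappa> \<CC>"
    and "A \<subseteq> univ \<CC>" and "small \<kappa> A"
    and "p \<in> types L \<CC> n (univ \<CC>)"
    and "generically_stable L \<CC> n A p"
    and "partial_definable_function L \<CC> n k \<psi> c"
    and "defined_on TYPE('b) L \<CC> n p k \<psi> c"
  shows "strong_germ TYPE('b) L \<CC> n A p k \<psi> c"
  unfolding strong_germ_def
proof (intro allI impI, elim conjE)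
  interpret generically_stable_type L T \<kappa> \<CC> A n p
    by unfold_locales (use assms in auto)
  fix N :: "('f, 'r, 'b) struc" and h a v
  assume ext: "elementary_ext L \<CC> N h" and a: "realizes N h n p a" and v: "fun_val N k \<psi> (map h c) a v"
  define l where "l = length c"
  note f = assms(7)
  have l: "length c = l" by (simp add: l_def)
  have \<psi>: "\<psi> \<in> fml L (n + k + l)" and c: "c \<in> tup (univ \<CC>) l"
    using f l by (auto simp: partial_definable_function_def tup_def)
  \<comment> \<open>Comparing \<open>f_c\<close> with itself at \<open>a\<close>, where it has the
    value \<open>v\<close>, records in \<open>p\<close> that it is defined.\<close>
  have "germ_rel TYPE('b) L \<CC> n p k \<psi> c c" unfolding germ_rel_def using ext a v by blast
  then have dfd: "(agr n k l \<psi>, c @ c) \<in> p" using germ_rel_iff [OF ext a \<psi> c c] by simp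
  have "Real ` set v \<subseteq> dcl_eq L N ({eq_map N h e} \<union> Real ` set a \<union> Real ` h ` A)"
    if is_germ: "is_germ TYPE('b) L \<CC> n A p k \<psi> c e" for e
  proof -
    obtain F d where d: "set d \<subseteq> A" and F: "eq_formula L \<CC> (l + length d) F"
      and germ: "\<And>c1 c2. realizes \<CC> id l (tp L \<CC> A c) c1 \<Longrightarrow> realizes \<CC> id l (tp L \<CC> A c) c2 \<Longrightarrow>
        germ_rel TYPE('b) L \<CC> n p k \<psi> c1 c2 \<longleftrightarrow> holds \<CC> F ((c1 @ d) @ (c2 @ d))"
      and e: "e = Imag (l + length d) F (eclass \<CC> (l + length d) F (c @ d))"
      using is_germ unfolding is_germ_def Let_def l_def by blast
    have tup_h: "map h u \<in> tup (univ N) (length u)" if "set u \<subseteq> A \<union> set c" for u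
      using that assms(3) c by (intro elementary_ext_tup [OF ext]) (auto simp: tup_def)
    have e': "eq_map N h e = Imag (l + length d) F (eclass N (l + length d) F (map h c @ map h d))"
      unfolding e using eq_map_eclass [OF ext F, of "c @ d"] c d assms(3) by (auto simp: tup_def)
    have "Real (v ! j) \<in> dcl_eq L N ({eq_map N h e} \<union> Real ` set a \<union> Real ` h ` A)" if j: "j < k" for j
    proof (rule germ_isolating [OF ext a f l dfd d refl F germ j])
      fix \<theta> s assume s: "set s \<subseteq> A" and \<theta>: "\<theta> \<in> fml L (n + l + length s)"
        and holds: "holds N \<theta> (a @ map h (c @ s))"
          "holds N (isolating n k l (length d) (length s) j F \<psi> \<theta>) (a @ map h (c @ s @ d))"
      have "Real (v ! j) \<in> dcl_eq L N
          ({eq_map N h e} \<union> Real ` set a \<union> Real ` (set (map h s) \<union> set (map h d)))"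
        unfolding e'
      proof (rule coordinate_in_dcl [OF elementary_ext_eq_formula [OF ext F] \<psi> j \<theta>])
        show "a \<in> tup (univ N) n" using a by (simp add: realizes_def)
        show "map h c \<in> tup (univ N) l" "map h s \<in> tup (univ N) (length s)" "map h d \<in> tup (univ N) (length d)"
          using tup_h [of c] tup_h [of s] tup_h [of d] s d l by auto
        show "fun_val N k \<psi> (map h c) a v" by fact
      qed (use holds in simp_all)
      \<comment> \<open>The tuple \<open>s\<close> depends on \<open>j\<close>; enlarging the
        parameters to the image of \<open>A\<close> makes the base the same for all
        coordinates.\<close>
      moreover have "{eq_map N h e} \<union> Real ` set a \<union> Real ` (set (map h s) \<union> set (map h d)) \<subseteq>
          {eq_map N h e} \<union> Real ` set a \<union> Real ` h ` A"
        using s d by (intro Un_mono image_mono) (auto intro!: image_mono)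
      ultimately show ?thesis using dcl_eq_mono by blast
    qed
    moreover have "length v = k" using v by (simp add: fun_val_def tup_def)
    ultimately show ?thesis by (auto simp: in_set_conv_nth)
  qed
  then show "(\<exists>e. is_germ TYPE('b) L \<CC> n A p k \<psi> c e) \<and>
      (\<forall>e. is_germ TYPE('b) L \<CC> n A p k \<psi> c e \<longrightarrow>
        Real ` set v \<subseteq> dcl_eq L N ({eq_map N h e} \<union> Real ` set a \<union> Real ` h ` A))"
    using ex_germ [OF ext a f l dfd] by blast
qed
end
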